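(* The following hold. (1) For every cardinal $\mu < \aleph_\omega$, $Nt(PR(A_{\omega_1}(\mu))) \leq \aleph_1$. (2) $Nt(PR(A_{\omega_1}(\aleph_\omega))) \leq \aleph_4$. (3) If Chang's Conjecture for $\aleph_\omega$ holds then $Nt(PR(A_{\omega_1}(\aleph_\omega))) \geq \aleph_2$. (4) If Martin's Maximum holds then $Nt(PR(A_{\omega_1}(\aleph_\omega))) \leq \aleph_2$.
   Context: $A_{\omega_1}(\mu)$ is the space on $\mu\cup\{p\}$ (with $p\notin\mu$) in which every point of $\mu$ is isolated and the basic neighbourhoods of $p$ are the sets $\{p\}\cup(\mu\setminus C)$ with $C\subseteq\mu$ countable. For a space $(X,\tau)$, the Pixley-Roy hyperspace $PR(X)$ is the set $[X]^{<\omega}$ of finite subsets of $X$ with the topology having as a base the sets $[F,U]=\{G\in PR(X): F\subset G\subset U\}$, for $F\in PR(X)$ and $U\in\tau$. A family $\mathcal{B}$ of sets is $\kappa^{op}$-like (with respect to $\supseteq$) if every bounded subset of $(\mathcal{B},\supseteq)$ has size strictly less than $\kappa$, i.e. for every $B\in\mathcal{B}$, the set $\{C\in\mathcal{B}:B\subseteq C\}$ has cardinality less than $\kappa$. The Noetherian type $Nt(Z)$ of a space $Z$ is the minimum cardinal $\kappa$ such that $Z$ has a $\kappa^{op}$-like base. For cardinals $\lambda,\kappa,\mu,\tau$, $(\lambda,\kappa)\twoheadrightarrow(\mu,\tau)$ means that for every structure $(A,B,\dots)$ with countable signature (where $B\subseteq A$ is the interpretation of a unary predicate) such that $|A|=\lambda$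 and $|B|=\kappa$, there is an elementary substructure $(A',B',\dots)\prec(A,B,\dots)$ with $|A'|=\mu$ and $|B'|=\tau$. Chang's Conjecture for $\aleph_\omega$ is the assertion $(\aleph_{\omega+1},\aleph_\omega)\twoheadrightarrow(\aleph_1,\aleph_0)$. *)

theory Defs
  imports "HOL-Analysis.Analysis"
begin

no_notation Set_Algebras.elt_set_eq (infix \<open>=o\<close> 50)
unbundle cardinal_syntax

section \<open>Alephs\<close>

abbreviation aleph1 :: "nat set rel"
  where "aleph1 \<equiv> cardSuc natLeq"

abbreviation aleph2 :: "nat set set rel"
  where "aleph2 \<equiv> cardSuc aleph1"

abbreviation aleph4 :: "nat set set set set rel"
  where "aleph4 \<equiv> cardSuc (cardSuc aleph2)"

text \<open>
  \<open>cardSuc\<close> raises the type, so the sequence of all \<open>\<aleph>\<^sub>n\<close> cannot be formed by iterating it.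
  The cardinals are therefore described by the sets, within one type, that have them as size.
\<close>

primrec has_card_aleph :: "nat \<Rightarrow> 'a set \<Rightarrow> bool" where
  "has_card_aleph 0 A \<longleftrightarrow> |A| =o natLeq"
| "has_card_aleph (Suc n) A \<longleftrightarrow> (\<exists>B\<subseteq>A. has_card_aleph n B \<and> |A| =o cardSuc |B| )"

text \<open>\<open>\<aleph>\<^sub>\<omega>\<close> is the least cardinal that is at least every \<open>\<aleph>\<^sub>n\<close>.\<close>

definition above_alephs :: "'a set \<Rightarrow> bool"
  where "above_alephs A \<longleftrightarrow> (\<forall>n. \<exists>B\<subseteq>A. has_card_aleph n B)"

definition has_card_aleph_omega :: "'a set \<Rightarrow> bool"
  where "has_card_aleph_omega A \<longleftrightarrow>
    above_alephs A \<and> (\<forall>C :: 'a set. above_alephs C \<longrightarrow> |A| \<le>o |C| )"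

section \<open>Bases and Noetherian type\<close>

definition is_base :: "'z topology \<Rightarrow> 'z set set \<Rightarrow> bool"
  where "is_base Z \<B> \<longleftrightarrow> openin Z = arbitrary union_of (\<lambda>U. U \<in> \<B>)"

definition op_like :: "'k rel \<Rightarrow> 'z set set \<Rightarrow> bool"
  where "op_like \<kappa> \<B> \<longleftrightarrow> (\<forall>B\<in>\<B>. |{C \<in> \<B>. B \<subseteq> C}| <o \<kappa>)"

definition has_op_like_base :: "'z topology \<Rightarrow> 'k rel \<Rightarrow> bool"
  where "has_op_like_base Z \<kappa> \<longleftrightarrow> (\<exists>\<B>. is_base Z \<B> \<and> op_like \<kappa> \<B>)"

text \<open>
  The minimum is taken over the cardinals living on \<^typ>\<open>'z set set\<close>: the topology of a space on
  \<^typ>\<open>'z\<close> has at most \<open>|UNIV :: 'z set set|\<close> elements, so such a cardinal exists, and by lemma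
  \<open>noetherian_type_le_iff\<close> below no cardinal on any other type does better.
\<close>

definition noetherian_type :: "'z topology \<Rightarrow> 'z set set rel"
  where "noetherian_type Z = (SOME \<kappa>. Card_order \<kappa> \<and> has_op_like_base Z \<kappa> \<and>
    (\<forall>\<kappa>' :: 'z set set rel. Card_order \<kappa>' \<and> has_op_like_base Z \<kappa>' \<longrightarrow> \<kappa> \<le>o \<kappa>'))"

lemma has_op_like_base_mono:
  assumes "has_op_like_base Z \<kappa>" "\<kappa> \<le>o \<kappa>'"
  shows "has_op_like_base Z \<kappa>'"
  using assms unfolding has_op_like_base_def op_like_def by (meson ordLess_ordLeq_trans)

lemma noetherian_type:
  fixes Z :: "'z topology"
  shows "Card_order (noetherian_type Z)" (is ?A)
    and "has_op_like_base Z (noetherian_type Z)" (is ?B)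
    and "\<And>\<kappa> :: 'z set set rel. Card_order \<kappa> \<Longrightarrow> has_op_like_base Z \<kappa> \<Longrightarrow> noetherian_type Z \<le>o \<kappa>"
proof -
  let ?R = "{\<kappa> :: 'z set set rel. Card_order \<kappa> \<and> has_op_like_base Z \<kappa>}"
  have "is_base Z {U. openin Z U}"
    unfolding is_base_def openin_topology_base_unique by blast
  moreover have "|\<B>| <o |UNIV :: 'z set set set|" for \<B> :: "'z set set"
    using ordLeq_ordLess_trans[OF card_of_mono1[OF subset_UNIV] card_of_Pow[of UNIV]]
    by (simp add: Pow_UNIV)
  ultimately have "has_op_like_base Z |UNIV :: 'z set set set|"
    unfolding has_op_like_base_def op_like_def by blast
  then have "|UNIV :: 'z set set set| \<in> ?R"
    by (simp add: card_of_Card_order)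
  then obtain \<kappa> where "\<kappa> \<in> ?R" "\<forall>\<kappa>'\<in>?R. \<kappa> \<le>o \<kappa>'"
    using exists_minim_Card_order[of ?R] by blast
  then have "\<exists>\<kappa> :: 'z set set rel. Card_order \<kappa> \<and> has_op_like_base Z \<kappa> \<and>
    (\<forall>\<kappa>' :: 'z set set rel. Card_order \<kappa>' \<and> has_op_like_base Z \<kappa>' \<longrightarrow> \<kappa> \<le>o \<kappa>')"
    by blast
  from someI_ex[OF this, folded noetherian_type_def]
  show ?A ?B and "\<And>\<kappa> :: 'z set set rel. Card_order \<kappa> \<Longrightarrow> has_op_like_base Z \<kappa> \<Longrightarrow> noetherian_type Z \<le>o \<kappa>"
    by blast+
qed

lemma noetherian_type_le_iff:
  fixes Z :: "'z topology" and \<kappa> :: "'k rel"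
  assumes \<kappa>: "Card_order \<kappa>"
  shows "noetherian_type Z \<le>o \<kappa> \<longleftrightarrow> has_op_like_base Z \<kappa>"
proof
  assume "noetherian_type Z \<le>o \<kappa>"
  then show "has_op_like_base Z \<kappa>"
    using noetherian_type(2) has_op_like_base_mono by blast
next
  assume base: "has_op_like_base Z \<kappa>"
  have wo: "Well_order \<kappa>" "Well_order (noetherian_type Z)"
    using \<kappa> noetherian_type(1)[of Z] by (auto simp: card_order_on_def)
  show "noetherian_type Z \<le>o \<kappa>"
  proof (rule ccontr)
    assume "\<not> noetherian_type Z \<le>o \<kappa>"
    then have less: "\<kappa> <o noetherian_type Z"
      using wo not_ordLeq_iff_ordLess by blast
    then have "|Field \<kappa>| \<le>o noetherian_type Z"
      by (rule ordIso_ordLeq_trans[OF card_of_Field_ordIso[OF \<kappa>] ordLess_imp_ordLeq])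
    from iffD1[OF internalize_card_of_ordLeq this]
    obtain D :: "'z set set set" where "|Field \<kappa>| =o |D|"
      by blast
    from ordIso_transitive[OF ordIso_symmetric[OF card_of_Field_ordIso[OF \<kappa>]] this]
    have D: "\<kappa> =o |D|" .
    then have "\<kappa> \<le>o |D|"
      using ordIso_iff_ordLeq by blast
    from has_op_like_base_mono[OF base this]
    have "has_op_like_base Z |D|" .
    then have "noetherian_type Z \<le>o |D|"
      by (intro noetherian_type(3) card_of_Card_order)
    then have "noetherian_type Z \<le>o \<kappa>"
      by (rule ordLeq_ordIso_trans[OF _ ordIso_symmetric[OF D]])
    then show False
      using less not_ordLess_ordLeq by blast
  qed
qed

section \<open>The spaces\<close>

text \<open>\<open>None\<close> is the point \<open>p\<close>, and \<open>M\<close> is a set of size \<open>\<mu>\<close>.\<close>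

definition A_omega1_base :: "'a set \<Rightarrow> 'a option set set"
  where "A_omega1_base M =
    {{Some x} | x. x \<in> M} \<union> {insert None (Some ` (M - C)) | C. C \<subseteq> M \<and> countable C}"

definition A_omega1 :: "'a set \<Rightarrow> 'a option topology"
  where "A_omega1 M = topology (arbitrary union_of (\<lambda>U. U \<in> A_omega1_base M))"

lemma is_base_A_omega1: "is_base (A_omega1 M) (A_omega1_base M)"
proof -
  have *: "(arbitrary union_of (\<lambda>U. U \<in> A_omega1_base M)) (S \<inter> T)"
    if S: "S \<in> A_omega1_base M" and T: "T \<in> A_omega1_base M" for S T
  proof (cases "None \<in> S \<and> None \<in> T")
    case True
    then obtain C D where CD: "C \<subseteq> M" "countable C" "S = insert None (Some ` (M - C))"
        "D \<subseteq> M" "countable D" "T = insert None (Some ` (M - D))"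
      using S T unfolding A_omega1_base_def by blast
    then have "S \<inter> T = insert None (Some ` (M - (C \<union> D)))" "C \<union> D \<subseteq> M" "countable (C \<union> D)"
      by auto
    then have "S \<inter> T \<in> A_omega1_base M"
      unfolding A_omega1_base_def by blast
    then show ?thesis
      by (simp add: arbitrary_union_of_inc)
  next
    case False
    then have "S \<inter> T \<subseteq> Some ` M"
      using S T by (auto simp: A_omega1_base_def)
    then have "(\<lambda>z. {z}) ` (S \<inter> T) \<subseteq> A_omega1_base M" "\<Union>((\<lambda>z. {z}) ` (S \<inter> T)) = S \<inter> T"
      by (auto simp: A_omega1_base_def)
    then show ?thesis
      unfolding union_of_def arbitrary_def by blast
  qed
  then have "istopology (arbitrary union_of (\<lambda>U. U \<in> A_omega1_base M))"
    by (auto simp: istopology_base_eq)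
  then show ?thesis
    by (simp add: is_base_def A_omega1_def)
qed

definition PR_basic :: "'x topology \<Rightarrow> 'x set \<Rightarrow> 'x set \<Rightarrow> 'x set set"
  where "PR_basic X F U = {G. finite G \<and> G \<subseteq> topspace X \<and> F \<subseteq> G \<and> G \<subseteq> U}"

definition PR_base :: "'x topology \<Rightarrow> 'x set set set"
  where "PR_base X = {PR_basic X F U | F U. finite F \<and> F \<subseteq> topspace X \<and> openin X U}"

definition PR :: "'x topology \<Rightarrow> 'x set topology"
  where "PR X = topology (arbitrary union_of (\<lambda>W. W \<in> PR_base X))"

lemma is_base_PR: "is_base (PR X) (PR_base X)"
proof -
  have *: "PR_basic X F U \<inter> PR_basic X G V = PR_basic X (F \<union> G) (U \<inter> V)" for F G U V
    by (auto simp: PR_basic_def)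
  have "S \<inter> T \<in> PR_base X" if "S \<in> PR_base X" "T \<in> PR_base X" for S T
  proof -
    obtain F U G V where "S = PR_basic X F U" "T = PR_basic X G V"
        "finite (F \<union> G)" "F \<union> G \<subseteq> topspace X" "openin X (U \<inter> V)"
      using \<open>S \<in> PR_base X\<close> \<open>T \<in> PR_base X\<close> unfolding PR_base_def by blast
    with * show ?thesis
      unfolding PR_base_def by blast
  qed
  then have "istopology (arbitrary union_of (\<lambda>W. W \<in> PR_base X))"
    by (intro istopology_base) auto
  then show ?thesis
    by (simp add: is_base_def PR_def)
qed

lemma topspace_PR: "topspace (PR X) = {F. finite F \<and> F \<subseteq> topspace X}"
proof -
  have *: "(\<forall>V. V \<in> PR_base X \<longrightarrow> openin (PR X) V) \<and>
      (\<forall>W F. openin (PR X) W \<and> F \<in> W \<longrightarrow> (\<exists>V. V \<in> PR_base X \<and> F \<in> V \<and> V \<subseteq> W))"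
    using is_base_PR[of X] unfolding is_base_def openin_topology_base_unique .
  show ?thesis
  proof (intro set_eqI iffI)
    fix F assume "F \<in> topspace (PR X)"
    then obtain V where "V \<in> PR_base X" "F \<in> V"
      using * openin_topspace by blast
    then show "F \<in> {F. finite F \<and> F \<subseteq> topspace X}"
      unfolding PR_base_def PR_basic_def by blast
  next
    fix F assume F: "F \<in> {F. finite F \<and> F \<subseteq> topspace X}"
    then have "PR_basic X F (topspace X) \<in> PR_base X"
      unfolding PR_base_def by blast
    then have "openin (PR X) (PR_basic X F (topspace X))"
      using * by blast
    moreover have "F \<in> PR_basic X F (topspace X)"
      using F by (simp add: PR_basic_def)
    ultimately show "F \<in> topspace (PR X)"
      using openin_subset by blast
  qed
qed

section \<open>First-order structures and Chang's Conjecture\<close>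

text \<open>
  Symbols are natural numbers, so every signature is countable.  A signature lists its function and
  relation symbols together with their arities; constants are the function symbols of arity 0.
\<close>

record signature =
  funs :: "(nat \<times> nat) set"
  rels :: "(nat \<times> nat) set"

datatype tm = Var nat | App nat "tm list"

datatype fm = Eq tm tm | Rel nat "tm list" | Neg fm | Conj fm fm | Exi nat fm

primrec wf_tm :: "signature \<Rightarrow> tm \<Rightarrow> bool" where
  "wf_tm \<Sigma> (Var n) \<longleftrightarrow> True"
| "wf_tm \<Sigma> (App f ts) \<longleftrightarrow> (f, length ts) \<in> funs \<Sigma> \<and> list_all (wf_tm \<Sigma>) ts"

primrec wf_fm :: "signature \<Rightarrow> fm \<Rightarrow> bool" where
  "wf_fm \<Sigma> (Eq s t) \<longleftrightarrow> wf_tm \<Sigma> s \<and> wf_tm \<Sigma> t"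
| "wf_fm \<Sigma> (Rel R ts) \<longleftrightarrow> (R, length ts) \<in> rels \<Sigma> \<and> list_all (wf_tm \<Sigma>) ts"
| "wf_fm \<Sigma> (Neg \<phi>) \<longleftrightarrow> wf_fm \<Sigma> \<phi>"
| "wf_fm \<Sigma> (Conj \<phi> \<psi>) \<longleftrightarrow> wf_fm \<Sigma> \<phi> \<and> wf_fm \<Sigma> \<psi>"
| "wf_fm \<Sigma> (Exi n \<phi>) \<longleftrightarrow> wf_fm \<Sigma> \<phi>"

record 'b struct =
  univ :: "'b set"
  fun_int :: "nat \<Rightarrow> 'b list \<Rightarrow> 'b"
  rel_int :: "nat \<Rightarrow> 'b list \<Rightarrow> bool"

definition is_struct :: "signature \<Rightarrow> 'b struct \<Rightarrow> bool"
  where "is_struct \<Sigma> \<AA> \<longleftrightarrow> univ \<AA> \<noteq> {} \<and>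
    (\<forall>(f, n) \<in> funs \<Sigma>. \<forall>xs. set xs \<subseteq> univ \<AA> \<and> length xs = n \<longrightarrow> fun_int \<AA> f xs \<in> univ \<AA>)"

primrec eval_tm :: "'b struct \<Rightarrow> (nat \<Rightarrow> 'b) \<Rightarrow> tm \<Rightarrow> 'b" where
  "eval_tm \<AA> v (Var n) = v n"
| "eval_tm \<AA> v (App f ts) = fun_int \<AA> f (map (eval_tm \<AA> v) ts)"

primrec sat :: "'b struct \<Rightarrow> (nat \<Rightarrow> 'b) \<Rightarrow> fm \<Rightarrow> bool" where
  "sat \<AA> v (Eq s t) \<longleftrightarrow> eval_tm \<AA> v s = eval_tm \<AA> v t"
| "sat \<AA> v (Rel R ts) \<longleftrightarrow> rel_int \<AA> R (map (eval_tm \<AA> v) ts)"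
| "sat \<AA> v (Neg \<phi>) \<longleftrightarrow> \<not> sat \<AA> v \<phi>"
| "sat \<AA> v (Conj \<phi> \<psi>) \<longleftrightarrow> sat \<AA> v \<phi> \<and> sat \<AA> v \<psi>"
| "sat \<AA> v (Exi n \<phi>) \<longleftrightarrow> (\<exists>x\<in>univ \<AA>. sat \<AA> (v(n := x)) \<phi>)"

text \<open>A substructure is given by its universe, as it inherits the interpretations.\<close>

definition elementary_sub :: "signature \<Rightarrow> 'b set \<Rightarrow> 'b struct \<Rightarrow> bool"
  where "elementary_sub \<Sigma> A' \<AA> \<longleftrightarrow> A' \<subseteq> univ \<AA> \<and> is_struct \<Sigma> (\<AA>\<lparr>univ := A'\<rparr>) \<and>
    (\<forall>\<phi> v. wf_fm \<Sigma> \<phi> \<and> range v \<subseteq> A' \<longrightarrow> (sat (\<AA>\<lparr>univ := A'\<rparr>) v \<phi> \<longleftrightarrow> sat \<AA> v \<phi>))"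

definition pred_int :: "'b struct \<Rightarrow> nat \<Rightarrow> 'b set"
  where "pred_int \<AA> P = {x \<in> univ \<AA>. rel_int \<AA> P [x]}"

text \<open>
  The two-headed arrow relation from \<open>(\<theta>, \<kappa>)\<close> to \<open>(\<mu>, \<tau>)\<close>.  Up to isomorphism,
  every structure of size \<open>\<theta>\<close> lives on the type of the elements of \<open>\<theta>\<close>.
\<close>

definition chang_arrow :: "'b rel \<Rightarrow> 'c rel \<Rightarrow> 'd rel \<Rightarrow> 'e rel \<Rightarrow> bool"
  where "chang_arrow \<theta> \<kappa> \<mu> \<tau> \<longleftrightarrow>
    (\<forall>\<Sigma> (\<AA> :: 'b struct) P. is_struct \<Sigma> \<AA> \<and> (P, 1) \<in> rels \<Sigma> \<and>
      |univ \<AA>| =o \<theta> \<and> |pred_int \<AA> P| =o \<kappa> \<longrightarrow>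
      (\<exists>A'. elementary_sub \<Sigma> A' \<AA> \<and> |A'| =o \<mu> \<and> |pred_int (\<AA>\<lparr>univ := A'\<rparr>) P| =o \<tau>))"

text \<open>To be used with a set \<open>K\<close> of size \<open>\<aleph>\<^sub>\<omega>\<close>.\<close>

definition chang_conjecture_for :: "'a set \<Rightarrow> bool"
  where "chang_conjecture_for K \<longleftrightarrow> chang_arrow (cardSuc (card_of K)) (card_of K) aleph1 natLeq"

section \<open>Martin's Maximum\<close>

text \<open>\<open>aleph1\<close> is also used as the ordinal \<open>\<omega>\<^sub>1\<close>: it is a well-order of least uncountable type.\<close>

definition club_omega1 :: "nat set set \<Rightarrow> bool"
  where "club_omega1 C \<longleftrightarrow> C \<subseteq> Field aleph1 \<and>
    (\<forall>a\<in>Field aleph1. \<exists>b\<in>aboveS aleph1 a. b \<in> C) \<and>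
    (\<forall>d\<in>Field aleph1. underS aleph1 d \<noteq> {} \<and>
      (\<forall>a\<in>underS aleph1 d. \<exists>b\<in>aboveS aleph1 a \<inter> underS aleph1 d. b \<in> C) \<longrightarrow> d \<in> C)"

definition stationary_omega1 :: "nat set set \<Rightarrow> bool"
  where "stationary_omega1 S \<longleftrightarrow> S \<subseteq> Field aleph1 \<and> (\<forall>C. club_omega1 C \<longrightarrow> (\<exists>a\<in>S. a \<in> C))"

text \<open>
  A forcing notion is a nonempty preorder \<open>r\<close> on \<open>Field r\<close>, where \<open>(q, p) \<in> r\<close> means that \<open>q\<close> extends
  \<open>p\<close>.  Statements of the forcing language are represented by the predicate of the conditions that
  force them, built up by the usual recursion for the forcing relation.  Quantifiers range over
  (check names of) sets of the ground model.
\<close>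

definition forcing_notion :: "'p rel \<Rightarrow> bool"
  where "forcing_notion r \<longleftrightarrow> r \<noteq> {} \<and> Preorder r"

definition f_all :: "'x set \<Rightarrow> ('x \<Rightarrow> 'p \<Rightarrow> bool) \<Rightarrow> 'p \<Rightarrow> bool"
  where "f_all A \<phi> p \<longleftrightarrow> (\<forall>x\<in>A. \<phi> x p)"

definition f_ex :: "'p rel \<Rightarrow> 'x set \<Rightarrow> ('x \<Rightarrow> 'p \<Rightarrow> bool) \<Rightarrow> 'p \<Rightarrow> bool"
  where "f_ex r A \<phi> p \<longleftrightarrow> (\<forall>q. (q, p) \<in> r \<longrightarrow> (\<exists>t. (t, q) \<in> r \<and> (\<exists>x\<in>A. \<phi> x t)))"

definition f_imp :: "'p rel \<Rightarrow> ('p \<Rightarrow> bool) \<Rightarrow> ('p \<Rightarrow> bool) \<Rightarrow> 'p \<Rightarrow> bool"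
  where "f_imp r \<phi> \<psi> p \<longleftrightarrow> (\<forall>q. (q, p) \<in> r \<longrightarrow> \<phi> q \<longrightarrow> \<psi> q)"

definition f_conj :: "('p \<Rightarrow> bool) \<Rightarrow> ('p \<Rightarrow> bool) \<Rightarrow> 'p \<Rightarrow> bool"
  where "f_conj \<phi> \<psi> p \<longleftrightarrow> \<phi> p \<and> \<psi> p"

text \<open>
  A name for a subset of \<open>\<omega>\<^sub>1\<close> is a set \<open>N\<close> of pairs of an element of \<open>\<omega>\<^sub>1\<close> (standing for its check
  name) and a condition; every subset of \<open>\<omega>\<^sub>1\<close> in the extension has such a name.
\<close>

definition name_omega1 :: "'p rel \<Rightarrow> (nat set \<times> 'p) set \<Rightarrow> bool"
  where "name_omega1 r N \<longleftrightarrow> N \<subseteq> Field aleph1 \<times> Field r"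

definition f_mem :: "'p rel \<Rightarrow> (nat set \<times> 'p) set \<Rightarrow> nat set \<Rightarrow> 'p \<Rightarrow> bool"
  where "f_mem r N a p \<longleftrightarrow>
    (\<forall>q. (q, p) \<in> r \<longrightarrow> (\<exists>t s. (t, q) \<in> r \<and> (a, s) \<in> N \<and> (t, s) \<in> r))"

text \<open>The forcing-language version of \<open>club_omega1\<close>.\<close>

definition f_club :: "'p rel \<Rightarrow> (nat set \<times> 'p) set \<Rightarrow> 'p \<Rightarrow> bool"
  where "f_club r N = f_conj
    (f_all (Field aleph1) (\<lambda>a. f_ex r (aboveS aleph1 a) (f_mem r N)))
    (f_all {d \<in> Field aleph1. underS aleph1 d \<noteq> {}} (\<lambda>d. f_imp r
      (f_all (underS aleph1 d) (\<lambda>a. f_ex r (aboveS aleph1 a \<inter> underS aleph1 d) (f_mem r N)))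
      (f_mem r N d)))"

text \<open>Every condition forces that the check name of \<open>S\<close> is stationary.\<close>

definition forces_stationary :: "'p rel \<Rightarrow> nat set set \<Rightarrow> bool"
  where "forces_stationary r S \<longleftrightarrow>
    (\<forall>N. name_omega1 r N \<longrightarrow> (\<forall>p\<in>Field r. f_imp r (f_club r N) (f_ex r S (f_mem r N)) p))"

definition preserves_stationary :: "'p rel \<Rightarrow> bool"
  where "preserves_stationary r \<longleftrightarrow> (\<forall>S. stationary_omega1 S \<longrightarrow> forces_stationary r S)"

definition dense_in :: "'p rel \<Rightarrow> 'p set \<Rightarrow> bool"
  where "dense_in r D \<longleftrightarrow> D \<subseteq> Field r \<and> (\<forall>p\<in>Field r. \<exists>d\<in>D. (d, p) \<in> r)"

definition filter_in :: "'p rel \<Rightarrow> 'p set \<Rightarrow> bool"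
  where "filter_in r G \<longleftrightarrow> G \<noteq> {} \<and> G \<subseteq> Field r \<and>
    (\<forall>p\<in>G. \<forall>q. (p, q) \<in> r \<longrightarrow> q \<in> G) \<and>
    (\<forall>p\<in>G. \<forall>q\<in>G. \<exists>t\<in>G. (t, p) \<in> r \<and> (t, q) \<in> r)"

text \<open>
  Martin's Maximum for the forcing notions whose conditions are of type \<^typ>\<open>'p\<close>, that is, up to
  isomorphism, for those of size at most \<open>|UNIV :: 'p set|\<close>.
  HOL cannot quantify over all types, so the class of all forcing notions has to be cut off at a
  type; in ZFC, the full axiom is equivalent to having this one for arbitrarily large \<^typ>\<open>'p\<close>.
\<close>

definition martins_maximum :: "'p itself \<Rightarrow> bool"
  where "martins_maximum (T :: 'p itself) \<longleftrightarrow>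
    (\<forall>(r :: 'p rel) \<D>. forcing_notion r \<and> preserves_stationary r \<and>
      |\<D>| \<le>o aleph1 \<and> (\<forall>D\<in>\<D>. dense_in r D) \<longrightarrow>
      (\<exists>G. filter_in r G \<and> (\<forall>D\<in>\<D>. G \<inter> D \<noteq> {})))"

end

theory Submission
  imports Defs
begin

text \<open>
  Call a cofinal family of countable subsets of \<open>M\<close> \<open>\<kappa>\<close>-sparse if every countable subset of \<open>M\<close> contains
  at most \<open>\<kappa>\<close> of its members.  If the neighbourhoods of \<open>p\<close> are restricted to the complements of the
  members of such a family, the hyperspace gets a \<open>(\<kappa>\<^sup>+)\<^sup>o\<^sup>p\<close>-like base.  Below \<open>\<aleph>\<^sub>\<omega>\<close>, \<open>\<aleph>\<^sub>0\<close>-sparse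
  families exist by induction.

  For \<open>\<aleph>\<^sub>\<omega>\<close>, pcf theory gives a scale in \<open>\<Prod>\<^sub>n\<^sub>\<ge>\<^sub>4 \<omega>\<^sub>n\<close> modulo the ideal of subproducts of smaller
  cofinality, and as many sets of size at most \<open>\<aleph>\<^sub>3\<close> covering all countable sets.  Add to the countable
  subsets of each covering set the range of a member of the scale as a tag.  The family is then as
  sparse as the scale.  By club guessing on \<open>\<omega>\<^sub>3\<close> only \<open>\<aleph>\<^sub>3\<close> members of the scale have their range in a
  given countable set, and only \<open>\<aleph>\<^sub>1\<close> if countably many stationary subsets of
  \<open>{\<beta> < \<omega>\<^sub>2. cf \<beta> = \<omega>}\<close> always reflect jointly.  Martin's Maximum implies this reflection: the forcing
  notion adding a continuous \<open>\<omega>\<^sub>1\<close>-sequence that sends the pieces of a partition of \<open>\<omega>\<^sub>1\<close> into the given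
  stationary sets preserves stationary subsets of \<open>\<omega>\<^sub>1\<close>.

  Under Chang's Conjecture no base is \<open>\<aleph>\<^sub>1\<^sup>o\<^sup>p\<close>-like: diagonalization gives more than \<open>\<aleph>\<^sub>\<omega>\<close> members \<open>B\<close>
  containing \<open>{p}\<close>, each with a countable set \<open>D B\<close> whose complement is a neighbourhood of \<open>p\<close> witnessing
  that.  An elementary substructure closed under enumerations of the \<open>D B\<close> has \<open>\<aleph>\<^sub>1\<close> members \<open>B\<close> and a
  countable trace containing all their \<open>D B\<close>, so all these \<open>B\<close> contain one common element of the base.

  All ordinals are elements of one well-ordered type, a copy of a set of larger size than all of
  these objects.
\<close>

section \<open>Cardinal bounds\<close>

text \<open>The induction below \<open>\<aleph>\<^sub>\<omega>\<close> relies on countable sets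
  being bounded; \<open>\<omega>\<^sub>\<omega>\<close> has countable cofinality, so other tags are
  needed there. No cardinal arithmetic is assumed, hence there may be more than
  \<open>\<aleph>\<^sub>\<omega>\<^sub>+\<^sub>1\<close> covering sets. What matters is that they
  are no more numerous than the members of the scale, so that different covering sets can get
  different tags. Origin of the constants: sparseness is refuted by a pigeonhole over the countably
  many coordinates, after which uncountably many indices must remain. The guessing sets must
  therefore be uncountable. Shelah's argument for cofinality \<open>\<omega>\<^sub>1\<close>
  corrects ladders of size \<open>\<aleph>\<^sub>1\<close> along \<open>\<omega>\<^sub>2\<close>
  stages, which takes place on \<open>\<omega>\<^sub>3\<close>. So the scale must be bounded along
  sequences of length \<open>\<omega>\<^sub>3\<close>, the product starts at
  \<open>\<omega>\<^sub>4\<close>, at most \<open>\<aleph>\<^sub>3\<close> tags fit into a countable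
  set, and the bound is the successor \<open>\<aleph>\<^sub>4\<close>. Reflection does the work of
  guessing with sequences of length \<open>\<omega>\<^sub>2\<close>, and the count drops to
  \<open>\<aleph>\<^sub>1\<close>.\<close>

lemma le_subset: "A \<subseteq> B \<Longrightarrow> |B| \<le>o |I| \<Longrightarrow> |A| \<le>o |I|"
  using card_of_mono1 ordLeq_transitive by blast

lemma le_image: "|A| \<le>o |I| \<Longrightarrow> |f ` A| \<le>o |I|"
  using card_of_image ordLeq_transitive by blast

lemma le_UN: "infinite I \<Longrightarrow> |X| \<le>o |I| \<Longrightarrow> (\<And>x. x \<in> X \<Longrightarrow> |A x| \<le>o |I| ) \<Longrightarrow> |\<Union>x\<in>X. A x| \<le>o |I|"
  by (rule card_of_UNION_ordLeq_infinite) auto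

lemma le_Times:
  assumes "infinite I" "|A| \<le>o |I|" "|B| \<le>o |I|" shows "|A \<times> B| \<le>o |I|"
  using card_of_Times_ordLeq_infinite_Field[of "|I|" A B] assms
  by (simp add: Field_card_of card_of_card_order_on)

lemma le_Un:
  assumes "infinite I" "|A| \<le>o |I|" "|B| \<le>o |I|" shows "|A \<union> B| \<le>o |I|"
  using card_of_Un_ordLeq_infinite_Field[of "|I|" A B] assms
  by (simp add: Field_card_of card_of_card_order_on)

lemma le_countable:
  assumes "infinite I" "countable A" shows "|A| \<le>o |I|"
proof -
  have "|A| \<le>o |UNIV::nat set|"
    using assms(2) by (meson card_of_ordLeqI countableE UNIV_I)
  then show ?thesis
    using assms(1) infinite_iff_card_of_nat ordLeq_transitive by blast
qed

lemma countable_iff_le: "countable A \<longleftrightarrow> |A| \<le>o |UNIV::nat set|"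
  unfolding countable_def card_of_ordLeq[symmetric] by auto

lemma le_countable_set: "|A| \<le>o |B| \<Longrightarrow> countable B \<Longrightarrow> countable A"
  unfolding countable_iff_le by (rule ordLeq_transitive)

lemma le_finite: "infinite I \<Longrightarrow> finite A \<Longrightarrow> |A| \<le>o |I|"
  by (simp add: le_countable countable_finite)

lemma le_insert: "infinite I \<Longrightarrow> |A| \<le>o |I| \<Longrightarrow> |insert x A| \<le>o |I|"
  using le_Un[of I "{x}" A] le_finite[of I "{x}"] by simp

lemma not_le_card: "\<not> |A| \<le>o |B| \<longleftrightarrow> |B| <o |A|"
  by (rule not_ordLeq_iff_ordLess[OF card_of_Well_order card_of_Well_order])

lemma le_lists:
  assumes I: "infinite I" and Q: "|Q| \<le>o |I|" shows "|{l. set l \<subseteq> Q}| \<le>o |I|"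
proof -
  have *: "|{l. set l \<subseteq> Q \<and> length l = n}| \<le>o |I|" for n
  proof (induction n)
    case 0
    have "{l. set l \<subseteq> Q \<and> length l = 0} \<subseteq> {[]}" by auto
    then show ?case by (intro le_finite[OF I]) (rule finite_subset, auto)
  next
    case (Suc n)
    have "{l. set l \<subseteq> Q \<and> length l = Suc n} \<subseteq> (\<lambda>(x,l). x # l) ` (Q \<times> {l. set l \<subseteq> Q \<and> length l = n})"
    proof
      fix l assume "l \<in> {l. set l \<subseteq> Q \<and> length l = Suc n}"
      then show "l \<in> (\<lambda>(x,l). x # l) ` (Q \<times> {l. set l \<subseteq> Q \<and> length l = n})"
        by (cases l) auto
    qed
    then show ?case
      by (rule le_subset) (intro le_image le_Times I Q Suc.IH)
  qed
  have "{l. set l \<subseteq> Q} = (\<Union>n\<in>UNIV. {l. set l \<subseteq> Q \<and> length l = n})" by auto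
  also have "|\<dots>| \<le>o |I|"
    by (rule le_UN[OF I le_countable[OF I] *]) simp
  finally show ?thesis .
qed

lemma le_disjoint_pick:
  assumes "\<not> |A| \<le>o |B|" "|B'| \<le>o |B|" obtains x where "x \<in> A" "x \<notin> B'"
proof -
  have "\<not> A \<subseteq> B'" using assms le_subset by blast
  then show ?thesis using that by blast
qed

section \<open>Well-ordered types\<close>

typedef 'b wo = "UNIV :: 'b set" ..

instantiation wo :: (type) wellorder
begin

definition less_eq_wo :: "'a wo \<Rightarrow> 'a wo \<Rightarrow> bool"
  where "x \<le> y \<longleftrightarrow> (Rep_wo x, Rep_wo y) \<in> |UNIV :: 'a set|"

definition less_wo :: "'a wo \<Rightarrow> 'a wo \<Rightarrow> bool"
  where "x < y \<longleftrightarrow> x \<le> y \<and> \<not> y \<le> (x :: 'a wo)"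

instance
proof
  have wo: "well_order_on UNIV |UNIV :: 'a set|"
    by (rule card_of_well_order_on)
  then have L: "linear_order_on UNIV |UNIV :: 'a set|" and wf: "wf ( |UNIV :: 'a set| - Id)"
    unfolding well_order_on_def by auto
  from L have refl: "refl_on UNIV |UNIV :: 'a set|" and tr: "trans |UNIV :: 'a set|"
    and an: "antisym |UNIV :: 'a set|" and tot: "total_on UNIV |UNIV :: 'a set|"
    unfolding linear_order_on_def partial_order_on_def preorder_on_def by auto
  fix x y z :: "'a wo"
  show "(x < y) = (x \<le> y \<and> \<not> y \<le> x)" by (rule less_wo_def)
  show "x \<le> x" using refl unfolding less_eq_wo_def refl_on_def by auto
  show "x \<le> y \<Longrightarrow> y \<le> z \<Longrightarrow> x \<le> z" using tr unfolding less_eq_wo_def trans_def by blast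
  show "x \<le> y \<Longrightarrow> y \<le> x \<Longrightarrow> x = y"
    using an unfolding less_eq_wo_def antisym_def by (metis Rep_wo_inject)
  show le: "x \<le> y \<or> y \<le> x" for x y :: "'a wo"
    using tot refl unfolding less_eq_wo_def total_on_def refl_on_def by (metis UNIV_I)
  show "P a" if "\<And>x. (\<And>y. y < x \<Longrightarrow> P y) \<Longrightarrow> P x" for P and a :: "'a wo"
  proof -
    have "P (Abs_wo u)" for u
    proof (induction u rule: wf_induct_rule[OF wf])
      case (1 u)
      show ?case
      proof (rule that)
        fix y assume "y < Abs_wo u"
        then have "(Rep_wo y, u) \<in> |UNIV :: 'a set| - Id"
          unfolding less_wo_def less_eq_wo_def using refl by (auto simp: Abs_wo_inverse refl_on_def)
        from 1[OF this] show "P y" by (simp add: Rep_wo_inverse)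
      qed
    qed
    from this[of "Rep_wo a"] show ?thesis by (simp add: Rep_wo_inverse)
  qed
qed

end

lemma card_of_wo: "|UNIV :: 'b wo set| =o |UNIV :: 'b set|"
  using card_of_ordIsoI[of Rep_wo UNIV UNIV] type_definition_wo
  by (metis bij_betw_def inj_def Rep_wo_inject type_definition.Rep_range)

text \<open>\<open>|A|\<close> is a well-order strictly shorter than that of the type, hence
  isomorphic to a proper initial segment. This turns abstract cardinals into ordinals of the
  type.\<close>

lemma segment_of_card:
  fixes A :: "'b set"
  assumes "|A| <o |UNIV :: 'o set|"
  obtains \<nu> :: "'o::wellorder" where "|A| =o |{..<\<nu>}|"
proof -
  define r where "r = {(x, y :: 'o). x \<le> y}"
  have F: "Field r = UNIV" unfolding r_def Field_def by auto
  have wf: "wf (r - Id)"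
    by (rule wf_subset[OF wf]) (auto simp: r_def)
  have "well_order_on UNIV r"
    unfolding well_order_on_def linear_order_on_def partial_order_on_def preorder_on_def
      refl_on_def trans_def antisym_def total_on_def using wf by (auto simp: r_def)
  then have wo: "Well_order r" and le: "|UNIV :: 'o set| \<le>o r"
    using F card_of_least by auto
  from assms le have "|A| <o r" by (rule ordLess_ordLeq_trans)
  then obtain a where a: "|A| =o Restr r (underS r a)"
    using ordLess_iff_ordIso_Restr[OF wo, of "|A|"] card_of_Well_order by blast
  have u: "underS r a = {..<a}"
    unfolding underS_def r_def by auto
  have "Field (Restr r (underS r a)) = {..<a}"
    unfolding u by (auto simp: Field_def r_def)
  with card_of_cong[OF a] have "|A| =o |{..<a}|"
    by (simp add: Field_card_of)
  then show ?thesis using that by blast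
qed

text \<open>\<open>om n\<close> is the initial ordinal \<open>\<omega>\<^sub>n\<close>.  In a type without ordinals of that size it is junk;
  the locale \<open>large_wellorder\<close> below rules this out.\<close>

primrec om :: "nat \<Rightarrow> 'o::wellorder" where
  "om 0 = (LEAST \<alpha>. infinite {..<\<alpha>})"
| "om (Suc n) = (LEAST \<alpha>. |{..<om n :: 'o}| <o |{..<\<alpha>}| )"

text \<open>The least strict upper bound: the successor for a singleton, the usual supremum for a
  nonempty set without a largest element.\<close>

definition ssup :: "'o::wellorder set \<Rightarrow> 'o" where "ssup Q = (LEAST z. \<forall>q\<in>Q. q < z)"

lemma ssup_gt: "\<forall>q\<in>Q. q < x \<Longrightarrow> q \<in> Q \<Longrightarrow> q < ssup Q"
  unfolding ssup_def by (rule LeastI2) auto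

lemma ssup_le: "\<forall>q\<in>Q. q < x \<Longrightarrow> ssup Q \<le> x"
  unfolding ssup_def by (rule Least_le)

lemma less_ssup: "z < ssup Q \<Longrightarrow> \<exists>q\<in>Q. z \<le> q"
  unfolding ssup_def using not_less_Least not_less by blast

text \<open>\<open>cof_gt I \<kappa>\<close> means \<open>cf \<kappa> > |I|\<close>.\<close>

definition cof_gt :: "'i set \<Rightarrow> 'o::wellorder \<Rightarrow> bool"
  where "cof_gt I \<kappa> \<longleftrightarrow> (\<forall>Q\<subseteq>{..<\<kappa>}. |Q| \<le>o |I| \<longrightarrow> (\<exists>x<\<kappa>. \<forall>q\<in>Q. q < x))"

lemma cof_gtD: "cof_gt I \<kappa> \<Longrightarrow> Q \<subseteq> {..<\<kappa>} \<Longrightarrow> |Q| \<le>o |I| \<Longrightarrow> \<exists>x<\<kappa>. \<forall>q\<in>Q. q < x"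
  unfolding cof_gt_def by blast

lemma cof_gt_ssup:
  assumes "cof_gt I \<kappa>" "Q \<subseteq> {..<\<kappa>}" "|Q| \<le>o |I|"
  shows "ssup Q < \<kappa>" "\<And>q. q \<in> Q \<Longrightarrow> q < ssup Q"
proof -
  obtain x where "x < \<kappa>" "\<forall>q\<in>Q. q < x" using cof_gtD[OF assms] by blast
  then show "ssup Q < \<kappa>" "\<And>q. q \<in> Q \<Longrightarrow> q < ssup Q"
    using ssup_le ssup_gt by (meson le_less_trans)+
qed

lemma cof_gt_mono: "cof_gt I \<kappa> \<Longrightarrow> |I'| \<le>o |I| \<Longrightarrow> cof_gt I' \<kappa>"
  unfolding cof_gt_def using ordLeq_transitive by blast

lemma not_cof_gtE:
  assumes "\<not> cof_gt I \<kappa>"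
  obtains Q where "Q \<subseteq> {..<\<kappa>}" "|Q| \<le>o |I|" "\<forall>x<\<kappa>. \<exists>q\<in>Q. x \<le> q"
proof -
  obtain Q where Q: "Q \<subseteq> {..<\<kappa>}" "|Q| \<le>o |I|" "\<not> (\<exists>x<\<kappa>. \<forall>q\<in>Q. q < x)"
    using assms unfolding cof_gt_def by auto
  have "\<exists>q\<in>Q. x \<le> q" if "x < \<kappa>" for x using Q(3) that by (metis not_le)
  then show ?thesis using that Q(1,2) by simp
qed

text \<open>Uncountable cofinality keeps the supremum \<open>y\<close> of \<omega> steps below
  \<kappa>, and whatever \<open>N\<close> achieves in one step then happens cofinally often below
  \<open>y\<close>. Most unboundedness proofs for clubs rest on this.\<close>

lemma omega_iterate:
  fixes \<kappa> :: "'o::wellorder"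
  assumes c: "cof_gt (UNIV::nat set) \<kappa>" and N: "\<And>x. x < \<kappa> \<Longrightarrow> x < N x \<and> N x < \<kappa>" and x: "x < \<kappa>"
  obtains s y where "s 0 = x" "\<And>n::nat. s (Suc n) = N (s n)" "\<And>n. s n < y" "y < \<kappa>"
    "\<And>z. z < y \<Longrightarrow> \<exists>n. z < s n" "y = ssup (range s)" "strict_mono s"
proof -
  define s where "s n = (N ^^ n) x" for n
  have s: "s 0 = x" "\<And>n. s (Suc n) = N (s n)" by (auto simp: s_def)
  have sk: "s n < \<kappa>" for n
    by (induction n) (use s N x in auto)
  have st: "s n < s (Suc n)" for n using s N sk by auto
  define y where "y = ssup (range s)"
  have "|range s| \<le>o |UNIV::nat set|" by (rule card_of_image)
  then have y: "y < \<kappa>" "\<And>n. s n < y"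
    using cof_gt_ssup[OF c, of "range s"] sk unfolding y_def by auto
  have "\<exists>n. z < s n" if zy: "z < y" for z
  proof -
    obtain n where "z \<le> s n" using less_ssup[OF zy[unfolded y_def]] by auto
    then show ?thesis using st[of n] le_less_trans by blast
  qed
  moreover have "strict_mono s" using st by (simp add: strict_mono_Suc_iff)
  ultimately show ?thesis using that s y y_def by blast
qed

section \<open>Closed unbounded sets\<close>

text \<open>The clause \<open>{..<y} \<noteq> {}\<close> exempts the least ordinal, which would
  vacuously count as a limit of \<open>E\<close>.\<close>

definition club :: "'o::wellorder \<Rightarrow> 'o set \<Rightarrow> bool" where
  "club \<gamma> E \<longleftrightarrow> E \<subseteq> {..<\<gamma>} \<and> (\<forall>x<\<gamma>. \<exists>y\<in>E. x < y) \<and>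
    (\<forall>y<\<gamma>. {..<y} \<noteq> {} \<and> (\<forall>x<y. \<exists>z\<in>E. x < z \<and> z < y) \<longrightarrow> y \<in> E)"

lemma clubD_sub: "club \<gamma> E \<Longrightarrow> x \<in> E \<Longrightarrow> x < \<gamma>"
  unfolding club_def by blast

lemma clubD_unb: "club \<gamma> E \<Longrightarrow> x < \<gamma> \<Longrightarrow> \<exists>y\<in>E. x < y"
  unfolding club_def by blast

lemma clubD_closed: "club \<gamma> E \<Longrightarrow> y < \<gamma> \<Longrightarrow> w < y \<Longrightarrow> (\<And>x. x < y \<Longrightarrow> \<exists>z\<in>E. x < z \<and> z < y) \<Longrightarrow> y \<in> E"
  unfolding club_def by blast

text \<open>\<open>N x\<close> lies beyond a member of every \<open>E j\<close> above
  \<open>x\<close>, so the supremum of \<omega> iterates is a limit of each \<open>E j\<close>. The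
  factor \<open>{..<\<kappa>}\<close> covers empty \<open>J\<close>.\<close>

lemma club_INT:
  fixes \<kappa> :: "'o::wellorder"
  assumes c: "cof_gt I \<kappa>" and I: "infinite I" and J: "|J| \<le>o |I|" and E: "\<And>j. j \<in> J \<Longrightarrow> club \<kappa> (E j)"
  shows "club \<kappa> ({..<\<kappa>} \<inter> (\<Inter>j\<in>J. E j))"
proof -
  have cn: "cof_gt (UNIV::nat set) \<kappa>"
    using cof_gt_mono[OF c] I infinite_iff_card_of_nat by blast
  have "\<exists>y. x < y \<and> y < \<kappa> \<and> (\<forall>j\<in>J. \<exists>e\<in>E j. x < e \<and> e < y)" if x: "x < \<kappa>" for x
  proof -
    have "\<forall>j\<in>J. \<exists>e. e \<in> E j \<and> x < e" using E x clubD_unb by blast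
    then obtain e where e: "\<And>j. j \<in> J \<Longrightarrow> e j \<in> E j \<and> x < e j" by metis
    have "|insert x (e ` J)| \<le>o |I|" by (intro le_insert le_image I J)
    moreover have "insert x (e ` J) \<subseteq> {..<\<kappa>}" using e E x clubD_sub by blast
    ultimately obtain y where "y < \<kappa>" "\<forall>q\<in>insert x (e ` J). q < y"
      using cof_gtD[OF c] by blast
    then show ?thesis using e by blast
  qed
  then have "\<forall>x. \<exists>y. x < \<kappa> \<longrightarrow> x < y \<and> y < \<kappa> \<and> (\<forall>j\<in>J. \<exists>e\<in>E j. x < e \<and> e < y)"
    by blast
  from choice[OF this] obtain N
    where N: "\<And>x. x < \<kappa> \<Longrightarrow> x < N x \<and> N x < \<kappa> \<and> (\<forall>j\<in>J. \<exists>e\<in>E j. x < e \<and> e < N x)"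
    by blast
  show ?thesis
    unfolding club_def
  proof (intro conjI allI impI)
    fix x assume x: "x < \<kappa>"
    obtain s y where s: "s 0 = x" "\<And>n::nat. s (Suc n) = N (s n)" "\<And>n. s n < y" "y < \<kappa>"
      "\<And>z. z < y \<Longrightarrow> \<exists>n. z < s n"
      using omega_iterate[OF cn _ x, of N] N by blast
    have "y \<in> E j" if j: "j \<in> J" for j
    proof (rule clubD_closed[OF E[OF j] s(4) s(3)[of 0]])
      fix z assume "z < y"
      then obtain n where n: "z < s n" using s(5) by blast
      have "s n < \<kappa>" using s(3,4) by (meson less_trans)
      from N[OF this] j s(2)[of n] obtain e where "e \<in> E j" "s n < e" "e < s (Suc n)" by auto
      then show "\<exists>e\<in>E j. z < e \<and> e < y" using n s(3) by (meson less_trans)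
    qed
    moreover have "x < y" using s(1) s(3)[of 0] by simp
    ultimately show "\<exists>y\<in>{..<\<kappa>} \<inter> \<Inter> (E ` J). x < y" using s(4) by blast
  next
    fix y assume y: "y < \<kappa>" "{..<y} \<noteq> {} \<and> (\<forall>x<y. \<exists>z\<in>{..<\<kappa>} \<inter> \<Inter> (E ` J). x < z \<and> z < y)"
    then obtain w where w: "w < y" by blast
    have "y \<in> E j" if j: "j \<in> J" for j
      by (rule clubD_closed[OF E[OF j] y(1) w]) (use y j in blast)
    then show "y \<in> {..<\<kappa>} \<inter> \<Inter> (E ` J)" using y by auto
  qed auto
qed

lemma club_Int:
  fixes \<kappa> :: "'o::wellorder"
  assumes c: "cof_gt (UNIV::nat set) \<kappa>" and "club \<kappa> D" "club \<kappa> E"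
  shows "club \<kappa> (D \<inter> E)"
proof -
  have "club \<kappa> ({..<\<kappa>} \<inter> (\<Inter>j\<in>{0,1::nat}. if j = 0 then D else E))"
    by (rule club_INT[OF c]) (use assms(2,3) in \<open>auto intro: le_finite\<close>)
  moreover have "{..<\<kappa>} \<inter> (\<Inter>j\<in>{0,1::nat}. if j = 0 then D else E) = D \<inter> E"
    using assms(2,3) unfolding club_def by auto
  ultimately show ?thesis by simp
qed

lemma club_tail:
  fixes \<kappa> :: "'o::wellorder"
  assumes c: "cof_gt (UNIV::nat set) \<kappa>" and x: "x < \<kappa>"
  shows "club \<kappa> {y. x < y \<and> y < \<kappa>}"
proof -
  have "\<exists>y. z < y \<and> x < y \<and> y < \<kappa>" if "z < \<kappa>" for z
    using cof_gtD[OF c, of "{x,z}"] x that le_finite[of "UNIV::nat set" "{x,z}"] by auto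
  then show ?thesis
    unfolding club_def by (auto intro: less_trans)
qed

lemma club_cof_omega:
  fixes \<kappa> :: "'o::wellorder"
  assumes c: "cof_gt (UNIV::nat set) \<kappa>" and E: "club \<kappa> E" and x: "x < \<kappa>"
  obtains y where "y \<in> E" "x < y" "\<exists>v. countable v \<and> v \<subseteq> {..<y} \<and> (\<forall>z<y. \<exists>u\<in>v. z < u)"
proof -
  obtain N where N: "\<And>x. x < \<kappa> \<Longrightarrow> N x \<in> E \<and> x < N x" using clubD_unb[OF E] by metis
  obtain s y where s: "s 0 = x" "\<And>n::nat. s (Suc n) = N (s n)" "\<And>n. s n < y" "y < \<kappa>"
      "\<And>z. z < y \<Longrightarrow> \<exists>n. z < s n"
    using omega_iterate[OF c _ x, of N] N clubD_sub[OF E] by blast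
  have E': "s (Suc n) \<in> E" for n using N s by (metis less_trans)
  have "y \<in> E"
  proof (rule clubD_closed[OF E s(4) s(3)[of 0]])
    fix z assume "z < y"
    then obtain n where n: "z < s n" using s(5) by blast
    have "s n < s (Suc n)" using N s by (metis less_trans)
    then show "\<exists>e\<in>E. z < e \<and> e < y" using n E' s(3) by (meson less_trans)
  qed
  moreover have "x < y" using s by metis
  moreover have "countable (range s) \<and> range s \<subseteq> {..<y} \<and> (\<forall>z<y. \<exists>u\<in>range s. z < u)"
    using s by auto
  ultimately show ?thesis using that by blast
qed

text \<open>This replaces closure under Skolem functions. \<open>Q\<close> is an increasing
  continuous chain, so at a limit \<alpha> a finite list from \<open>Q \<alpha>\<close> already
  comes from an earlier \<open>Q \<beta>\<close>; hence the closure points are closed under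
  limits.\<close>

lemma club_closure_points:
  fixes \<kappa> :: "'o::wellorder" and Q :: "'o \<Rightarrow> 'e set" and g :: "'e list \<Rightarrow> 'o"
  assumes c: "cof_gt I \<kappa>" and I: "infinite I"
    and sz: "\<And>\<alpha>. \<alpha> < \<kappa> \<Longrightarrow> |Q \<alpha>| \<le>o |I|"
    and mono: "\<And>\<alpha> \<beta>. \<alpha> \<le> \<beta> \<Longrightarrow> Q \<alpha> \<subseteq> Q \<beta>"
    and cont: "\<And>\<alpha> e w. w < \<alpha> \<Longrightarrow> (\<And>x. x < \<alpha> \<Longrightarrow> \<exists>z. x < z \<and> z < \<alpha>) \<Longrightarrow> e \<in> Q \<alpha> \<Longrightarrow> \<exists>\<beta><\<alpha>. e \<in> Q \<beta>"
    and g: "\<And>\<alpha> l. \<alpha> < \<kappa> \<Longrightarrow> set l \<subseteq> Q \<alpha> \<Longrightarrow> g l < \<kappa>"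
  shows "club \<kappa> {\<alpha>. \<alpha> < \<kappa> \<and> (\<forall>l. set l \<subseteq> Q \<alpha> \<longrightarrow> g l < \<alpha>)}"
proof -
  have cn: "cof_gt (UNIV::nat set) \<kappa>"
    using cof_gt_mono[OF c] I infinite_iff_card_of_nat by blast
  have lists: "\<exists>\<beta><\<alpha>. set l \<subseteq> Q \<beta>"
    if w: "w < \<alpha>" and lim: "\<And>x. x < \<alpha> \<Longrightarrow> \<exists>z. x < z \<and> z < \<alpha>" and l: "set l \<subseteq> Q \<alpha>" for w \<alpha> l
    using l
  proof (induction l)
    case Nil
    then show ?case using w by auto
  next
    case (Cons e l)
    then obtain \<beta> where "\<beta> < \<alpha>" "set l \<subseteq> Q \<beta>" by auto
    moreover obtain \<beta>' where "\<beta>' < \<alpha>" "e \<in> Q \<beta>'" using cont[OF w lim] Cons.prems by auto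
    ultimately show ?case
      using mono[of \<beta> "max \<beta> \<beta>'"] mono[of \<beta>' "max \<beta> \<beta>'"] by (intro exI[of _ "max \<beta> \<beta>'"]) auto
  qed
  have "\<exists>y. x < y \<and> y < \<kappa> \<and> (\<forall>l. set l \<subseteq> Q x \<longrightarrow> g l < y)" if x: "x < \<kappa>" for x
  proof -
    have "|insert x (g ` {l. set l \<subseteq> Q x})| \<le>o |I|"
      by (intro le_insert le_image le_lists I sz x)
    moreover have "insert x (g ` {l. set l \<subseteq> Q x}) \<subseteq> {..<\<kappa>}" using g x by auto
    ultimately obtain y where "y < \<kappa>" "\<forall>q\<in>insert x (g ` {l. set l \<subseteq> Q x}). q < y"
      using cof_gtD[OF c] by blast
    then show ?thesis by blast
  qed
  then have "\<forall>x. \<exists>y. x < \<kappa> \<longrightarrow> x < y \<and> y < \<kappa> \<and> (\<forall>l. set l \<subseteq> Q x \<longrightarrow> g l < y)"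
    by blast
  from choice[OF this] obtain N
    where N: "\<And>x. x < \<kappa> \<Longrightarrow> x < N x \<and> N x < \<kappa> \<and> (\<forall>l. set l \<subseteq> Q x \<longrightarrow> g l < N x)"
    by blast
  show ?thesis
    unfolding club_def
  proof (intro conjI allI impI)
    fix x assume x: "x < \<kappa>"
    obtain s y where s: "s 0 = x" "\<And>n::nat. s (Suc n) = N (s n)" "\<And>n. s n < y" "y < \<kappa>"
      "\<And>z. z < y \<Longrightarrow> \<exists>n. z < s n"
      using omega_iterate[OF cn _ x, of N] N by blast
    have "g l < y" if l: "set l \<subseteq> Q y" for l
    proof -
      obtain \<beta> where b: "\<beta> < y" "set l \<subseteq> Q \<beta>"
        using lists[OF s(3)[of 0] _ l] s(3,5) by blast
      then obtain n where n: "\<beta> < s n" using s(5) by blast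
      have "s n < \<kappa>" using s(3,4) by (meson less_trans)
      moreover have "set l \<subseteq> Q (s n)" using b mono[OF less_imp_le[OF n]] by auto
      ultimately have "g l < s (Suc n)" using N s(2) by auto
      then show ?thesis using s(3) by (meson less_trans)
    qed
    then show "\<exists>y\<in>{\<alpha>. \<alpha> < \<kappa> \<and> (\<forall>l. set l \<subseteq> Q \<alpha> \<longrightarrow> g l < \<alpha>)}. x < y"
      using s(1) s(3)[of 0] s(4) by auto
  next
    fix y assume y: "y < \<kappa>" "{..<y} \<noteq> {} \<and>
      (\<forall>x<y. \<exists>z\<in>{\<alpha>. \<alpha> < \<kappa> \<and> (\<forall>l. set l \<subseteq> Q \<alpha> \<longrightarrow> g l < \<alpha>)}. x < z \<and> z < y)"
    then obtain w where w: "w < y" by blast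
    have "g l < y" if l: "set l \<subseteq> Q y" for l
    proof -
      obtain \<beta> where b: "\<beta> < y" "set l \<subseteq> Q \<beta>"
        using lists[OF w _ l] y by blast
      then obtain z where "\<beta> < z" "z < y" "\<forall>l. set l \<subseteq> Q z \<longrightarrow> g l < z" using y by blast
      moreover have "set l \<subseteq> Q z" using b mono[OF less_imp_le[OF \<open>\<beta> < z\<close>]] by auto
      ultimately show ?thesis by (meson less_trans)
    qed
    then show "y \<in> {\<alpha>. \<alpha> < \<kappa> \<and> (\<forall>l. set l \<subseteq> Q \<alpha> \<longrightarrow> g l < \<alpha>)}" using y by auto
  qed auto
qed

section \<open>Continuous cofinal maps\<close>

text \<open>Monotonicity is weak because suprema along a chain of countable sets may be constant on
  an initial stretch. The values nevertheless stay strictly below \<gamma>.\<close>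

definition normal_to :: "'o::wellorder \<Rightarrow> 'o \<Rightarrow> ('o \<Rightarrow> 'o) \<Rightarrow> bool" where
  "normal_to \<kappa> \<gamma> s \<longleftrightarrow> (\<forall>i j. i \<le> j \<and> j < \<kappa> \<longrightarrow> s i \<le> s j) \<and> (\<forall>i<\<kappa>. s i < \<gamma>) \<and>
    (\<forall>x<\<gamma>. \<exists>i<\<kappa>. x < s i) \<and>
    (\<forall>i<\<kappa>. {..<i} \<noteq> {} \<and> (\<forall>k<i. \<exists>j. k < j \<and> j < i) \<longrightarrow> (\<forall>x < s i. \<exists>j<i. x < s j))"

lemma normal_toD:
  assumes "normal_to \<kappa> \<gamma> s"
  shows "i \<le> j \<Longrightarrow> j < \<kappa> \<Longrightarrow> s i \<le> s j" "i < \<kappa> \<Longrightarrow> s i < \<gamma>" "x < \<gamma> \<Longrightarrow> \<exists>i<\<kappa>. x < s i"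
    "i < \<kappa> \<Longrightarrow> w < i \<Longrightarrow> (\<And>k. k < i \<Longrightarrow> \<exists>j. k < j \<and> j < i) \<Longrightarrow> x < s i \<Longrightarrow> \<exists>j<i. x < s j"
  using assms unfolding normal_to_def by auto

lemma normal_to_cof: 
  assumes s: "normal_to \<kappa> \<gamma> s" and c: "cof_gt I \<kappa>"
  shows "cof_gt I \<gamma>"
  unfolding cof_gt_def
proof (intro allI impI)
  fix Q assume Q: "Q \<subseteq> {..<\<gamma>}" "|Q| \<le>o |I|"
  have "\<forall>q\<in>Q. \<exists>i<\<kappa>. q < s i" using Q s unfolding normal_to_def by auto
  then obtain i where i: "\<And>q. q \<in> Q \<Longrightarrow> i q < \<kappa> \<and> q < s (i q)" by metis
  have "i ` Q \<subseteq> {..<\<kappa>}" "|i ` Q| \<le>o |I|" using i le_image[OF Q(2)] by auto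
  then obtain x where x: "x < \<kappa>" "\<forall>q\<in>i ` Q. q < x" using cof_gtD[OF c] by blast
  then have "q < s x" if "q \<in> Q" for q
  proof -
    have "i q < x" using x that by auto
    then have "s (i q) \<le> s x" using s x unfolding normal_to_def by auto
    then show ?thesis using i that by (meson less_le_trans)
  qed
  then show "\<exists>x<\<gamma>. \<forall>q\<in>Q. q < x" using normal_toD(2)[OF s x(1)] by blast
qed

lemma club_vimage:
  assumes s: "normal_to \<kappa> \<gamma> s" and c: "cof_gt (UNIV::nat set) \<kappa>" and E: "club \<gamma> E"
  shows "club \<kappa> {i. i < \<kappa> \<and> s i \<in> E}"
proof -
  note mono = normal_toD(1)[OF s] and lt = normal_toD(2)[OF s] and cofin = normal_toD(3)[OF s]
    and cont = normal_toD(4)[OF s]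
  have "\<exists>j. i < j \<and> j < \<kappa> \<and> (\<exists>e\<in>E. s i < e \<and> e < s j)" if i: "i < \<kappa>" for i
  proof -
    obtain e where e: "e \<in> E" "s i < e" using clubD_unb[OF E lt[OF i]] by blast
    then obtain j where j: "j < \<kappa>" "e < s j" using cofin clubD_sub[OF E] by blast
    have "i < j" using mono[of j i] j e i by (meson leD less_trans not_le)
    then show ?thesis using e j by blast
  qed
  then have "\<forall>i. \<exists>j. i < \<kappa> \<longrightarrow> i < j \<and> j < \<kappa> \<and> (\<exists>e\<in>E. s i < e \<and> e < s j)"
    by blast
  from choice[OF this] obtain N
    where N: "\<And>i. i < \<kappa> \<Longrightarrow> i < N i \<and> N i < \<kappa> \<and> (\<exists>e\<in>E. s i < e \<and> e < s (N i))"
    by blast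
  show ?thesis
    unfolding club_def
  proof (intro conjI allI impI)
    fix x assume x: "x < \<kappa>"
    obtain t y where t: "t 0 = x" "\<And>n::nat. t (Suc n) = N (t n)" "\<And>n. t n < y" "y < \<kappa>"
      "\<And>z. z < y \<Longrightarrow> \<exists>n. z < t n"
      using omega_iterate[OF c _ x, of N] N by blast
    have tk: "t n < \<kappa>" for n using t by (meson less_trans)
    have "s y \<in> E"
    proof (rule clubD_closed[OF E lt[OF t(4)]])
      have "s (t 0) < s (N (t 0))" using N[OF tk] by (meson less_trans)
      then show "s (t 0) < s y" using mono[of "N (t 0)" y] t
        by (metis less_imp_le less_le_trans)
      fix z assume "z < s y"
      then obtain j where j: "j < y" "z < s j"
        using cont[OF t(4) t(3)[of 0]] t(3,5) by blast
      then obtain n where "j < t n" using t(5) by blast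
      then have "z < s (t n)" using mono[of j "t n"] j tk by (meson less_imp_le less_le_trans)
      moreover obtain e where "e \<in> E" "s (t n) < e" "e < s (N (t n))" using N[OF tk] by blast
      moreover have "s (N (t n)) \<le> s y" using mono[of "N (t n)" y] t by (metis less_imp_le)
      ultimately show "\<exists>e\<in>E. z < e \<and> e < s y" by (meson less_le_trans less_trans)
    qed
    then show "\<exists>y\<in>{i. i < \<kappa> \<and> s i \<in> E}. x < y" using t(4) t(1) t(3)[of 0] by auto
  next
    fix y assume y: "y < \<kappa>" "{..<y} \<noteq> {} \<and> (\<forall>x<y. \<exists>z\<in>{i. i < \<kappa> \<and> s i \<in> E}. x < z \<and> z < y)"
    then obtain w where w: "w < y" by blast
    show "y \<in> {i. i < \<kappa> \<and> s i \<in> E}"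
    \<comment> \<open>If \<open>s\<close> is constant just below \<open>y\<close>, then closedness
      of \<open>E\<close> at \<open>s y\<close> says nothing; but then a smaller point of the
      preimage has the same value \<open>s y\<close>.\<close>
    proof (cases "\<exists>j<y. s j = s y")
      case True
      then obtain j where j: "j < y" "s j = s y" by blast
      then obtain z where z: "j < z" "z < y" "s z \<in> E" using y by blast
      have "s j \<le> s z" by (rule mono) (use z y in auto)
      moreover have "s z \<le> s y" by (rule mono) (use z y in auto)
      ultimately have "s z = s y" using j by simp
      then show ?thesis using z y by simp
    next
      case False
      then have lt': "s j < s y" if "j < y" for j
        using mono[of j y] that y by (metis less_imp_le order_neq_le_trans)
      have "s y \<in> E"
      proof (rule clubD_closed[OF E lt[OF y(1)] lt'[OF w]])
        fix z assume "z < s y"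
        then obtain j where j: "j < y" "z < s j"
          using cont[OF y(1) w] y by blast
        then obtain i where "j < i" "i < y" "s i \<in> E" using y by blast
        moreover from this have "s j \<le> s i" by (intro mono) (use y in auto)
        ultimately show "\<exists>e\<in>E. z < e \<and> e < s y" using j lt' by (meson less_le_trans)
      qed
      then show ?thesis using y by simp
    qed
  qed auto
qed

text \<open>Take the least \<open>i\<close> with \<open>y \<le> s i\<close>. If \<open>y\<close>
  were smaller than \<open>s i\<close>, then \<open>i\<close> would be a limit and continuity would
  push an earlier value above \<open>y\<close>. This supplies small clubs below every ordinal
  reached by a short normal sequence.\<close>

lemma club_range:
  assumes s: "normal_to \<kappa> \<gamma> s"
  shows "club \<gamma> (s ` {..<\<kappa>})"
proof -
  note mono = normal_toD(1)[OF s] and lt = normal_toD(2)[OF s] and cofin = normal_toD(3)[OF s]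
    and cont = normal_toD(4)[OF s]
  show ?thesis
    unfolding club_def
  proof (intro conjI allI impI)
    fix x assume "x < \<gamma>" then show "\<exists>y\<in>s ` {..<\<kappa>}. x < y" using cofin by blast
  next
    fix y assume y: "y < \<gamma>" "{..<y} \<noteq> {} \<and> (\<forall>x<y. \<exists>z\<in>s ` {..<\<kappa>}. x < z \<and> z < y)"
    define i where "i = (LEAST i. y \<le> s i)"
    have ex: "\<exists>i<\<kappa>. y \<le> s i" using cofin y by (meson less_imp_le)
    then have i: "y \<le> s i" "i < \<kappa>"
      unfolding i_def by (metis LeastI, metis Least_le le_less_trans)
    have below: "s j < y" if "j < i" for j using that not_less_Least unfolding i_def by (metis not_le)
    have "s i \<le> y"
    proof (rule ccontr)
      assume "\<not> s i \<le> y" then have yi: "y < s i" by simp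
      obtain w where w: "w \<in> {..<\<kappa>}" "s w < y" using y by blast
      have wi: "w < i" using mono[of i w] w i by (meson leD le_less_trans lessThan_iff not_le)
      have "\<exists>j. k < j \<and> j < i" if k: "k < i" for k
      proof -
        obtain j where j: "j < \<kappa>" "s k < s j" "s j < y" using y below[OF k] by blast
        have "k < j" using mono[of j k] j k i by (meson leD less_trans not_le)
        moreover have "j < i" using mono[of i j] j i by (meson leD le_less_trans not_le)
        ultimately show ?thesis by blast
      qed
      from cont[OF i(2) wi this yi] below show False by (meson less_asym)
    qed
    then show "y \<in> s ` {..<\<kappa>}" using i by (metis antisym imageI lessThan_iff)
  qed (use lt in auto)
qed

declare om.simps [simp del]

section \<open>The initial ordinals\<close>

lemma cardSuc_ordIso: "Card_order \<kappa> \<Longrightarrow> Card_order \<kappa>' \<Longrightarrow> \<kappa> =o \<kappa>' \<Longrightarrow> cardSuc \<kappa> =o cardSuc \<kappa>'"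
  using cardSuc_invar_ordIso by blast

text \<open>The assumption \<open>products\<close> puts the cofinalities of products of alephs into the type.\<close>

locale large_wellorder =
  fixes T :: "'o::wellorder itself"
  assumes ex_om0: "\<exists>\<alpha>::'o. infinite {..<\<alpha>}"
    and ex_omSuc: "\<exists>\<alpha>::'o. |{..<om n :: 'o}| <o |{..<\<alpha>}|"
    and products: "|{h :: nat \<Rightarrow> 'o. \<forall>n. h n < om n}| <o |UNIV :: 'o set|"
begin

abbreviation omega :: "nat \<Rightarrow> 'o" where "omega \<equiv> om"
abbreviation aleph :: "nat \<Rightarrow> 'o set" where "aleph n \<equiv> {..<om n}"

lemma om_0: "infinite (aleph 0)" "\<alpha> < omega 0 \<Longrightarrow> finite {..<\<alpha>}"
  using LeastI_ex[OF ex_om0] not_less_Least[of \<alpha> "\<lambda>\<alpha>. infinite {..<\<alpha>}"] by (auto simp: om.simps)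

lemma om_Suc: "|aleph n| <o |aleph (Suc n)|" "\<alpha> < omega (Suc n) \<Longrightarrow> |{..<\<alpha>}| \<le>o |aleph n|"
proof -
  show "|aleph n| <o |aleph (Suc n)|"
    using LeastI_ex[OF ex_omSuc] by (simp add: om.simps)
  show "\<alpha> < omega (Suc n) \<Longrightarrow> |{..<\<alpha>}| \<le>o |aleph n|"
    using not_less_Least[of \<alpha> "\<lambda>\<alpha>. |aleph n| <o |{..<\<alpha>}|"] not_le_card[of "{..<\<alpha>}" "aleph n"] by (auto simp: om.simps)
qed

lemma om_less_Suc: "omega n < omega (Suc n)"
proof (rule ccontr)
  assume "\<not> omega n < omega (Suc n)"
  then have "aleph (Suc n) \<subseteq> aleph n" by auto
  then show False using om_Suc(1)[of n] card_of_mono1 not_le_card by metis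
qed

lemma om_strict_mono: "m < n \<Longrightarrow> omega m < omega n"
  using om_less_Suc lift_Suc_mono_less[of om] by blast

lemma om_mono: "m \<le> n \<Longrightarrow> omega m \<le> omega n"
  using om_strict_mono by (metis le_less)

lemma aleph_mono: "m \<le> n \<Longrightarrow> |aleph m| \<le>o |aleph n|"
  using om_mono by (intro card_of_mono1) (auto intro: less_le_trans)

lemma infinite_aleph: "infinite (aleph n)"
proof -
  have "aleph 0 \<subseteq> aleph n" using om_mono[of 0 n] by (auto intro: less_le_trans)
  then show ?thesis using om_0(1) infinite_super by blast
qed

lemma nat_le_aleph: "|UNIV :: nat set| \<le>o |aleph n|"
  using infinite_aleph infinite_iff_card_of_nat by blast

lemma countable_aleph0: "countable (aleph 0)"
proof -
  have "inj_on (\<lambda>x. card {..<x}) (aleph 0)"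
  proof (rule linorder_inj_onI)
    fix x y :: 'o assume "x < y" "x \<in> aleph 0" "y \<in> aleph 0"
    then have "{..<x} \<subset> {..<y}" "finite {..<y}" using om_0(2) by (auto intro: less_trans)
    then show "card {..<x} \<noteq> card {..<y}" using psubset_card_mono by (metis less_irrefl)
  qed auto
  then show ?thesis by (rule countableI)
qed

lemma om_pos: "\<exists>x. x < omega n"
proof -
  have "aleph n \<noteq> {}" using infinite_aleph by (metis finite.emptyI)
  then show ?thesis by blast
qed

lemma cof_om: "cof_gt (aleph n) (omega (Suc n))"
  unfolding cof_gt_def
proof (intro allI impI)
  fix Q assume Q: "Q \<subseteq> aleph (Suc n)" "|Q| \<le>o |aleph n|"
  have "|\<Union>q\<in>Q. insert q {..<q}| \<le>o |aleph n|"
    by (intro le_UN infinite_aleph Q(2) le_insert om_Suc(2)) (use Q in auto)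
  then obtain x where x: "x \<in> aleph (Suc n)" "x \<notin> (\<Union>q\<in>Q. insert q {..<q})"
    using le_disjoint_pick[of "aleph (Suc n)" "aleph n"] om_Suc(1) not_le_card by metis
  then have "\<forall>q\<in>Q. q < x" by force
  then show "\<exists>x< omega (Suc n). \<forall>q\<in>Q. q < x" using x by auto
qed

lemma cof_om_le: "m < n \<Longrightarrow> |I| \<le>o |aleph m| \<Longrightarrow> cof_gt I (omega n)"
proof -
  assume "m < n" "|I| \<le>o |aleph m|"
  then have "|I| \<le>o |aleph (n - 1)|" using aleph_mono[of m "n - 1"] ordLeq_transitive by fastforce
  then show ?thesis using cof_gt_mono[OF cof_om[of "n - 1"]] \<open>m < n\<close> by simp
qed

lemma cof_om_nat: "0 < n \<Longrightarrow> cof_gt (UNIV::nat set) (omega n)"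
  using cof_om_le[of 0 n] nat_le_aleph by blast

lemma om_limit: "x < omega n \<Longrightarrow> \<exists>y. x < y \<and> y < omega n"
proof (cases "n = 0")
  case True
  assume x: "x < omega n"
  then have "finite {..x}" using True om_0(2) by (simp add: ivl_disj_un_singleton(2)[symmetric])
  then obtain y where "y \<in> aleph 0" "y \<notin> {..x}" using om_0(1) by (metis finite_subset subsetI)
  then show ?thesis using True by (auto simp: not_le)
next
  case False
  assume "x < omega n"
  then show ?thesis using cof_gtD[OF cof_om_nat, of n "{x}"] False le_finite[of "UNIV::nat set" "{x}"] by auto
qed

lemma less_card_UNIV: "|aleph n| <o |UNIV::'o set|"
  using ordLess_ordLeq_trans[OF om_Suc(1) card_of_mono1[OF subset_UNIV]] .

lemma card_less_om_Suc:
  assumes "|A| <o |aleph (Suc n)|" shows "|A| \<le>o |aleph n|"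
proof (rule ccontr)
  assume n: "\<not> |A| \<le>o |aleph n|"
  have "|A| <o |UNIV :: 'o set|" using ordLess_transitive[OF assms less_card_UNIV] .
  then obtain \<nu> :: 'o where nu: "|A| =o |{..<\<nu>}|" by (rule segment_of_card)
  have "|{..<\<nu>}| <o |aleph (Suc n)|"
    by (rule ordIso_ordLess_trans[OF ordIso_symmetric[OF nu] assms])
  then have "\<not> aleph (Suc n) \<subseteq> {..<\<nu>}"
    using card_of_mono1 not_le_card by metis
  then have "\<nu> < omega (Suc n)" by force
  from om_Suc(2)[OF this] show False using n ordIso_ordLeq_trans[OF nu] by blast
qed

lemma aleph0_ordIso: "|aleph 0| =o natLeq"
proof -
  have "|aleph 0| \<le>o |UNIV::nat set|" using countable_aleph0 countable_iff_le by blast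
  then have "|aleph 0| =o |UNIV::nat set|"
    using nat_le_aleph[of 0] by (simp add: ordIso_iff_ordLeq)
  then show ?thesis using card_of_nat ordIso_transitive by blast
qed

lemma alephSuc_ordIso: "|aleph (Suc n)| =o cardSuc |aleph n|"
  unfolding ordIso_iff_ordLeq
proof
  have co: "Card_order |aleph n|" "Card_order |aleph (Suc n)|" by (rule card_of_Card_order)+
  show "cardSuc |aleph n| \<le>o |aleph (Suc n)|"
    using cardSuc_ordLess_ordLeq[OF co] om_Suc(1) by blast
  show "|aleph (Suc n)| \<le>o cardSuc |aleph n|"
  proof (rule ccontr)
    assume "\<not> |aleph (Suc n)| \<le>o cardSuc |aleph n|"
    then have "cardSuc |aleph n| <o |aleph (Suc n)|"
      using not_ordLeq_iff_ordLess[OF cardSuc_Well_order[OF co(1)] card_of_Well_order[of "aleph (Suc n)"]]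
        not_ordLeq_iff_ordLess[OF card_of_Well_order[of "aleph (Suc n)"] cardSuc_Well_order[OF co(1)]] by blast
    then have "|Field (cardSuc |aleph n| )| <o |aleph (Suc n)|" by (rule ordLess_Field)
    then have "|Field (cardSuc |aleph n| )| \<le>o |aleph n|" by (rule card_less_om_Suc)
    then have "cardSuc |aleph n| \<le>o |aleph n|"
      using card_of_Field_ordIso[OF cardSuc_Card_order[OF co(1)]] ordIso_ordLeq_trans ordIso_symmetric by blast
    then show False using cardSuc_greater[OF co(1)] not_ordLess_ordLeq by blast
  qed
qed

lemma cardSuc_aleph: "Card_order \<kappa> \<Longrightarrow> |aleph n| =o \<kappa> \<Longrightarrow> cardSuc |aleph n| =o cardSuc \<kappa>"
  by (rule cardSuc_ordIso[OF card_of_Card_order])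

lemma aleph_Suc_ordIso: "Card_order \<kappa> \<Longrightarrow> |aleph n| =o \<kappa> \<Longrightarrow> |aleph (Suc n)| =o cardSuc \<kappa>"
  by (rule ordIso_transitive[OF alephSuc_ordIso cardSuc_aleph])

lemma aleph_ordIso: "|aleph 1| =o aleph1" "|aleph 2| =o aleph2" "|aleph 3| =o cardSuc aleph2"
proof -
  show 1: "|aleph 1| =o aleph1"
    using aleph_Suc_ordIso[OF natLeq_Card_order aleph0_ordIso] by simp
  show 2: "|aleph 2| =o aleph2"
    using aleph_Suc_ordIso[OF cardSuc_Card_order[OF natLeq_Card_order] 1] by (simp add: numeral_2_eq_2)
  show "|aleph 3| =o cardSuc aleph2"
    using aleph_Suc_ordIso[OF cardSuc_Card_order[OF cardSuc_Card_order[OF natLeq_Card_order]] 2]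
    by (simp add: numeral_3_eq_3 numeral_2_eq_2)
qed

text \<open>From here on the type-bound description of \<open>\<aleph>\<^sub>n\<close> is replaced
  by the fixed segments \<open>aleph n\<close>, with which sets of any type can be compared.\<close>

lemma has_card_aleph_iff: "has_card_aleph n (A :: 'b set) \<longleftrightarrow> |A| =o |aleph n|"
proof (induction n arbitrary: A)
  case 0
  show ?case
    unfolding has_card_aleph.simps
    by (rule iffI) (erule ordIso_transitive[OF _ aleph0_ordIso]
        ordIso_transitive[OF _ ordIso_symmetric[OF aleph0_ordIso]])+
next
  case (Suc n)
  have *: "|A| =o cardSuc |B| \<longleftrightarrow> |A| =o |aleph (Suc n)|" if "|B| =o |aleph n|" for B :: "'b set"
  proof -
    have "cardSuc |B| =o cardSuc |aleph n|"
      using cardSuc_invar_ordIso[OF card_of_Card_order card_of_Card_order] that by blast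
    from ordIso_transitive[OF this ordIso_symmetric[OF alephSuc_ordIso]]
    have c: "cardSuc |B| =o |aleph (Suc n)|" .
    show ?thesis
      by (rule iffI) (erule ordIso_transitive[OF _ c] ordIso_transitive[OF _ ordIso_symmetric[OF c]])+
  qed
  show ?case
  proof
    assume "has_card_aleph (Suc n) A"
    then show "|A| =o |aleph (Suc n)|" using Suc.IH * by auto
  next
    assume A: "|A| =o |aleph (Suc n)|"
    have "|aleph n| \<le>o |A|"
      using ordLeq_ordIso_trans[OF ordLess_imp_ordLeq[OF om_Suc(1)] ordIso_symmetric[OF A]] .
    then obtain B where B: "B \<subseteq> A" "|aleph n| =o |B|"
      using internalize_card_of_ordLeq2[of "aleph n" A] by blast
    then have "has_card_aleph n B" using Suc.IH ordIso_symmetric[OF B(2)] by simp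
    moreover have "|A| =o cardSuc |B|" using *[OF ordIso_symmetric[OF B(2)]] A by simp
    ultimately show "has_card_aleph (Suc n) A" using B by auto
  qed
qed

text \<open>\<open>Kw\<close> is the ordinal \<open>\<omega>\<^sub>\<omega>\<close>, which need not be an element of the type.\<close>

definition Kw :: "'o set" where "Kw = (\<Union>n. aleph n)"

lemma card_less_Kw:
  assumes "|A| <o |Kw|" shows "\<exists>n. |A| \<le>o |aleph n|"
proof (rule ccontr)
  assume n: "\<not> (\<exists>n. |A| \<le>o |aleph n| )"
  have "|A| <o |UNIV :: 'o set|" using ordLess_ordLeq_trans[OF assms card_of_mono1] by blast
  then obtain \<nu> :: 'o where nu: "|A| =o |{..<\<nu>}|" by (rule segment_of_card)
  have "\<not> {..<\<nu>} \<subseteq> aleph n" for n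
    using n ordIso_ordLeq_trans[OF nu] card_of_mono1 by blast
  then have "om n \<le> \<nu>" for n by (metis lessThan_subset_iff linear)
  then have "Kw \<subseteq> {..<\<nu>}" unfolding Kw_def by (auto intro: less_le_trans)
  from ordLeq_ordIso_trans[OF card_of_mono1[OF this] ordIso_symmetric[OF nu]] have "|Kw| \<le>o |A|" .
  then show False using assms not_ordLess_ordLeq by blast
qed

lemma has_card_aleph_omega_iff:
  assumes "has_card_aleph_omega (K :: 'b set)" shows "|K| =o |Kw|"
proof -
  from assms obtain B where B: "\<And>n. B n \<subseteq> K" "\<And>n. has_card_aleph n (B n)"
    unfolding has_card_aleph_omega_def above_alephs_def by metis
  then have Bn: "|B n| =o |aleph n|" for n using has_card_aleph_iff by blast
  \<comment> \<open>The union of the witnesses competes with \<open>K\<close> in the minimality of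
    \<open>\<aleph>\<^sub>\<omega>\<close>, so \<open>K\<close> has at most its size.\<close>
  have "above_alephs (\<Union>n. B n)"
    unfolding above_alephs_def using B(2) by blast
  then have KB: "|K| \<le>o |\<Union>n. B n|"
    using assms unfolding has_card_aleph_omega_def by blast
  have an: "|aleph n| \<le>o |Kw|" for n by (rule card_of_mono1) (auto simp: Kw_def)
  have inf: "infinite Kw" using card_of_ordLeq_infinite[OF an infinite_aleph] .
  have "|\<Union>n. B n| \<le>o |Kw|"
    by (rule le_UN[OF inf le_countable[OF inf] ordIso_ordLeq_trans[OF Bn an]]) simp
  then have 1: "|K| \<le>o |Kw|" using KB ordLeq_transitive by blast
  have 2: "|aleph n| \<le>o |K|" for n
    by (rule ordIso_ordLeq_trans[OF ordIso_symmetric[OF Bn] card_of_mono1[OF B(1)]])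
  have "|Kw| \<le>o |K|"
  proof (rule ccontr)
    assume "\<not> |Kw| \<le>o |K|"
    then have "|K| <o |Kw|" using not_le_card by blast
    then obtain n where "|K| \<le>o |aleph n|" using card_less_Kw by blast
    then have "|aleph (Suc n)| \<le>o |aleph n|" using 2 ordLeq_transitive by blast
    then show False using om_Suc(1) not_ordLess_ordLeq by blast
  qed
  with 1 show ?thesis by (simp add: ordIso_iff_ordLeq)
qed

end

section \<open>Sparse cofinal families of countable sets\<close>

definition sparse_cofinal_family :: "'k set \<Rightarrow> 'a set \<Rightarrow> 'a set set \<Rightarrow> bool" where
  "sparse_cofinal_family \<kappa> M \<F> \<longleftrightarrow> (\<forall>A\<in>\<F>. A \<subseteq> M \<and> countable A) \<and>
    (\<forall>C\<subseteq>M. countable C \<longrightarrow> (\<exists>A\<in>\<F>. C \<subseteq> A)) \<and>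
    (\<forall>Z\<subseteq>M. countable Z \<longrightarrow> |{A\<in>\<F>. A \<subseteq> Z}| \<le>o |\<kappa>| )"

definition sparse_cofinal :: "'k set \<Rightarrow> 'a set \<Rightarrow> bool"
  where "sparse_cofinal \<kappa> M \<longleftrightarrow> (\<exists>\<F>. sparse_cofinal_family \<kappa> M \<F>)"

lemma sparse_cofinal_familyD:
  assumes "sparse_cofinal_family \<kappa> M \<F>"
  shows "A \<in> \<F> \<Longrightarrow> A \<subseteq> M" "A \<in> \<F> \<Longrightarrow> countable A"
    "C \<subseteq> M \<Longrightarrow> countable C \<Longrightarrow> \<exists>A\<in>\<F>. C \<subseteq> A"
    "Z \<subseteq> M \<Longrightarrow> countable Z \<Longrightarrow> |{A\<in>\<F>. A \<subseteq> Z}| \<le>o |\<kappa>|"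
  using assms unfolding sparse_cofinal_family_def by simp_all

lemma sparse_cofinal_bij:
  assumes h: "bij_betw h M N" and M: "sparse_cofinal \<kappa> M"
  shows "sparse_cofinal \<kappa> N"
proof -
  obtain \<F> where F: "sparse_cofinal_family \<kappa> M \<F>"
    using M unfolding sparse_cofinal_def by blast
  note F = sparse_cofinal_familyD[OF F]
  define h' where "h' = the_inv_into M h"
  have inj: "inj_on h M" and im: "h ` M = N" using h by (auto simp: bij_betw_def)
  have h': "h' ` N = M" "\<And>x. x \<in> M \<Longrightarrow> h' (h x) = x" "\<And>x. x \<in> N \<Longrightarrow> h (h' x) = x"
    unfolding h'_def using inj im the_inv_into_onto the_inv_into_f_f f_the_inv_into_f by fast+
  have hh: "h' ` h ` A = A" if "A \<subseteq> M" for A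
    using that h'(2) by (force simp: image_image subset_iff)
  have hh': "h ` h' ` A = A" if "A \<subseteq> N" for A
    using that h'(3) by (force simp: image_image subset_iff)
  show ?thesis
    unfolding sparse_cofinal_def sparse_cofinal_family_def
  proof (intro exI[of _ "(`) h ` \<F>"] conjI ballI allI impI)
    fix A assume "A \<in> (`) h ` \<F>"
    then obtain B where B: "A = h ` B" "B \<in> \<F>" by blast
    show "A \<subseteq> N" using F(1)[OF B(2)] B(1) im by blast
    show "countable A" using F(2)[OF B(2)] B(1) by simp
  next
    fix C assume C: "C \<subseteq> N" "countable C"
    then have "h' ` C \<subseteq> M" "countable (h' ` C)" using h'(1) by auto
    then obtain A where "A \<in> \<F>" "h' ` C \<subseteq> A" using F(3) by blast
    then show "\<exists>A\<in>(`) h ` \<F>. C \<subseteq> A" using hh'[OF C(1)] by (metis image_eqI image_mono)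
  next
    fix Z assume Z: "Z \<subseteq> N" "countable Z"
    then have Z': "h' ` Z \<subseteq> M" "countable (h' ` Z)" using h'(1) by auto
    have "{A \<in> (`) h ` \<F>. A \<subseteq> Z} \<subseteq> (`) h ` {A\<in>\<F>. A \<subseteq> h' ` Z}"
      using F(1) hh by (force dest: image_mono[of _ _ h'])
    then show "|{A \<in> (`) h ` \<F>. A \<subseteq> Z}| \<le>o |\<kappa>|"
      by (rule le_subset) (intro le_image F(4) Z')
  qed
qed

lemma sparse_cofinal_countable:
  assumes "countable M" "infinite \<kappa>" shows "sparse_cofinal \<kappa> M"
  unfolding sparse_cofinal_def sparse_cofinal_family_def
proof (intro exI[of _ "{M}"] conjI allI impI)
  fix Z :: "'a set"
  have "finite {A \<in> {M}. A \<subseteq> Z}" by (rule finite_subset[of _ "{M}"]) auto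
  then show "|{A \<in> {M}. A \<subseteq> Z}| \<le>o |\<kappa>|" by (intro le_finite assms)
qed (use assms in auto)

text \<open>A countable set has only countably many possible tags \<open>\<alpha>\<close>.\<close>

lemma sparse_cofinal_segment:
  fixes \<delta> :: "'o::wellorder"
  assumes c: "cof_gt (UNIV::nat set) \<delta>" and S: "\<And>\<alpha>. \<alpha> < \<delta> \<Longrightarrow> sparse_cofinal \<kappa> {..<\<alpha>}"
    and inf: "infinite \<kappa>"
  shows "sparse_cofinal \<kappa> {..<\<delta>}"
proof -
  obtain \<F> where "\<And>\<alpha>. \<alpha> < \<delta> \<Longrightarrow> sparse_cofinal_family \<kappa> {..<\<alpha>} (\<F> \<alpha>)"
    using S unfolding sparse_cofinal_def by metis
  note F = sparse_cofinal_familyD[OF this]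
  let ?G = "{insert \<alpha> A | \<alpha> A. \<alpha> < \<delta> \<and> A \<in> \<F> \<alpha>}"
  show ?thesis
    unfolding sparse_cofinal_def sparse_cofinal_family_def
  proof (intro exI[of _ ?G] conjI ballI allI impI)
    fix A assume "A \<in> ?G"
    then obtain \<alpha> B where A: "A = insert \<alpha> B" "\<alpha> < \<delta>" "B \<in> \<F> \<alpha>" by blast
    have "B \<subseteq> {..<\<alpha>} \<and> countable B" using F(1,2) A by blast
    then show "A \<subseteq> {..<\<delta>}" "countable A" using A by (auto intro: less_trans)
  next
    fix C assume C: "C \<subseteq> {..<\<delta>}" "countable C"
    then obtain \<alpha> where a: "\<alpha> < \<delta>" "\<forall>q\<in>C. q < \<alpha>"
      using cof_gtD[OF c] countable_iff_le by blast
    then have "C \<subseteq> {..<\<alpha>}" by auto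
    then obtain A where "A \<in> \<F> \<alpha>" "C \<subseteq> A" using F(3)[OF a(1)] C by blast
    then show "\<exists>A\<in>?G. C \<subseteq> A" using a by blast
  next
    fix Z assume Z: "Z \<subseteq> {..<\<delta>}" "countable Z"
    have "{A \<in> ?G. A \<subseteq> Z} \<subseteq> (\<Union>\<alpha>\<in>Z. insert \<alpha> ` {A \<in> \<F> \<alpha>. A \<subseteq> Z \<inter> {..<\<alpha>}})"
    proof
      fix A assume "A \<in> {A \<in> ?G. A \<subseteq> Z}"
      then obtain \<alpha> B where A: "A = insert \<alpha> B" "\<alpha> < \<delta>" "B \<in> \<F> \<alpha>" "A \<subseteq> Z" by blast
      have "B \<subseteq> Z \<inter> {..<\<alpha>}" using F(1)[OF A(2,3)] A by blast
      then show "A \<in> (\<Union>\<alpha>\<in>Z. insert \<alpha> ` {A \<in> \<F> \<alpha>. A \<subseteq> Z \<inter> {..<\<alpha>}})" using A by blast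
    qed
    moreover have "|\<Union>\<alpha>\<in>Z. insert \<alpha> ` {A \<in> \<F> \<alpha>. A \<subseteq> Z \<inter> {..<\<alpha>}}| \<le>o |\<kappa>|"
      by (intro le_UN inf le_countable le_image F(4)) (use Z in auto)
    ultimately show "|{A \<in> ?G. A \<subseteq> Z}| \<le>o |\<kappa>|" by (rule le_subset)
  qed
qed

context large_wellorder
begin

text \<open>\<open>\<omega>\<^sub>n\<^sub>+\<^sub>1\<close> has uncountable cofinality and its
  proper segments have size at most \<open>\<aleph>\<^sub>n\<close>, so the families for the
  segments can be combined.\<close>

lemma sparse_cofinal_le_aleph:
  fixes M :: "'o set"
  assumes "|M| \<le>o |aleph n|" and inf: "infinite \<kappa>"
  shows "sparse_cofinal \<kappa> M"
  using assms(1)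
proof (induction n arbitrary: M)
  case 0
  then have "countable M" using le_countable_set countable_aleph0 by blast
  then show ?case using inf by (rule sparse_cofinal_countable)
next
  case (Suc n)
  show ?case
  proof (cases "|M| \<le>o |aleph n|")
    case True
    then show ?thesis by (rule Suc.IH)
  next
    case False
    then have "\<not> |M| <o |aleph (Suc n)|" using card_less_om_Suc by blast
    then have "|aleph (Suc n)| \<le>o |M|" using not_le_card by blast
    then have "|aleph (Suc n)| =o |M|" using Suc.prems by (simp add: ordIso_iff_ordLeq)
    then obtain h where h: "bij_betw h (aleph (Suc n)) M" using card_of_ordIso by blast
    have "sparse_cofinal \<kappa> (aleph (Suc n))"
      by (rule sparse_cofinal_segment[OF cof_om_nat _ inf]) (use Suc.IH om_Suc(2) in auto)
    then show ?thesis using sparse_cofinal_bij[OF h] by blast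
  qed
qed

end

section \<open>Bases of the Pixley--Roy hyperspace\<close>

lemma is_base_openin:
  assumes "is_base Z \<B>" "V \<in> \<B>" shows "openin Z V"
  using assms(2) assms(1)[unfolded is_base_def openin_topology_base_unique] by simp

lemma is_base_ex:
  assumes "is_base Z \<B>" "openin Z W" "F \<in> W" shows "\<exists>V\<in>\<B>. F \<in> V \<and> V \<subseteq> W"
  using assms(2,3) assms(1)[unfolded is_base_def openin_topology_base_unique] by blast

lemma is_baseI:
  assumes "\<And>V. V \<in> \<B> \<Longrightarrow> openin Z V"
    and "\<And>W F. openin Z W \<Longrightarrow> F \<in> W \<Longrightarrow> \<exists>V\<in>\<B>. F \<in> V \<and> V \<subseteq> W"
  shows "is_base Z \<B>"
  unfolding is_base_def openin_topology_base_unique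
  by (intro conjI allI impI) (use assms in \<open>simp, blast\<close>)

lemma topspace_A_omega1: "topspace (A_omega1 M) = insert None (Some ` M)"
proof -
  have "insert None (Some ` (M - {})) \<in> A_omega1_base M"
    unfolding A_omega1_base_def by blast
  then have o: "openin (A_omega1 M) (insert None (Some ` M))"
    using is_base_openin[OF is_base_A_omega1, of _ M] by simp
  have "z \<in> insert None (Some ` M)" if z: "z \<in> topspace (A_omega1 M)" for z
  proof -
    obtain V where "V \<in> A_omega1_base M" "z \<in> V"
      using is_base_ex[OF is_base_A_omega1 openin_topspace z] by blast
    then show ?thesis by (auto simp: A_omega1_base_def)
  qed
  then show ?thesis using openin_subset[OF o] by blast
qed

lemma openin_A_omega1_finite: "F \<subseteq> Some ` M \<Longrightarrow> openin (A_omega1 M) F"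
proof -
  assume F: "F \<subseteq> Some ` M"
  have "openin (A_omega1 M) {z}" if "z \<in> F" for z
    by (rule is_base_openin[OF is_base_A_omega1]) (use F that in \<open>auto simp: A_omega1_base_def\<close>)
  then have "openin (A_omega1 M) (\<Union>z\<in>F. {z})" by blast
  then show ?thesis by simp
qed

lemma openin_A_omega1_cocountable:
  assumes "C \<subseteq> M" "countable C" shows "openin (A_omega1 M) (insert None (Some ` (M - C)))"
  by (rule is_base_openin[OF is_base_A_omega1]) (use assms in \<open>auto simp: A_omega1_base_def\<close>)

lemma openin_A_omega1_None:
  assumes "openin (A_omega1 M) U" "None \<in> U"
  obtains C where "C \<subseteq> M" "countable C" "insert None (Some ` (M - C)) \<subseteq> U"
proof -
  obtain V where "V \<in> A_omega1_base M" "None \<in> V" "V \<subseteq> U"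
    using is_base_ex[OF is_base_A_omega1 assms] by auto
  then show ?thesis using that by (auto simp: A_omega1_base_def)
qed

lemma openin_PR_basic:
  assumes "finite F" "F \<subseteq> topspace X" "openin X U" shows "openin (PR X) (PR_basic X F U)"
  by (rule is_base_openin[OF is_base_PR]) (use assms in \<open>auto simp: PR_base_def\<close>)

lemma openin_PR_basic_ex:
  assumes "openin (PR X) W" "G \<in> W"
  obtains U where "finite G" "G \<subseteq> topspace X" "openin X U" "G \<subseteq> U" "PR_basic X G U \<subseteq> W"
proof -
  obtain V where V: "V \<in> PR_base X" "G \<in> V" "V \<subseteq> W" using is_base_ex[OF is_base_PR assms] by auto
  from V(1) obtain F U where FU: "V = PR_basic X F U" "openin X U"
    unfolding PR_base_def by auto
  have G: "finite G" "G \<subseteq> topspace X" "F \<subseteq> G" "G \<subseteq> U"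
    using V(2) unfolding FU PR_basic_def by auto
  have "PR_basic X G U \<subseteq> V" using G(3) unfolding FU PR_basic_def by auto
  then show ?thesis using that[OF G(1,2) FU(2) G(4)] V(3) by auto
qed

abbreviation nbhd :: "'a set \<Rightarrow> 'a option set \<Rightarrow> 'a set \<Rightarrow> 'a option set set" where
  "nbhd M F A \<equiv> PR_basic (A_omega1 M) F (F \<union> insert None (Some ` (M - A)))"

lemma openin_nbhd:
  assumes "finite F" "F \<subseteq> insert None (Some ` M)" "A \<subseteq> M" "countable A"
  shows "openin (PR (A_omega1 M)) (nbhd M F A)"
proof (rule openin_PR_basic)
  have "F \<union> insert None (Some ` (M - A)) = (F - {None}) \<union> insert None (Some ` (M - A))" by auto
  moreover have "openin (A_omega1 M) (F - {None})"
    by (rule openin_A_omega1_finite) (use assms in auto)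
  ultimately show "openin (A_omega1 M) (F \<union> insert None (Some ` (M - A)))"
    using openin_A_omega1_cocountable[OF assms(3,4)] openin_Un by metis
qed (use assms in \<open>simp_all add: topspace_A_omega1\<close>)

text \<open>Finite sets without \<open>p\<close> are isolated in the hyperspace and contribute
  singletons. Only finite sets containing \<open>p\<close> need larger neighbourhoods, and there the
  excluded countable sets are taken from the sparse family.\<close>

lemma has_op_like_base_PR:
  fixes M :: "'a set"
  assumes S: "sparse_cofinal \<kappa> M" and inf: "infinite \<kappa>"
  shows "has_op_like_base (PR (A_omega1 M)) (cardSuc |\<kappa>| )"
proof -
  obtain \<F> where "sparse_cofinal_family \<kappa> M \<F>" using S unfolding sparse_cofinal_def by blast
  note F = sparse_cofinal_familyD[OF this]
  let ?X = "A_omega1 M"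
  define \<B>1 where "\<B>1 = {{F} | F. finite F \<and> F \<subseteq> Some ` M}"
  define \<B>2 where "\<B>2 = {nbhd M F A | F A. finite F \<and> F \<subseteq> insert None (Some ` M) \<and> None \<in> F \<and> A \<in> \<F>}"
  have base: "is_base (PR ?X) (\<B>1 \<union> \<B>2)"
  proof (rule is_baseI)
    fix V assume "V \<in> \<B>1 \<union> \<B>2"
    then show "openin (PR ?X) V"
    proof
      assume "V \<in> \<B>1"
      then obtain F where F: "V = {F}" "finite F" "F \<subseteq> Some ` M" unfolding \<B>1_def by blast
      then have "V = PR_basic ?X F F" by (auto simp: PR_basic_def topspace_A_omega1)
      moreover have "openin (PR ?X) (PR_basic ?X F F)"
        by (rule openin_PR_basic) (use F openin_A_omega1_finite in \<open>auto simp: topspace_A_omega1\<close>)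
      ultimately show ?thesis by simp
    next
      assume "V \<in> \<B>2"
      then obtain F A where FA: "V = nbhd M F A" "finite F" "F \<subseteq> insert None (Some ` M)" "A \<in> \<F>"
        unfolding \<B>2_def by auto
      show ?thesis unfolding FA(1) by (rule openin_nbhd[OF FA(2,3) F(1,2)[OF FA(4)]])
    qed
  next
    fix W G assume W: "openin (PR ?X) W" "G \<in> W"
    then obtain U where U: "finite G" "G \<subseteq> topspace ?X" "openin ?X U" "G \<subseteq> U" "PR_basic ?X G U \<subseteq> W"
      by (rule openin_PR_basic_ex)
    show "\<exists>V\<in>\<B>1 \<union> \<B>2. G \<in> V \<and> V \<subseteq> W"
    proof (cases "None \<in> G")
      case False
      then have "{G} \<in> \<B>1" using U unfolding \<B>1_def topspace_A_omega1 by auto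
      then show ?thesis using W by auto
    next
      case True
      then have "None \<in> U" using U(4) by auto
      then obtain C where C: "C \<subseteq> M" "countable C" "insert None (Some ` (M - C)) \<subseteq> U"
        by (rule openin_A_omega1_None[OF U(3)])
      then obtain A where A: "A \<in> \<F>" "C \<subseteq> A" using F(3)[OF C(1,2)] by auto
      have "nbhd M G A \<in> \<B>2" using U True A unfolding \<B>2_def topspace_A_omega1 by auto
      moreover have "G \<in> nbhd M G A" using U by (auto simp: PR_basic_def)
      moreover have "nbhd M G A \<subseteq> PR_basic ?X G U"
      proof -
        have "G \<union> insert None (Some ` (M - A)) \<subseteq> U" using C(3) A U(4) by blast
        then show ?thesis unfolding PR_basic_def by blast
      qed
      ultimately show ?thesis using U(5) by blast
    qed
  qed
  have "op_like (cardSuc |\<kappa>| ) (\<B>1 \<union> \<B>2)"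
    unfolding op_like_def
  proof
    fix B assume B: "B \<in> \<B>1 \<union> \<B>2"
    obtain G where G: "G \<in> B" "finite G" "None \<in> G \<Longrightarrow> \<exists>A\<in>\<F>. B = nbhd M G A"
    proof -
      from B show ?thesis
      proof
        assume "B \<in> \<B>1" then show ?thesis using that unfolding \<B>1_def by auto
      next
        assume "B \<in> \<B>2"
        then obtain F A where FA: "B = nbhd M F A" "finite F" "F \<subseteq> insert None (Some ` M)" "A \<in> \<F>"
          unfolding \<B>2_def by auto
        then have "F \<in> B" by (auto simp: PR_basic_def topspace_A_omega1)
        then show ?thesis using that[of F] FA by auto
      qed
    qed
    have 2: "|{C \<in> \<B>2. B \<subseteq> C}| \<le>o |\<kappa>|"
    proof (cases "None \<in> G")
      case False
      have "None \<in> H" if "C \<in> \<B>2" "H \<in> C" for C H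
        using that unfolding \<B>2_def PR_basic_def by auto
      then have "{C \<in> \<B>2. B \<subseteq> C} = {}" using G(1) False by auto
      then show ?thesis by (simp only: card_of_empty)
    next
      case True
      from G(3)[OF this] obtain A where A: "A \<in> \<F>" "B = nbhd M G A" by (elim bexE)
      \<comment> \<open>A point of \<open>A'\<close> outside \<open>A\<close> and \<open>G\<close>
        could be added to \<open>G\<close> without leaving \<open>B\<close>, but this would leave
        \<open>nbhd M F' A'\<close>. So \<open>A' \<subseteq> Z\<close>, and sparseness applies
        because \<open>Z\<close> is countable.\<close>
      define Z where "Z = A \<union> {x \<in> M. Some x \<in> G}"
      have "countable {x. Some x \<in> G}"
        using G(2) by (simp add: countable_finite finite_vimageI[of G Some, unfolded vimage_def])
      then have Z: "Z \<subseteq> M" "countable Z"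
        unfolding Z_def using F(1,2)[OF A(1)] by (auto intro: countable_subset)
      have "{C \<in> \<B>2. B \<subseteq> C} \<subseteq> (\<lambda>(F', A'). nbhd M F' A') ` (Pow G \<times> {A'\<in>\<F>. A' \<subseteq> Z})"
      proof
        fix C assume "C \<in> {C \<in> \<B>2. B \<subseteq> C}"
        then obtain F' A' where C: "C = nbhd M F' A'" "A' \<in> \<F>" "B \<subseteq> C"
          unfolding \<B>2_def by auto
        then have F': "F' \<subseteq> G" using G(1) by (auto simp: PR_basic_def)
        have GX: "G \<subseteq> topspace ?X" using G(1) A(2) by (auto simp: PR_basic_def)
        have "x \<in> Z" if x: "x \<in> A'" for x
        proof (cases "x \<in> A")
          case False
          have xM: "x \<in> M" using F(1)[OF C(2)] x by blast
          then have "insert (Some x) G \<in> B"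
            using G(2) GX False unfolding A(2) PR_basic_def topspace_A_omega1 by auto
          then have "Some x \<in> F' \<union> insert None (Some ` (M - A'))"
            using C(1,3) by (auto simp: PR_basic_def)
          then have "Some x \<in> G" using F' x by auto
          then show ?thesis using xM unfolding Z_def by blast
        qed (auto simp: Z_def)
        then show "C \<in> (\<lambda>(F', A'). nbhd M F' A') ` (Pow G \<times> {A'\<in>\<F>. A' \<subseteq> Z})"
          using C F' by auto
      qed
      then show ?thesis
        by (rule le_subset) (intro le_image le_Times inf F(4) Z le_finite, use G(2) in simp)
    qed
    have "{C \<in> \<B>1. B \<subseteq> C} \<subseteq> {{G}}" using G(1) unfolding \<B>1_def by auto
    then have 1: "|{C \<in> \<B>1. B \<subseteq> C}| \<le>o |\<kappa>|" by (intro le_finite inf) (rule finite_subset, auto)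
    have "{C \<in> \<B>1 \<union> \<B>2. B \<subseteq> C} = {C \<in> \<B>1. B \<subseteq> C} \<union> {C \<in> \<B>2. B \<subseteq> C}" by auto
    then have "|{C \<in> \<B>1 \<union> \<B>2. B \<subseteq> C}| \<le>o |\<kappa>|" using le_Un[OF inf 1 2] by simp
    then show "|{C \<in> \<B>1 \<union> \<B>2. B \<subseteq> C}| <o cardSuc |\<kappa>|"
      using cardSuc_ordLeq_ordLess[OF card_of_Card_order card_of_Card_order] by blast
  qed
  then show ?thesis unfolding has_op_like_base_def using base by blast
qed

section \<open>The lower bound under Chang's Conjecture\<close>

lemma PR_basic_mono: "U \<subseteq> V \<Longrightarrow> PR_basic X F U \<subseteq> PR_basic X F V"
  unfolding PR_basic_def by auto

lemma nbhd_antimono: "A \<subseteq> A' \<Longrightarrow> nbhd M F A' \<subseteq> nbhd M F A"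
  by (rule PR_basic_mono) auto

lemma not_op_like_base_chang:
  fixes K :: "'a set" and Kn :: "nat \<Rightarrow> 'a set"
  assumes K: "K = (\<Union>n. Kn n)" and Kn: "\<And>n. infinite (Kn n)" "\<And>n. |Kn n| <o |K|"
    and chang: "chang_conjecture_for K"
  shows "\<not> has_op_like_base (PR (A_omega1 K)) aleph1"
proof
  assume "has_op_like_base (PR (A_omega1 K)) aleph1"
  then obtain \<B> where base: "is_base (PR (A_omega1 K)) \<B>" and op: "op_like aleph1 \<B>"
    unfolding has_op_like_base_def by auto
  obtain k0 where k0: "k0 \<in> K" using Kn(1)[of 0] K by (metis UN_I UNIV_I finite.emptyI all_not_in_conv)
  define \<B>p where "\<B>p = {B \<in> \<B>. {None} \<in> B}"
  have "\<exists>D. D \<subseteq> K \<and> countable D \<and> D \<noteq> {} \<and> nbhd K {None} D \<subseteq> B" if B: "B \<in> \<B>p" for B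
  proof -
    have "openin (PR (A_omega1 K)) B" "{None} \<in> B"
      using B is_base_openin[OF base] unfolding \<B>p_def by auto
    then obtain U where U: "openin (A_omega1 K) U" "{None} \<subseteq> U" "PR_basic (A_omega1 K) {None} U \<subseteq> B"
      by (rule openin_PR_basic_ex)
    then obtain C where C: "C \<subseteq> K" "countable C" "insert None (Some ` (K - C)) \<subseteq> U"
      using openin_A_omega1_None[OF U(1)] by auto
    \<comment> \<open>Inserting \<open>k0\<close> makes the excluded set nonempty, so that
      \<open>from_nat_into\<close> enumerates it below.\<close>
    have "nbhd K {None} (insert k0 C) \<subseteq> PR_basic (A_omega1 K) {None} U"
      by (rule PR_basic_mono) (use C(3) in auto)
    then show ?thesis using C k0 U(3) by (intro exI[of _ "insert k0 C"]) auto
  qed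
  then obtain D where D: "\<And>B. B \<in> \<B>p \<Longrightarrow> D B \<subseteq> K" "\<And>B. B \<in> \<B>p \<Longrightarrow> countable (D B)"
    "\<And>B. B \<in> \<B>p \<Longrightarrow> D B \<noteq> {}" "\<And>B. B \<in> \<B>p \<Longrightarrow> nbhd K {None} (D B) \<subseteq> B"
    by metis
  have ex: "\<exists>B\<in>\<B>p. B \<subseteq> nbhd K {None} Z" if Z: "Z \<subseteq> K" "countable Z" for Z
  proof -
    have o: "openin (PR (A_omega1 K)) (nbhd K {None} Z)" by (rule openin_nbhd) (use Z in auto)
    have "{None} \<in> nbhd K {None} Z" unfolding PR_basic_def topspace_A_omega1 by auto
    from is_base_ex[OF base o this] show ?thesis unfolding \<B>p_def by auto
  qed
  have "\<not> |\<B>p| \<le>o |K|"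
  proof
    assume "|\<B>p| \<le>o |K|"
    then obtain j where j: "inj_on j \<B>p" "j ` \<B>p \<subseteq> K" unfolding card_of_ordLeq[symmetric] by auto
    \<comment> \<open>Diagonalization: \<open>\<B>p\<close> splits into countably many pieces
      smaller than \<open>K\<close>, and the sets \<open>D B\<close> for \<open>B\<close> in the
      \<open>n\<close>-th piece together miss a point \<open>x n\<close>. A member of
      \<open>\<B>p\<close> inside the neighbourhood excluding all \<open>x n\<close> would belong to
      some piece and yet contain \<open>{None, Some (x n)}\<close>.\<close>
    define \<B>n where "\<B>n n = {B \<in> \<B>p. j B \<in> Kn n}" for n
    have "|\<B>n n| \<le>o |Kn n|" for n
      by (rule card_of_ordLeqI[of j]) (use j in \<open>auto simp: \<B>n_def inj_on_def\<close>)
    then have "|\<Union>B\<in>\<B>n n. D B| \<le>o |Kn n|" for n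
      by (rule le_UN[OF Kn(1) _ le_countable[OF Kn(1) D(2)]]) (simp_all add: \<B>n_def)
    then have "\<exists>x. x \<in> K \<and> x \<notin> (\<Union>B\<in>\<B>n n. D B)" for n
      using le_disjoint_pick[of K "Kn n"] Kn(2)[of n] not_le_card[of K "Kn n"] by metis
    then obtain x where x: "\<And>n. x n \<in> K" "\<And>n. x n \<notin> (\<Union>B\<in>\<B>n n. D B)" by metis
    obtain B where B: "B \<in> \<B>p" "B \<subseteq> nbhd K {None} (range x)"
      using ex[of "range x"] x(1) by auto
    obtain n where "j B \<in> Kn n" using j(2) B(1) K by auto
    then have "x n \<notin> D B" using x(2)[of n] B(1) unfolding \<B>n_def by auto
    then have "{None, Some (x n)} \<in> nbhd K {None} (D B)"
      using x(1) unfolding PR_basic_def topspace_A_omega1 by auto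
    then have "{None, Some (x n)} \<in> nbhd K {None} (range x)" using D(4)[OF B(1)] B(2) by auto
    then show False unfolding PR_basic_def by auto
  qed
  then have "|K| <o |\<B>p|" using not_le_card by auto
  then have "cardSuc |K| \<le>o |\<B>p|" by (rule cardSuc_least[OF card_of_Card_order card_of_Card_order])
  define U where "U = Field (cardSuc |K| )"
  have Us: "|U| =o cardSuc |K|"
    unfolding U_def by (rule card_of_Field_ordIso[OF cardSuc_Card_order[OF card_of_Card_order]])
  from ordIso_ordLeq_trans[OF Us \<open>cardSuc |K| \<le>o |\<B>p|\<close>]
  obtain \<psi> where psi: "inj_on \<psi> U" "\<psi> ` U \<subseteq> \<B>p" unfolding card_of_ordLeq[symmetric] by auto
  obtain V where V: "V \<subseteq> U" "|K| =o |V|"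
    using internalize_card_of_ordLeq[of K "cardSuc |K|"] cardSuc_ordLeq[OF card_of_Card_order, of K]
    unfolding U_def by auto
  then obtain v where v: "bij_betw v K V" unfolding card_of_ordIso[symmetric] by auto
  have psi': "\<psi> x \<in> \<B>p" if "x \<in> U" for x using psi(2) that by auto
  \<comment> \<open>The function symbol \<open>n\<close> sends the index \<open>x\<close> to the
    \<open>n\<close>-th point of the countable set \<open>D (\<psi> x)\<close>, transported into the
    copy \<open>V\<close> of \<open>K\<close> inside the universe.\<close>
  define e where "e x n = v (from_nat_into (D (\<psi> x)) n)" for x n
  have e: "e x n \<in> V" if "x \<in> U" for x n
    using from_nat_into[OF D(3)[OF psi'[OF that]], of n] D(1)[OF psi'[OF that]] v
    unfolding e_def bij_betw_def by auto
  define \<AA> where "\<AA> = \<lparr>univ = U, fun_int = (\<lambda>n xs. e (hd xs) n), rel_int = (\<lambda>_ xs. hd xs \<in> V)\<rparr>"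
  define \<Sigma> where "\<Sigma> = \<lparr>funs = {(n, 1 :: nat) | n :: nat. True}, rels = {(0 :: nat, 1 :: nat)}\<rparr>"
  have "is_struct \<Sigma> \<AA>"
    unfolding is_struct_def
  proof (intro conjI ballI)
    have "V \<noteq> {}" using v k0 unfolding bij_betw_def by auto
    then show "univ \<AA> \<noteq> {}" using V(1) by (auto simp: \<AA>_def)
    fix p assume "p \<in> funs \<Sigma>"
    then obtain f where p: "p = (f, 1)" by (auto simp: \<Sigma>_def)
    have "fun_int \<AA> f xs \<in> univ \<AA>" if "set xs \<subseteq> univ \<AA>" "length xs = 1" for xs
    proof -
      have "hd xs \<in> U" using that by (cases xs) (auto simp: \<AA>_def)
      then show ?thesis using e V(1) by (auto simp: \<AA>_def)
    qed
    then show "case p of (f, n) \<Rightarrow> \<forall>xs. set xs \<subseteq> univ \<AA> \<and> length xs = n \<longrightarrow> fun_int \<AA> f xs \<in> univ \<AA>"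
      using p by simp
  qed
  moreover have "(0, 1) \<in> rels \<Sigma>" "|univ \<AA>| =o cardSuc |K|" by (simp_all add: \<Sigma>_def \<AA>_def Us)
  moreover have "pred_int \<AA> 0 = V" using V(1) by (auto simp: pred_int_def \<AA>_def)
  then have "|pred_int \<AA> 0| =o |K|" using ordIso_symmetric[OF V(2)] by simp
  ultimately obtain A' where A': "elementary_sub \<Sigma> A' \<AA>" "|A'| =o aleph1"
    "|pred_int (\<AA>\<lparr>univ := A'\<rparr>) 0| =o natLeq"
    using chang unfolding chang_conjecture_for_def chang_arrow_def by meson
  have sub: "A' \<subseteq> U" and str: "is_struct \<Sigma> (\<AA>\<lparr>univ := A'\<rparr>)"
    using A'(1) unfolding elementary_sub_def by (auto simp: \<AA>_def)
  have closed: "e x n \<in> A'" if "x \<in> A'" for x n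
  proof -
    have "(n, 1) \<in> funs \<Sigma>" by (simp add: \<Sigma>_def)
    then have "fun_int (\<AA>\<lparr>univ := A'\<rparr>) n [x] \<in> univ (\<AA>\<lparr>univ := A'\<rparr>)"
      using str that unfolding is_struct_def by fastforce
    then show ?thesis by (simp add: \<AA>_def)
  qed
  \<comment> \<open>The trace of the substructure on \<open>K\<close> is countable, and closure
    under \<open>e\<close> puts \<open>D (\<psi> x)\<close> into it for each of the
    \<open>\<aleph>\<^sub>1\<close> many \<open>x\<close>. A base element inside the neighbourhood
    excluding \<open>Z\<close> is then contained in every \<open>\<psi> x\<close>.\<close>
  define Z where "Z = {k \<in> K. v k \<in> A'}"
  have "|Z| \<le>o |pred_int (\<AA>\<lparr>univ := A'\<rparr>) 0|"
    by (rule card_of_ordLeqI[of v]) (use v in \<open>auto simp: Z_def pred_int_def \<AA>_def bij_betw_def inj_on_def\<close>)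
  then have "|Z| \<le>o natLeq" using A'(3) ordLeq_ordIso_trans by auto
  then have "countable Z"
    unfolding countable_iff_le using ordLeq_ordIso_trans[OF _ ordIso_symmetric[OF card_of_nat]] by auto
  then obtain B where B: "B \<in> \<B>p" "B \<subseteq> nbhd K {None} Z" using ex[of Z] by (auto simp: Z_def)
  have "\<psi> x \<in> {C \<in> \<B>. B \<subseteq> C}" if x: "x \<in> A'" for x
  proof -
    have p: "\<psi> x \<in> \<B>p" using psi' sub x by auto
    have "D (\<psi> x) \<subseteq> Z"
    proof
      fix k assume k: "k \<in> D (\<psi> x)"
      then obtain n where "k = from_nat_into (D (\<psi> x)) n"
        using from_nat_into_surj[OF D(2)[OF p] k] by auto
      then have "v k = e x n" by (simp add: e_def)
      then show "k \<in> Z" using closed[OF x] D(1)[OF p] k by (auto simp: Z_def)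
    qed
    from nbhd_antimono[OF this, of K "{None}"] D(4)[OF p] B(2) have "B \<subseteq> \<psi> x" by auto
    then show ?thesis using p by (auto simp: \<B>p_def)
  qed
  then have "|A'| \<le>o |{C \<in> \<B>. B \<subseteq> C}|"
    by (rule card_of_ordLeqI[OF inj_on_subset[OF psi(1) sub]])
  moreover have "|{C \<in> \<B>. B \<subseteq> C}| <o aleph1"
    using op B(1) unfolding op_like_def \<B>p_def by auto
  ultimately have "|A'| <o aleph1" by (rule ordLeq_ordLess_trans)
  then show False using A'(2) not_ordLess_ordIso by blast
qed

section \<open>Cofinalities of products of alephs\<close>

context large_wellorder
begin

definition prd :: "nat set \<Rightarrow> (nat \<Rightarrow> 'o) set" where "prd b = {h. \<forall>n\<in>b. h n < om n}"

definition cofinal_in :: "nat set \<Rightarrow> (nat \<Rightarrow> 'o) set \<Rightarrow> bool" where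
  "cofinal_in b F \<longleftrightarrow> F \<subseteq> prd b \<and> (\<forall>h\<in>prd b. \<exists>g\<in>F. \<forall>n\<in>b. h n \<le> g n)"

text \<open>\<open>lam b\<close> is the cofinality of \<open>\<Prod>\<^sub>n\<^sub>\<in>\<^sub>b \<omega>\<^sub>n\<close> under the pointwise order.  The subsets \<open>c\<close> of \<open>b\<close> with
  \<open>lam c < lam b\<close> form the ideal called \<open>J\<^sub><\<^sub>\<lambda>\<close> in pcf theory.\<close>

definition lam :: "nat set \<Rightarrow> 'o" where
  "lam b = (LEAST \<nu>. \<exists>F. cofinal_in b F \<and> |F| \<le>o |{..<\<nu>}| )"

definition zero :: "nat \<Rightarrow> 'o" where "zero n = (SOME x. x < om n)"

lemma zero: "zero n < om n"
  unfolding zero_def using someI_ex[OF om_pos] .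

lemma prd_mono: "c \<subseteq> d \<Longrightarrow> prd d \<subseteq> prd c"
  unfolding prd_def by auto

lemma prdD: "h \<in> prd b \<Longrightarrow> n \<in> b \<Longrightarrow> h n < om n"
  unfolding prd_def by auto

lemma prd_extend: "h \<in> prd c \<Longrightarrow> (\<lambda>n. if n \<in> c then h n else zero n) \<in> prd d"
  unfolding prd_def using zero by auto

lemma cofinal_inD: "cofinal_in b F \<Longrightarrow> h \<in> prd b \<Longrightarrow> \<exists>g\<in>F. \<forall>n\<in>b. h n \<le> g n"
  unfolding cofinal_in_def by auto

lemma cofinal_in_sub: "cofinal_in b F \<Longrightarrow> g \<in> F \<Longrightarrow> g \<in> prd b"
  unfolding cofinal_in_def by auto

lemma lam_ex: "\<exists>F. cofinal_in b F \<and> |F| \<le>o |{..<lam b}|"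
proof -
  let ?F = "{h :: nat \<Rightarrow> 'o. \<forall>n. h n < om n}"
  have F: "cofinal_in b ?F"
    unfolding cofinal_in_def
  proof (intro conjI ballI)
    fix h assume h: "h \<in> prd b"
    have "(\<lambda>n. if n \<in> b then h n else zero n) \<in> ?F" using prdD[OF h] zero by auto
    then show "\<exists>g\<in>?F. \<forall>n\<in>b. h n \<le> g n" by (rule bexI[rotated]) simp
  qed (auto simp: prd_def)
  obtain \<nu> :: 'o where "|?F| =o |{..<\<nu>}|"
    using segment_of_card[OF products] by auto
  then have "|?F| \<le>o |{..<\<nu>}|" by (simp only: ordIso_iff_ordLeq)
  with F have "\<exists>\<nu>::'o. \<exists>F. cofinal_in b F \<and> |F| \<le>o |{..<\<nu>}|" by (intro exI conjI)
  from LeastI_ex[OF this] show ?thesis unfolding lam_def .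
qed

lemma lam_le: "cofinal_in b F \<Longrightarrow> |F| \<le>o |{..<\<theta>}| \<Longrightarrow> lam b \<le> \<theta>"
  unfolding lam_def by (rule Least_le) blast

lemma lam_le_ex: "lam b \<le> \<theta> \<Longrightarrow> \<exists>F. cofinal_in b F \<and> |F| \<le>o |{..<\<theta>}|"
proof -
  assume "lam b \<le> \<theta>"
  then have "|{..<lam b}| \<le>o |{..<\<theta>}|" by (intro card_of_mono1) (auto intro: less_le_trans)
  with lam_ex[of b] show ?thesis by (auto intro: ordLeq_transitive)
qed

lemma lam_mono: assumes "c \<subseteq> d" shows "lam c \<le> lam d"
proof -
  obtain F where F: "cofinal_in d F" "|F| \<le>o |{..<lam d}|" using lam_ex by blast
  have "cofinal_in c F"
    unfolding cofinal_in_def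
  proof (intro conjI ballI)
    show "F \<subseteq> prd c" using cofinal_in_sub[OF F(1)] prd_mono[OF assms] by blast
    fix h assume "h \<in> prd c"
    from cofinal_inD[OF F(1) prd_extend[OF this]]
    obtain g where g: "g \<in> F" "\<forall>n\<in>d. (if n \<in> c then h n else zero n) \<le> g n" by auto
    have "h n \<le> g n" if "n \<in> c" for n using bspec[OF g(2), of n] that assms by auto
    then show "\<exists>g\<in>F. \<forall>n\<in>c. h n \<le> g n" using g(1) by auto
  qed
  then show ?thesis using F(2) by (rule lam_le)
qed

text \<open>Cofinal families on \<open>c\<close> and \<open>d\<close> are pasted pairwise. This is
  what makes the sets of small \<open>lam\<close> an ideal.\<close>

lemma lam_Un:
  assumes "lam c \<le> \<theta>" "lam d \<le> \<theta>" "infinite {..<\<theta>}" shows "lam (c \<union> d) \<le> \<theta>"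
proof -
  obtain F where F: "cofinal_in c F" "|F| \<le>o |{..<\<theta>}|" using lam_le_ex[OF assms(1)] by blast
  obtain G where G: "cofinal_in d G" "|G| \<le>o |{..<\<theta>}|" using lam_le_ex[OF assms(2)] by blast
  let ?m = "\<lambda>(f, g) n. if n \<in> c then f n else (g n :: 'o)"
  have "cofinal_in (c \<union> d) (?m ` (F \<times> G))"
    unfolding cofinal_in_def
  proof (intro conjI ballI)
    show "?m ` (F \<times> G) \<subseteq> prd (c \<union> d)"
      using cofinal_in_sub[OF F(1)] cofinal_in_sub[OF G(1)] by (auto simp: prd_def)
    fix h assume "h \<in> prd (c \<union> d)"
    then have h: "h \<in> prd c" "h \<in> prd d" using prd_mono[of c "c \<union> d"] prd_mono[of d "c \<union> d"] by auto
    obtain f where "f \<in> F" "\<forall>n\<in>c. h n \<le> f n" using cofinal_inD[OF F(1) h(1)] by auto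
    moreover obtain g where "g \<in> G" "\<forall>n\<in>d. h n \<le> g n" using cofinal_inD[OF G(1) h(2)] by auto
    ultimately show "\<exists>g\<in>?m ` (F \<times> G). \<forall>n\<in>c \<union> d. h n \<le> g n"
      by (intro bexI[of _ "?m (f, g)"]) auto
  qed
  then show ?thesis by (rule lam_le) (intro le_image le_Times assms F G)
qed

lemma lam_empty: "x < \<theta> \<Longrightarrow> lam {} \<le> \<theta>"
proof -
  assume "x < \<theta>"
  then have "|{zero}| \<le>o |{..<\<theta>}|" by (intro card_of_singl_ordLeq) auto
  moreover have "cofinal_in {} {zero}" unfolding cofinal_in_def prd_def by auto
  ultimately show ?thesis by (rule lam_le[rotated])
qed

text \<open>From 4 on every factor has cofinality above \<open>\<aleph>\<^sub>3\<close>, so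
  pointwise suprema of \<open>\<aleph>\<^sub>3\<close> functions stay in the product.\<close>

abbreviation a0 :: "nat set" where "a0 \<equiv> {4..}"

lemma om3_less_lam: assumes "b \<subseteq> a0" "b \<noteq> {}" shows "om 3 < lam b"
proof (rule ccontr)
  assume "\<not> om 3 < lam b"
  then obtain F where F: "cofinal_in b F" "|F| \<le>o |aleph 3|" using lam_le_ex[of b "om 3"] by (auto simp: not_less)
  obtain n where n: "n \<in> b" "3 < n" using assms by force
  have "(\<lambda>g. g n) ` F \<subseteq> {..<om n}" using cofinal_in_sub[OF F(1)] prdD n by auto
  then obtain x where x: "x < om n" "\<forall>q\<in>(\<lambda>g. g n) ` F. q < x"
    using cof_gtD[OF cof_om_le[OF n(2)], of F] le_image[OF F(2)] cof_gtD[OF cof_om_le[OF n(2) F(2)]] card_of_image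
    by blast
  have "zero(n := x) \<in> prd b" using x zero unfolding prd_def by auto
  from cofinal_inD[OF F(1) this] obtain g where "g \<in> F" "x \<le> g n" using n by fastforce
  then show False using x(2) by auto
qed

definition psup :: "'i set \<Rightarrow> ('i \<Rightarrow> nat \<Rightarrow> 'o) \<Rightarrow> nat \<Rightarrow> 'o" where
  "psup I f n = ssup ((\<lambda>i. f i n) ` I)"

lemma psup:
  assumes "b \<subseteq> a0" "|I| \<le>o |aleph 3|" "\<And>i. i \<in> I \<Longrightarrow> f i \<in> prd b"
  shows "psup I f \<in> prd b" "\<And>i n. i \<in> I \<Longrightarrow> n \<in> b \<Longrightarrow> f i n < psup I f n"
proof -
  have *: "ssup ((\<lambda>i. f i n) ` I) < om n \<and> (\<forall>i\<in>I. f i n < ssup ((\<lambda>i. f i n) ` I))" if n: "n \<in> b" for n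
  proof -
    have "3 < n" using n assms(1) by force
    then have c: "cof_gt (aleph 3) (om n :: 'o)" by (rule cof_om_le) (rule card_of_mono1, simp)
    have s: "(\<lambda>i. f i n) ` I \<subseteq> {..<om n}" using prdD[OF assms(3) n] by auto
    show ?thesis using cof_gt_ssup[OF c s le_image[OF assms(2)]] by auto
  qed
  then show "psup I f \<in> prd b" "\<And>i n. i \<in> I \<Longrightarrow> n \<in> b \<Longrightarrow> f i n < psup I f n"
    unfolding prd_def psup_def by auto
qed

text \<open>Directedness modulo the ideal.  The functions \<open>g\<^sub>i\<close> (\<open>i < \<omega>\<^sub>1\<close>) improve on each other; the set of
  coordinates where a late \<open>f\<^sub>\<gamma>\<close> exceeds \<open>g\<^sub>i\<close> cannot shrink strictly \<open>\<omega>\<^sub>1\<close> times.\<close>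

lemma bounded_mod:
  assumes b: "b \<subseteq> a0" and "\<And>\<gamma>. \<gamma> < \<theta> \<Longrightarrow> h \<gamma> \<in> prd b"
  shows "\<exists>g\<in>prd b. \<forall>\<gamma><\<theta>. lam {n\<in>b. g n < h \<gamma> n} \<le> max \<theta> (om 3)"
  using assms(2)
proof (induction \<theta> arbitrary: h rule: less_induct)
  case (less \<theta>)
  define \<mu> where "\<mu> = max \<theta> (om 3)"
  have "aleph 3 \<subseteq> {..<\<mu>}" unfolding \<mu>_def by auto
  then have inf: "infinite {..<\<mu>}" using infinite_aleph finite_subset by blast
  have th_mu: "|{..<\<theta>}| \<le>o |{..<\<mu>}|" unfolding \<mu>_def by (intro card_of_mono1) auto
  have J_sub: "c \<subseteq> d \<Longrightarrow> lam d \<le> \<mu> \<Longrightarrow> lam c \<le> \<mu>" for c d using lam_mono order_trans by blast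
  have J_empty: "lam {} \<le> \<mu>" using lam_empty[of "zero 3" \<mu>] zero[of 3] unfolding \<mu>_def by (simp add: less_max_iff_disj)
  \<comment> \<open>The given functions are first replaced by larger ones that increase modulo the
    ideal; the induction hypothesis bounds the predecessors of each.\<close>
  have "\<exists>f::'o \<Rightarrow> nat \<Rightarrow> 'o. \<forall>\<gamma>. \<gamma> < \<theta> \<longrightarrow> f \<gamma> \<in> prd b \<and> (\<forall>n\<in>b. h \<gamma> n \<le> f \<gamma> n) \<and> (\<forall>\<eta><\<gamma>. lam {n\<in>b. f \<gamma> n < f \<eta> n} \<le> \<mu>)"
  proof (rule dependent_wellorder_choice)
    fix r :: "nat \<Rightarrow> 'o" and f g :: "'o \<Rightarrow> nat \<Rightarrow> 'o" and x :: 'o assume "\<And>y. y < x \<Longrightarrow> f y = g y"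
    then show "(x < \<theta> \<longrightarrow> r \<in> prd b \<and> (\<forall>n\<in>b. h x n \<le> r n) \<and> (\<forall>\<eta><x. lam {n\<in>b. r n < f \<eta> n} \<le> \<mu>)) \<longleftrightarrow>
      (x < \<theta> \<longrightarrow> r \<in> prd b \<and> (\<forall>n\<in>b. h x n \<le> r n) \<and> (\<forall>\<eta><x. lam {n\<in>b. r n < g \<eta> n} \<le> \<mu>))"
      by simp
  next
    fix \<gamma> :: 'o and f :: "'o \<Rightarrow> nat \<Rightarrow> 'o"
    assume f: "\<And>y. y < \<gamma> \<Longrightarrow> y < \<theta> \<longrightarrow> f y \<in> prd b \<and> (\<forall>n\<in>b. h y n \<le> f y n) \<and> (\<forall>\<eta><y. lam {n\<in>b. f y n < f \<eta> n} \<le> \<mu>)"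
    show "\<exists>r. \<gamma> < \<theta> \<longrightarrow> r \<in> prd b \<and> (\<forall>n\<in>b. h \<gamma> n \<le> r n) \<and> (\<forall>\<eta><\<gamma>. lam {n\<in>b. r n < f \<eta> n} \<le> \<mu>)"
    proof (cases "\<gamma> < \<theta>")
      case True
      have "\<exists>g\<in>prd b. \<forall>\<eta><\<gamma>. lam {n\<in>b. g n < f \<eta> n} \<le> max \<gamma> (om 3)"
        by (rule less.IH[OF True]) (use f True in \<open>auto intro: less_trans\<close>)
      then obtain g where g: "g \<in> prd b" "\<And>\<eta>. \<eta> < \<gamma> \<Longrightarrow> lam {n\<in>b. g n < f \<eta> n} \<le> max \<gamma> (om 3)" by blast
      let ?r = "\<lambda>n. max (g n) (h \<gamma> n)"
      have "?r \<in> prd b" using g(1) less.prems[OF True] by (auto simp: prd_def)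
      moreover have "lam {n\<in>b. ?r n < f \<eta> n} \<le> \<mu>" if "\<eta> < \<gamma>" for \<eta>
      proof (rule J_sub)
        show "{n\<in>b. ?r n < f \<eta> n} \<subseteq> {n\<in>b. g n < f \<eta> n}" by auto
        have "max \<gamma> (om 3) \<le> \<mu>" using True unfolding \<mu>_def by (auto simp: max_def)
        then show "lam {n\<in>b. g n < f \<eta> n} \<le> \<mu>" using g(2)[OF that] by (rule order_trans[rotated])
      qed
      ultimately show ?thesis by (intro exI[of _ ?r]) auto
    qed simp
  qed
  then obtain f where f: "\<And>\<gamma>. \<gamma> < \<theta> \<Longrightarrow> f \<gamma> \<in> prd b" "\<And>\<gamma> n. \<gamma> < \<theta> \<Longrightarrow> n \<in> b \<Longrightarrow> h \<gamma> n \<le> f \<gamma> n"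
    "\<And>\<gamma> \<eta>. \<gamma> < \<theta> \<Longrightarrow> \<eta> < \<gamma> \<Longrightarrow> lam {n\<in>b. f \<gamma> n < f \<eta> n} \<le> \<mu>"
    by auto
  have f3: "lam {n\<in>b. f \<gamma> n < f \<eta> n} \<le> \<mu>" if "\<gamma> < \<theta>" "\<eta> \<le> \<gamma>" for \<gamma> \<eta>
  proof (cases "\<eta> = \<gamma>")
    case True
    then show ?thesis using J_empty by simp
  qed (use that f(3)[of \<gamma> \<eta>] in auto)
  have "\<exists>g\<in>prd b. \<forall>\<gamma><\<theta>. lam {n\<in>b. g n < f \<gamma> n} \<le> \<mu>"
  proof (cases "cof_gt (aleph 3) \<theta>")
    case False
    then obtain Q where Q: "Q \<subseteq> {..<\<theta>}" "|Q| \<le>o |aleph 3|" "\<forall>x<\<theta>. \<exists>q\<in>Q. x \<le> q"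
      by (rule not_cof_gtE)
    have fQ: "\<And>q. q \<in> Q \<Longrightarrow> f q \<in> prd b" using Q(1) f(1) by auto
    show ?thesis
    proof (intro bexI[of _ "psup Q f"] allI impI)
      show "psup Q f \<in> prd b" by (rule psup(1)[of b Q f, OF b Q(2) fQ])
      fix \<gamma> assume "\<gamma> < \<theta>"
      then obtain q where q: "q \<in> Q" "\<gamma> \<le> q" using Q(3) by auto
      show "lam {n\<in>b. psup Q f n < f \<gamma> n} \<le> \<mu>"
      proof (rule J_sub)
        show "{n\<in>b. psup Q f n < f \<gamma> n} \<subseteq> {n\<in>b. f q n < f \<gamma> n}"
          using psup(2)[of b Q f, OF b Q(2) fQ q(1)] by (auto intro: less_trans)
        show "lam {n\<in>b. f q n < f \<gamma> n} \<le> \<mu>" using f3 q Q(1) by auto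
      qed
    qed
  next
    case cof: True
    show ?thesis
    proof (rule ccontr)
      assume neg: "\<not> ?thesis"
      define bad where "bad \<gamma> g = {n\<in>b. g n < f \<gamma> n}" for \<gamma> g
      have step: "\<exists>g' \<beta>. g \<in> prd b \<longrightarrow> g' \<in> prd b \<and> \<beta> < \<theta> \<and>
        (\<forall>\<gamma>. \<beta> \<le> \<gamma> \<and> \<gamma> < \<theta> \<longrightarrow> (\<exists>n\<in>bad \<gamma> g. n \<notin> bad \<gamma> g'))" for g
      proof (cases "g \<in> prd b")
        case g: True
        then obtain \<beta> where be: "\<beta> < \<theta>" "\<not> lam (bad \<beta> g) \<le> \<mu>" using neg unfolding bad_def by blast
        define b' where "b' = bad \<beta> g"
        have b'b: "b' \<subseteq> b" unfolding b'_def bad_def by auto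
        define c where "c \<gamma> = b' - bad \<gamma> g" for \<gamma>
        have "lam (c \<gamma>) \<le> \<mu>" if "\<beta> \<le> \<gamma>" "\<gamma> < \<theta>" for \<gamma>
          by (rule J_sub[OF _ f3[OF that(2,1)]]) (auto simp: c_def b'_def bad_def not_less)
        then have "\<exists>G. \<beta> \<le> \<gamma> \<and> \<gamma> < \<theta> \<longrightarrow> cofinal_in (c \<gamma>) G \<and> |G| \<le>o |{..<\<mu>}|" for \<gamma>
          using lam_le_ex by blast
        then obtain G where G: "\<And>\<gamma>. \<beta> \<le> \<gamma> \<Longrightarrow> \<gamma> < \<theta> \<Longrightarrow> cofinal_in (c \<gamma>) (G \<gamma>)"
          "\<And>\<gamma>. \<beta> \<le> \<gamma> \<Longrightarrow> \<gamma> < \<theta> \<Longrightarrow> |G \<gamma>| \<le>o |{..<\<mu>}|" by metis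
        \<comment> \<open>If \<open>\<F>\<close> were cofinal on \<open>b'\<close>, then
          \<open>lam b'\<close> would be at most \<mu>. A function \<open>h'\<close> not dominated
          by \<open>\<F>\<close> is dominated on \<open>c \<gamma>\<close> by some member of
          \<open>G \<gamma>\<close>, so it must exceed \<open>f \<gamma>\<close> elsewhere in
          \<open>b'\<close>. Joining \<open>h'\<close> to \<open>g\<close> thus removes a bad
          coordinate for every late \<gamma> at once.\<close>
        define \<F> where "\<F> = (\<Union>\<gamma>\<in>{\<beta>..<\<theta>}. (\<lambda>k n. if n \<in> c \<gamma> then k n else f \<gamma> n) ` G \<gamma>)"
        have "|{\<beta>..<\<theta>}| \<le>o |{..<\<mu>}|" by (rule le_subset[OF _ th_mu]) auto
        then have "|\<F>| \<le>o |{..<\<mu>}|"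
          unfolding \<F>_def by (rule le_UN[OF inf]) (intro le_image G(2), auto)
        then have ncf: "\<not> cofinal_in b' \<F>" using be(2) lam_le unfolding b'_def by blast
        have "\<F> \<subseteq> prd b'"
        proof
          fix k' assume "k' \<in> \<F>"
          then obtain \<gamma> k where k: "\<beta> \<le> \<gamma>" "\<gamma> < \<theta>" "k \<in> G \<gamma>" "k' = (\<lambda>n. if n \<in> c \<gamma> then k n else f \<gamma> n)"
            unfolding \<F>_def by auto
          have "k n < om n" if "n \<in> c \<gamma>" for n
            using cofinal_in_sub[OF G(1)[OF k(1,2)] k(3)] that by (rule prdD)
          moreover have "f \<gamma> n < om n" if "n \<in> b'" for n using prdD[OF f(1)[OF k(2)]] that b'b by auto
          ultimately show "k' \<in> prd b'" unfolding k(4) prd_def by auto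
        qed
        then obtain h' where h': "h' \<in> prd b'" "\<And>k. k \<in> \<F> \<Longrightarrow> \<exists>n\<in>b'. k n < h' n"
          using ncf unfolding cofinal_in_def by (auto simp: not_le)
        define g' where "g' n = (if n \<in> b' then max (g n) (h' n) else g n)" for n
        have "g' \<in> prd b" using g h'(1) unfolding g'_def prd_def by auto
        moreover have "\<exists>n\<in>bad \<gamma> g. n \<notin> bad \<gamma> g'" if ga: "\<beta> \<le> \<gamma>" "\<gamma> < \<theta>" for \<gamma>
        proof -
          have "h' \<in> prd (c \<gamma>)" using h'(1) prd_mono[of "c \<gamma>" b'] unfolding c_def by auto
          from cofinal_inD[OF G(1)[OF ga] this]
          obtain k where k: "k \<in> G \<gamma>" "\<forall>n\<in>c \<gamma>. h' n \<le> k n" by auto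
          have "(\<lambda>n. if n \<in> c \<gamma> then k n else f \<gamma> n) \<in> \<F>" unfolding \<F>_def using k(1) ga by auto
          from h'(2)[OF this] obtain n where n: "n \<in> b'" "(if n \<in> c \<gamma> then k n else f \<gamma> n) < h' n" by auto
          then have "n \<notin> c \<gamma>" "f \<gamma> n < h' n" using k(2) by (auto split: if_splits simp: not_le[symmetric])
          then have "n \<in> bad \<gamma> g" "n \<notin> bad \<gamma> g'" using n(1) unfolding c_def bad_def g'_def by auto
          then show ?thesis by blast
        qed
        ultimately show ?thesis using be(1) by blast
      qed simp
      have "\<forall>g. \<exists>p. g \<in> prd b \<longrightarrow> fst p \<in> prd b \<and> snd p < \<theta> \<and>
        (\<forall>\<gamma>. snd p \<le> \<gamma> \<and> \<gamma> < \<theta> \<longrightarrow> (\<exists>n\<in>bad \<gamma> g. n \<notin> bad \<gamma> (fst p)))"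
        using step by simp
      from choice[OF this] obtain p where p: "\<And>g. g \<in> prd b \<Longrightarrow> fst (p g) \<in> prd b"
        "\<And>g. g \<in> prd b \<Longrightarrow> snd (p g) < \<theta>"
        "\<And>g \<gamma>. g \<in> prd b \<Longrightarrow> snd (p g) \<le> \<gamma> \<Longrightarrow> \<gamma> < \<theta> \<Longrightarrow> \<exists>n\<in>bad \<gamma> g. n \<notin> bad \<gamma> (fst (p g))"
        by auto
      \<comment> \<open>The correction is iterated with pointwise strict suprema. A \<beta> beyond
        all \<open>\<omega>\<^sub>1\<close> thresholds loses a new bad coordinate at every stage,
        which would inject \<open>\<omega>\<^sub>1\<close> into \<open>nat\<close>.\<close>
      have "\<exists>G. \<forall>i::'o. G i = psup {..<i} (\<lambda>j. fst (p (G j)))"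
      proof (rule dependent_wellorder_choice)
        fix r f g and x :: 'o assume "\<And>y. y < x \<Longrightarrow> f y = (g y :: nat \<Rightarrow> 'o)"
        then have "psup {..<x} (\<lambda>j. fst (p (f j))) = psup {..<x} (\<lambda>j. fst (p (g j)))"
          unfolding psup_def by (intro ext arg_cong[of _ _ ssup] image_cong) auto
        then show "(r = psup {..<x} (\<lambda>j. fst (p (f j)))) = (r = psup {..<x} (\<lambda>j. fst (p (g j))))" by simp
      qed simp
      then obtain G where G: "\<And>i::'o. G i = psup {..<i} (\<lambda>j. fst (p (G j)))" by auto
      have small: "|{..<i}| \<le>o |aleph 3|" if "i < om 1" for i :: 'o
        using om_Suc(2)[of i 0] that aleph_mono[of 0 3] ordLeq_transitive by auto
      have Gp: "G i \<in> prd b" if "i < om 1" for i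
        using that
      proof (induction i rule: less_induct)
        case (less i)
        then have "\<And>j. j \<in> {..<i} \<Longrightarrow> fst (p (G j)) \<in> prd b" using p(1) by (auto intro: less_trans)
        from psup(1)[of b "{..<i}" "\<lambda>j. fst (p (G j))", OF b small[OF less.prems] this] show ?case unfolding G[of i] .
      qed
      have Gl: "fst (p (G j)) n < G i n" if "i < om 1" "j < i" "n \<in> b" for i j n
        unfolding G[of i]
        by (rule psup(2)[OF b small[OF that(1)]]) (use that p(1) Gp in \<open>auto intro: less_trans\<close>)
      have sz: "|(\<lambda>i. snd (p (G i))) ` aleph 1| \<le>o |aleph 3|"
        by (rule le_image) (rule aleph_mono, simp)
      have "(\<lambda>i. snd (p (G i))) ` aleph 1 \<subseteq> {..<\<theta>}" using p(2) Gp by auto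
      from cof_gtD[OF cof this sz]
      obtain \<beta> where be: "\<beta> < \<theta>" "\<And>i. i < om 1 \<Longrightarrow> snd (p (G i)) < \<beta>" by auto
      have "\<exists>n. n \<in> bad \<beta> (G i) \<and> n \<notin> bad \<beta> (fst (p (G i)))" if "i < om 1" for i
        using p(3)[OF Gp[OF that] less_imp_le[OF be(2)[OF that]] be(1)] by auto
      then obtain N where N: "\<And>i. i < om 1 \<Longrightarrow> N i \<in> bad \<beta> (G i) \<and> N i \<notin> bad \<beta> (fst (p (G i)))"
        by metis
      have "inj_on N (aleph 1)"
      proof (rule linorder_inj_onI)
        fix i j :: 'o assume ij: "i < j" "i \<in> aleph 1" "j \<in> aleph 1"
        show "N i \<noteq> N j"
        proof
          assume e: "N i = N j"
          have "N j \<in> b" "G j (N j) < f \<beta> (N j)" using N[of j] ij by (auto simp: bad_def)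
          moreover have "fst (p (G i)) (N j) < G j (N j)" using Gl ij calculation by auto
          ultimately have "N j \<in> bad \<beta> (fst (p (G i)))" by (auto simp: bad_def intro: less_trans)
          then show False using N[of i] ij e by auto
        qed
      qed auto
      then have "countable (aleph 1)" by (rule countableI)
      then have "|aleph (Suc 0)| \<le>o |aleph 0|" by (intro le_countable infinite_aleph) simp
      then show False using om_Suc(1)[of 0] not_ordLess_ordLeq by blast
    qed
  qed
  then obtain g where g: "g \<in> prd b" "\<And>\<gamma>. \<gamma> < \<theta> \<Longrightarrow> lam {n\<in>b. g n < f \<gamma> n} \<le> \<mu>" by auto
  have "lam {n\<in>b. g n < h \<gamma> n} \<le> \<mu>" if "\<gamma> < \<theta>" for \<gamma>
    by (rule J_sub[OF _ g(2)[OF that]]) (use f(2)[OF that] in \<open>auto intro: less_le_trans\<close>)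
  then show ?case using g(1) unfolding \<mu>_def by blast
qed

section \<open>Scales modulo the ideal\<close>

definition small_club :: "'o \<Rightarrow> 'o set" where
  "small_club \<xi> = (if \<exists>E. club \<xi> E \<and> |E| \<le>o |aleph 3| then SOME E. club \<xi> E \<and> |E| \<le>o |aleph 3| else {})"

lemma small_club:
  "|small_club \<xi>| \<le>o |aleph 3|" "small_club \<xi> \<subseteq> {..<\<xi>}"
  "club \<xi> E \<Longrightarrow> |E| \<le>o |aleph 3| \<Longrightarrow> club \<xi> (small_club \<xi>)"
proof -
  have *: "club \<xi> (small_club \<xi>) \<and> |small_club \<xi>| \<le>o |aleph 3|" if "\<exists>E. club \<xi> E \<and> |E| \<le>o |aleph 3|"
    using someI_ex[OF that] unfolding small_club_def if_P[OF that] .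
  have **: "small_club \<xi> = {}" if "\<not> (\<exists>E. club \<xi> E \<and> |E| \<le>o |aleph 3| )"
    unfolding small_club_def by (rule if_not_P[OF that])
  show "|small_club \<xi>| \<le>o |aleph 3|"
  proof (cases "\<exists>E. club \<xi> E \<and> |E| \<le>o |aleph 3|")
    case True
    then show ?thesis using * by blast
  next
    case False
    show ?thesis unfolding **[OF False] by (rule card_of_empty)
  qed
  show "small_club \<xi> \<subseteq> {..<\<xi>}"
  proof (cases "\<exists>E. club \<xi> E \<and> |E| \<le>o |aleph 3|")
    case True
    then have "club \<xi> (small_club \<xi>)" using * by simp
    then show ?thesis unfolding club_def by simp
  qed (simp add: **)
  show "club \<xi> E \<Longrightarrow> |E| \<le>o |aleph 3| \<Longrightarrow> club \<xi> (small_club \<xi>)" using * by blast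
qed

text \<open>Cofinality is required on all of \<open>b\<close>, not only modulo the ideal. The last
  clause is a form of continuity: where \<xi> has a club of size at most
  \<open>\<aleph>\<^sub>3\<close>, the function at \<xi> dominates, at every coordinate, the
  functions along one such club.\<close>

definition is_scale :: "nat set \<Rightarrow> ('o \<Rightarrow> nat \<Rightarrow> 'o) \<Rightarrow> bool" where
  "is_scale b f \<longleftrightarrow> (\<forall>\<xi><lam b. f \<xi> \<in> prd b) \<and>
    (\<forall>h\<in>prd b. \<exists>\<xi><lam b. \<forall>n\<in>b. h n \<le> f \<xi> n) \<and>
    (\<forall>\<xi><lam b. \<forall>\<eta><\<xi>. lam {n\<in>b. f \<xi> n \<le> f \<eta> n} < lam b) \<and>
    (\<forall>\<xi><lam b. \<forall>\<eta>\<in>small_club \<xi>. \<forall>n\<in>b. f \<eta> n \<le> f \<xi> n)"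

lemma ex_scale:
  assumes b: "b \<subseteq> a0" "b \<noteq> {}" shows "\<exists>f. is_scale b f"
proof -
  obtain F where F: "cofinal_in b F" "|F| \<le>o |{..<lam b}|" using lam_ex by blast
  have "zero \<in> prd b" using zero by (auto simp: prd_def)
  then have "F \<noteq> {}" using cofinal_inD[OF F(1)] by fastforce
  from iffD2[OF card_of_ordLeq2[OF this] F(2)] obtain e where e: "e ` {..<lam b} = F" by auto
  then have ep: "e \<xi> \<in> prd b" if "\<xi> < lam b" for \<xi> using cofinal_in_sub[OF F(1)] that by auto
  have "\<exists>f::'o \<Rightarrow> nat \<Rightarrow> 'o. \<forall>\<xi>. \<xi> < lam b \<longrightarrow> f \<xi> \<in> prd b \<and> (\<forall>n\<in>b. e \<xi> n \<le> f \<xi> n) \<and>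
    (\<forall>\<eta><\<xi>. lam {n\<in>b. f \<xi> n \<le> f \<eta> n} < lam b) \<and> (\<forall>\<eta>\<in>small_club \<xi>. \<forall>n\<in>b. f \<eta> n \<le> f \<xi> n)"
  proof (rule dependent_wellorder_choice)
    fix r :: "nat \<Rightarrow> 'o" and f g :: "'o \<Rightarrow> nat \<Rightarrow> 'o" and x :: 'o assume fg: "\<And>y. y < x \<Longrightarrow> f y = (g y :: nat \<Rightarrow> 'o)"
    have "\<And>\<eta>. \<eta> \<in> small_club x \<Longrightarrow> f \<eta> = g \<eta>" using small_club(2) fg by blast
    then show "(x < lam b \<longrightarrow> r \<in> prd b \<and> (\<forall>n\<in>b. e x n \<le> r n) \<and>
      (\<forall>\<eta><x. lam {n\<in>b. r n \<le> f \<eta> n} < lam b) \<and> (\<forall>\<eta>\<in>small_club x. \<forall>n\<in>b. f \<eta> n \<le> r n)) \<longleftrightarrow>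
      (x < lam b \<longrightarrow> r \<in> prd b \<and> (\<forall>n\<in>b. e x n \<le> r n) \<and>
      (\<forall>\<eta><x. lam {n\<in>b. r n \<le> g \<eta> n} < lam b) \<and> (\<forall>\<eta>\<in>small_club x. \<forall>n\<in>b. g \<eta> n \<le> r n))"
      using fg by simp
  next
    fix \<xi> :: 'o and f :: "'o \<Rightarrow> nat \<Rightarrow> 'o"
    assume f: "\<And>y. y < \<xi> \<Longrightarrow> y < lam b \<longrightarrow> f y \<in> prd b \<and> (\<forall>n\<in>b. e y n \<le> f y n) \<and>
      (\<forall>\<eta><y. lam {n\<in>b. f y n \<le> f \<eta> n} < lam b) \<and> (\<forall>\<eta>\<in>small_club y. \<forall>n\<in>b. f \<eta> n \<le> f y n)"
    show "\<exists>r. \<xi> < lam b \<longrightarrow> r \<in> prd b \<and> (\<forall>n\<in>b. e \<xi> n \<le> r n) \<and>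
      (\<forall>\<eta><\<xi>. lam {n\<in>b. r n \<le> f \<eta> n} < lam b) \<and> (\<forall>\<eta>\<in>small_club \<xi>. \<forall>n\<in>b. f \<eta> n \<le> r n)"
    proof (cases "\<xi> < lam b")
      case xi: True
      have fp: "f \<eta> \<in> prd b" if "\<eta> < \<xi>" for \<eta> using f[OF that] that xi by auto
      \<comment> \<open>\<open>psup {\<eta>} f\<close> is strictly above \<open>f \<eta>\<close> at
        every coordinate of \<open>b\<close>. Bounding it instead of \<open>f \<eta>\<close> turns a
        weak bound modulo the ideal into a strict increase.\<close>
      let ?s = "\<lambda>\<eta>. psup {\<eta>} f"
      have one: "|{\<eta>}| \<le>o |aleph 3|" for \<eta> :: 'o by (intro le_finite infinite_aleph) simp
      have sp: "?s \<eta> \<in> prd b" "\<And>n. n \<in> b \<Longrightarrow> f \<eta> n < ?s \<eta> n" if "\<eta> < \<xi>" for \<eta>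
        using psup[OF b(1) one[of \<eta>], of f] fp[OF that] by auto
      obtain g where g: "g \<in> prd b" "\<And>\<eta>. \<eta> < \<xi> \<Longrightarrow> lam {n\<in>b. g n < ?s \<eta> n} \<le> max \<xi> (om 3)"
        using bounded_mod[OF b(1), of \<xi> ?s] sp(1) by auto
      have lt: "max \<xi> (om 3) < lam b" using om3_less_lam[OF b] xi by auto
      let ?t = "psup (small_club \<xi>) f"
      have fc: "f \<eta> \<in> prd b" if "\<eta> \<in> small_club \<xi>" for \<eta> using fp small_club(2)[of \<xi>] that by auto
      note tp = psup[of b "small_club \<xi>" f, OF b(1) small_club(1) fc]
      let ?r = "\<lambda>n. max (g n) (max (e \<xi> n) (?t n))"
      have "?r \<in> prd b" using g(1) tp(1) ep[OF xi] by (auto simp: prd_def)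
      moreover have "lam {n\<in>b. ?r n \<le> f \<eta> n} < lam b" if "\<eta> < \<xi>" for \<eta>
      proof -
        have "{n\<in>b. ?r n \<le> f \<eta> n} \<subseteq> {n\<in>b. g n < ?s \<eta> n}" using sp(2)[OF that] by (auto intro: le_less_trans)
        from order_trans[OF lam_mono[OF this] g(2)[OF that]] lt show ?thesis by (rule le_less_trans)
      qed
      moreover have "f \<eta> n \<le> ?r n" if "\<eta> \<in> small_club \<xi>" "n \<in> b" for \<eta> n
        using tp(2)[of \<eta> n] that by (simp add: le_max_iff_disj less_imp_le)
      moreover have "e \<xi> n \<le> ?r n" for n by (simp add: le_max_iff_disj)
      ultimately show ?thesis by (intro exI[of _ ?r]) blast
    qed simp
  qed
  then obtain f where f0: "\<forall>\<xi>. \<xi> < lam b \<longrightarrow> f \<xi> \<in> prd b \<and> (\<forall>n\<in>b. e \<xi> n \<le> f \<xi> n) \<and>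
    (\<forall>\<eta><\<xi>. lam {n\<in>b. f \<xi> n \<le> f \<eta> n} < lam b) \<and> (\<forall>\<eta>\<in>small_club \<xi>. \<forall>n\<in>b. f \<eta> n \<le> f \<xi> n)"
    by (rule exE)
  have f: "\<forall>\<xi><lam b. f \<xi> \<in> prd b" "\<forall>\<xi><lam b. \<forall>n\<in>b. e \<xi> n \<le> f \<xi> n"
    "\<forall>\<xi><lam b. \<forall>\<eta><\<xi>. lam {n\<in>b. f \<xi> n \<le> f \<eta> n} < lam b"
    "\<forall>\<xi><lam b. \<forall>\<eta>\<in>small_club \<xi>. \<forall>n\<in>b. f \<eta> n \<le> f \<xi> n"
    by (simp_all add: f0)
  have "\<exists>\<xi><lam b. \<forall>n\<in>b. h n \<le> f \<xi> n" if h: "h \<in> prd b" for h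
  proof -
    obtain g where g: "g \<in> F" "\<forall>n\<in>b. h n \<le> g n" using cofinal_inD[OF F(1) h] by auto
    then obtain \<xi> where "\<xi> < lam b" "g = e \<xi>" using e by auto
    then show ?thesis using f(2) g(2) by (blast intro: order_trans)
  qed
  then show ?thesis unfolding is_scale_def using f(1,3,4) by blast
qed

text \<open>If \<open>\<aleph>\<^sub>3\<close> indices were cofinal, some scale function would
  dominate the pointwise supremum of their functions, and hence the function of a later index, on
  all of \<open>b\<close>. This contradicts the increase modulo the ideal.\<close>

lemma cof_lam:
  assumes b: "b \<subseteq> a0" "b \<noteq> {}" shows "cof_gt (aleph 3) (lam b)"
proof (rule ccontr)
  assume "\<not> cof_gt (aleph 3) (lam b)"
  then obtain Q where Q: "Q \<subseteq> {..<lam b}" "|Q| \<le>o |aleph 3|" "\<forall>x<lam b. \<exists>q\<in>Q. x \<le> q"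
    by (rule not_cof_gtE)
  obtain f where f: "is_scale b f" using ex_scale[OF b] by auto
  have fQ: "f q \<in> prd b" if "q \<in> Q" for q using f Q(1) that unfolding is_scale_def by auto
  note ps = psup[of b Q f, OF b(1) Q(2) fQ]
  have "psup Q f \<in> prd b" using ps(1) by simp
  with f obtain \<xi> where xi: "\<xi> < lam b" "\<forall>n\<in>b. psup Q f n \<le> f \<xi> n" unfolding is_scale_def by auto
  obtain q where q: "q \<in> Q" "\<xi> \<le> q" using Q(3) xi(1) by auto
  have lt: "f q n < f \<xi> n" if "n \<in> b" for n using ps(2)[of q n] q(1) xi(2) that by (auto intro: less_le_trans)
  then have "\<xi> \<noteq> q" using b(2) by auto
  then have "lam {n\<in>b. f q n \<le> f \<xi> n} < lam b" using f q Q(1) unfolding is_scale_def by auto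
  moreover have "{n\<in>b. f q n \<le> f \<xi> n} = b" using lt by (auto intro: less_imp_le)
  ultimately show False by simp
qed

end

section \<open>Covering countable subsets of \<open>\<omega>\<^sub>\<omega>\<close>\<close>

context large_wellorder
begin

definition scale :: "nat set \<Rightarrow> 'o \<Rightarrow> nat \<Rightarrow> 'o" where "scale b = (SOME f. is_scale b f)"

lemma scale:
  assumes "b \<subseteq> a0" "b \<noteq> {}"
  shows scale_prd: "\<xi> < lam b \<Longrightarrow> scale b \<xi> \<in> prd b"
    and scale_cofinal: "h \<in> prd b \<Longrightarrow> \<exists>\<xi><lam b. \<forall>n\<in>b. h n \<le> scale b \<xi> n"
    and scale_increasing: "\<xi> < lam b \<Longrightarrow> \<eta> < \<xi> \<Longrightarrow> lam {n\<in>b. scale b \<xi> n \<le> scale b \<eta> n} < lam b"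
    and scale_club: "\<xi> < lam b \<Longrightarrow> \<eta> \<in> small_club \<xi> \<Longrightarrow> n \<in> b \<Longrightarrow> scale b \<eta> n \<le> scale b \<xi> n"
proof -
  have "is_scale b (scale b)" unfolding scale_def using someI_ex[OF ex_scale[OF assms]] .
  then show "\<xi> < lam b \<Longrightarrow> scale b \<xi> \<in> prd b"
    "h \<in> prd b \<Longrightarrow> \<exists>\<xi><lam b. \<forall>n\<in>b. h n \<le> scale b \<xi> n"
    "\<xi> < lam b \<Longrightarrow> \<eta> < \<xi> \<Longrightarrow> lam {n\<in>b. scale b \<xi> n \<le> scale b \<eta> n} < lam b"
    "\<xi> < lam b \<Longrightarrow> \<eta> \<in> small_club \<xi> \<Longrightarrow> n \<in> b \<Longrightarrow> scale b \<eta> n \<le> scale b \<xi> n"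
    unfolding is_scale_def by simp_all
qed

definition supb :: "'o set \<Rightarrow> 'o \<Rightarrow> 'o" where "supb A \<kappa> = ssup (A \<inter> {..<\<kappa>})"

lemma supb:
  assumes "cof_gt I \<kappa>" "|A| \<le>o |I|"
  shows "supb A \<kappa> < \<kappa>" "x \<in> A \<Longrightarrow> x < \<kappa> \<Longrightarrow> x < supb A \<kappa>"
  using cof_gt_ssup[OF assms(1) _ le_subset[OF Int_lower1 assms(2)]] unfolding supb_def by auto

lemma supb_gt: "x \<in> A \<Longrightarrow> x < \<kappa> \<Longrightarrow> x < supb A \<kappa>"
  unfolding supb_def by (rule ssup_gt[of _ \<kappa>]) auto

lemma supb_le: "supb A \<kappa> \<le> \<kappa>"
  unfolding supb_def by (rule ssup_le) auto

lemma less_supb: "x < supb A \<kappa> \<Longrightarrow> \<exists>y\<in>A. y < \<kappa> \<and> x \<le> y"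
  unfolding supb_def using less_ssup by blast

lemma supb_mono: "A \<subseteq> A' \<Longrightarrow> supb A \<kappa> \<le> supb A' \<kappa>"
  unfolding supb_def[of A] by (rule ssup_le) (use supb_gt in blast)

definition lev :: "'o \<Rightarrow> nat" where "lev \<alpha> = (LEAST m. \<alpha> < om (Suc m))"

text \<open>Taking the target at level \<open>lev \<alpha>\<close> makes one function
  \<open>code \<alpha>\<close> right for every \<open>m\<close> with
  \<open>\<alpha> < om (Suc m)\<close>.\<close>

definition code :: "'o \<Rightarrow> 'o \<Rightarrow> 'o" where
  "code \<alpha> = (SOME j. inj_on j {..<\<alpha>} \<and> j ` {..<\<alpha>} \<subseteq> aleph (lev \<alpha>))"

lemma code:
  assumes "\<alpha> < om (Suc m)"
  shows "inj_on (code \<alpha>) {..<\<alpha>}" "\<beta> < \<alpha> \<Longrightarrow> code \<alpha> \<beta> < om m"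
proof -
  have l: "\<alpha> < om (Suc (lev \<alpha>))" "lev \<alpha> \<le> m"
    unfolding lev_def by (rule LeastI[of "\<lambda>m. \<alpha> < om (Suc m)", OF assms], rule Least_le[of "\<lambda>m. \<alpha> < om (Suc m)", OF assms])
  then have "\<exists>j. inj_on j {..<\<alpha>} \<and> j ` {..<\<alpha>} \<subseteq> aleph (lev \<alpha>)"
    unfolding card_of_ordLeq using om_Suc(2) by blast
  from someI_ex[OF this] have c: "inj_on (code \<alpha>) {..<\<alpha>}" "code \<alpha> ` {..<\<alpha>} \<subseteq> aleph (lev \<alpha>)"
    unfolding code_def by auto
  then show "inj_on (code \<alpha>) {..<\<alpha>}" by simp
  assume "\<beta> < \<alpha>"
  then have "code \<alpha> \<beta> < om (lev \<alpha>)" using c(2) by auto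
  also have "\<dots> \<le> om m" by (rule om_mono[OF l(2)])
  finally show "code \<alpha> \<beta> < om m" .
qed

definition badset :: "nat set \<Rightarrow> 'o \<Rightarrow> 'o \<Rightarrow> nat set" where
  "badset b \<xi> \<epsilon> = {n\<in>b. scale b \<epsilon> n \<le> scale b \<xi> n}"

definition domi :: "nat set \<Rightarrow> 'o set \<Rightarrow> 'o" where
  "domi b A = (SOME \<xi>. \<xi> < lam b \<and> (\<forall>n\<in>b. supb A (om n) \<le> scale b \<xi> n))"

lemma domi:
  assumes b: "b \<subseteq> a0" "b \<noteq> {}" and A: "countable A"
  shows "domi b A < lam b" "\<And>n. n \<in> b \<Longrightarrow> supb A (om n) \<le> scale b (domi b A) n"
proof -
  have "supb A (om n) < om n" if "n \<in> b" for n
  proof (rule supb(1))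
    show "cof_gt (UNIV::nat set) (om n :: 'o)" by (rule cof_om_nat) (use b that in auto)
    show "|A| \<le>o |UNIV::nat set|" using A countable_iff_le by blast
  qed
  then have "(\<lambda>n. supb A (om n)) \<in> prd b" by (auto simp: prd_def)
  from someI_ex[OF scale_cofinal[OF b this]]
  show "domi b A < lam b" "\<And>n. n \<in> b \<Longrightarrow> supb A (om n) \<le> scale b (domi b A) n"
    unfolding domi_def by auto
qed

section \<open>Approachable chains and their characteristic functions\<close>

definition stepA :: "'o set \<Rightarrow> nat set set \<Rightarrow> 'o set" where
  "stepA A B = A \<union> (\<lambda>(b, \<xi>, n). scale b \<xi> n) ` (B \<times> A \<times> UNIV) \<union> (\<lambda>n. supb A (om n)) ` UNIV \<union>
    (\<lambda>b. supb A (lam b)) ` B \<union> (\<lambda>b. domi b A) ` B \<union> (\<lambda>(\<alpha>, \<beta>). code \<alpha> \<beta>) ` (A \<times> A)"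

text \<open>The exceptional sets must themselves belong to the chain, so that the induction in
  \<open>Ch_determined\<close> can continue on them.\<close>

definition stepB :: "'o set \<Rightarrow> nat set set \<Rightarrow> nat set set" where
  "stepB A B = B \<union> (\<lambda>(b, \<xi>, \<epsilon>). badset b \<xi> \<epsilon>) ` (B \<times> A \<times> A)"

text \<open>Continuous chains of countable sets of ordinals and of sets of indices, playing the role of an
  internally approachable chain of elementary submodels.\<close>

definition chain :: "('o \<Rightarrow> 'o set) \<Rightarrow> ('o \<Rightarrow> nat set set) \<Rightarrow> bool" where
  "chain A B \<longleftrightarrow> (\<forall>i< om 1. countable (A i) \<and> countable (B i)) \<and>
    (\<forall>i< om 1. \<forall>j<i. stepA (A j) (B j) \<subseteq> A i \<and> stepB (A j) (B j) \<subseteq> B i) \<and>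
    (\<forall>i< om 1. {..<i} \<noteq> {} \<and> (\<forall>k<i. \<exists>j. k < j \<and> j < i) \<longrightarrow> A i \<subseteq> (\<Union>j<i. A j))"

definition lim :: "('o \<Rightarrow> 'o set) \<Rightarrow> 'o set" where "lim A = (\<Union>i< om 1. A i)"

lemma stepA:
  "A \<subseteq> stepA A B" "b \<in> B \<Longrightarrow> \<xi> \<in> A \<Longrightarrow> scale b \<xi> n \<in> stepA A B" "supb A (om n) \<in> stepA A B"
  "b \<in> B \<Longrightarrow> supb A (lam b) \<in> stepA A B" "b \<in> B \<Longrightarrow> domi b A \<in> stepA A B"
  "\<alpha> \<in> A \<Longrightarrow> \<beta> \<in> A \<Longrightarrow> code \<alpha> \<beta> \<in> stepA A B"
  unfolding stepA_def by force+

lemma stepB: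
  "B \<subseteq> stepB A B" "b \<in> B \<Longrightarrow> \<xi> \<in> A \<Longrightarrow> \<epsilon> \<in> A \<Longrightarrow> badset b \<xi> \<epsilon> \<in> stepB A B"
  unfolding stepB_def by force+

lemma ex_chain:
  assumes X: "countable X"
  obtains A B where "chain A B" "\<And>i. X \<subseteq> A i" "\<And>i. a0 \<in> B i"
proof -
  let ?A = "\<lambda>f i. X \<union> (\<Union>j<i. stepA (fst (f j)) (snd (f j)))"
  let ?B = "\<lambda>f i. {a0} \<union> (\<Union>j<i. stepB (fst (f j)) (snd (f j)))"
  have "\<exists>f :: 'o \<Rightarrow> 'o set \<times> nat set set. \<forall>i. f i = (?A f i, ?B f i)"
  proof (rule dependent_wellorder_choice)
    fix r and f g :: "'o \<Rightarrow> 'o set \<times> nat set set" and x :: 'o assume "\<And>y. y < x \<Longrightarrow> f y = g y"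
    then show "(r = (?A f x, ?B f x)) = (r = (?A g x, ?B g x))" by simp
  qed (rule exI, rule refl)
  then obtain f :: "'o \<Rightarrow> 'o set \<times> nat set set" where f: "\<forall>i. f i = (?A f i, ?B f i)" by (rule exE)
  define A B where "A i = fst (f i)" and "B i = snd (f i)" for i
  have A: "A i = X \<union> (\<Union>j<i. stepA (A j) (B j))" and B: "B i = {a0} \<union> (\<Union>j<i. stepB (A j) (B j))" for i
    using arg_cong[OF f[rule_format, of i], of fst] arg_cong[OF f[rule_format, of i], of snd] unfolding A_def B_def by simp_all
  have cnt: "countable {..<i}" if "i < om 1" for i :: 'o
    using om_Suc(2)[of i 0] that countable_aleph0 le_countable_set by auto
  have c: "countable (A i) \<and> countable (B i)" if "i < om 1" for i
    using that
  proof (induction i rule: less_induct)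
    case (less i)
    have IH: "countable (A j)" "countable (B j)" if "j \<in> {..<i}" for j
      using less.IH[of j] that less.prems by (auto intro: less_trans)
    have "countable (\<Union>j<i. stepA (A j) (B j))" "countable (\<Union>j<i. stepB (A j) (B j))"
      using IH unfolding stepA_def stepB_def by (intro countable_UN cnt less.prems; simp)+
    then show ?case unfolding A[of i] B[of i] using X by simp
  qed
  have "chain A B"
    unfolding chain_def
  proof (intro conjI allI impI)
    fix i :: 'o assume i: "i < om 1"
    show "countable (A i)" "countable (B i)" using c[OF i] by auto
    show "stepA (A j) (B j) \<subseteq> A i" "stepB (A j) (B j) \<subseteq> B i" if "j < i" for j
      using that unfolding A[of i] B[of i] by blast+
    assume l: "{..<i} \<noteq> {} \<and> (\<forall>k<i. \<exists>j. k < j \<and> j < i)"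
    show "A i \<subseteq> (\<Union>j<i. A j)"
    proof
      fix x assume "x \<in> A i"
      then consider "x \<in> X" | k where "k < i" "x \<in> stepA (A k) (B k)" unfolding A[of i] by blast
      then show "x \<in> (\<Union>j<i. A j)"
      proof cases
        case 1
        then show ?thesis using l A by blast
      next
        case 2
        then obtain j where "k < j" "j < i" using l by blast
        then show ?thesis using 2 A[of j] by blast
      qed
    qed
  qed
  moreover have "X \<subseteq> A i" "a0 \<in> B i" for i using A[of i] B[of i] by blast+
  ultimately show ?thesis using that by blast
qed

lemma chainD:
  assumes "chain A B" "i < om 1"
  shows "countable (A i)" "countable (B i)" "j < i \<Longrightarrow> x \<in> stepA (A j) (B j) \<Longrightarrow> x \<in> A i"
    "j < i \<Longrightarrow> b \<in> stepB (A j) (B j) \<Longrightarrow> b \<in> B i"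
    "w < i \<Longrightarrow> (\<And>k. k < i \<Longrightarrow> \<exists>j. k < j \<and> j < i) \<Longrightarrow> x \<in> A i \<Longrightarrow> \<exists>j<i. x \<in> A j"
proof -
  note c = assms(1)[unfolded chain_def]
  note s = c[THEN conjunct1] c[THEN conjunct2, THEN conjunct1] c[THEN conjunct2, THEN conjunct2]
  show "countable (A i)" "countable (B i)" using s(1) assms(2) by auto
  show "j < i \<Longrightarrow> x \<in> stepA (A j) (B j) \<Longrightarrow> x \<in> A i"
    "j < i \<Longrightarrow> b \<in> stepB (A j) (B j) \<Longrightarrow> b \<in> B i" using s(2) assms(2) by auto
  assume a: "w < i" "\<And>k. k < i \<Longrightarrow> \<exists>j. k < j \<and> j < i" "x \<in> A i"
  then have "{..<i} \<noteq> {} \<and> (\<forall>k<i. \<exists>j. k < j \<and> j < i)" by auto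
  then have "A i \<subseteq> (\<Union>j<i. A j)" using s(3) assms(2) by blast
  then show "\<exists>j<i. x \<in> A j" using a(3) by blast
qed

lemma chain_mono:
  assumes "chain A B" "i < om 1" "j \<le> i"
  shows "x \<in> A j \<Longrightarrow> x \<in> A i" "b \<in> B j \<Longrightarrow> b \<in> B i"
proof -
  consider "j = i" | "j < i" using assms(3) by fastforce
  then have "(x \<in> A j \<longrightarrow> x \<in> A i) \<and> (b \<in> B j \<longrightarrow> b \<in> B i)"
  proof cases
    case 2
    show ?thesis
      using chainD(3)[OF assms(1,2) 2 subsetD[OF stepA(1)]] chainD(4)[OF assms(1,2) 2 subsetD[OF stepB(1)]]
      by simp
  qed simp
  then show "x \<in> A j \<Longrightarrow> x \<in> A i" "b \<in> B j \<Longrightarrow> b \<in> B i" by simp_all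
qed

lemma chain_lim_card: assumes "chain A B" shows "|lim A| \<le>o |aleph 3|"
  unfolding lim_def
proof (rule le_UN[OF infinite_aleph])
  show "|aleph 1| \<le>o |aleph 3|" by (rule aleph_mono) simp
  show "|A x| \<le>o |aleph 3|" if "x \<in> aleph 1" for x
    using chainD(1)[OF assms] that le_countable[OF infinite_aleph] by auto
qed

text \<open>Continuity of the chain gives continuity of the suprema. By \<open>s\<close>, each
  supremum from stage \<open>i0\<close> on is an element of all later stages, so no stage attains
  the supremum of the limit.\<close>

lemma chain_normal:
  assumes ch: "chain A B" and c: "cof_gt (aleph 3) \<kappa>" and i0: "i0 < om 1"
    and s: "\<And>i j. i0 \<le> i \<Longrightarrow> i < j \<Longrightarrow> j < om 1 \<Longrightarrow> supb (A i) \<kappa> \<in> A j"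
  shows "normal_to (om 1) (supb (lim A) \<kappa>) (\<lambda>i. supb (A i) \<kappa>)"
proof -
  have lt: "supb (A i) \<kappa> < \<kappa>" if "i < om 1" for i
    by (rule supb(1)[OF c]) (intro le_countable infinite_aleph chainD(1)[OF ch that])
  have mono: "supb (A i) \<kappa> \<le> supb (A j) \<kappa>" if "i \<le> j" "j < om 1" for i j
    using chain_mono(1)[OF ch that(2,1)] by (intro supb_mono) auto
  show ?thesis
    unfolding normal_to_def
  proof (intro conjI allI impI)
    show "\<And>i j. i \<le> j \<and> j < om 1 \<Longrightarrow> supb (A i) \<kappa> \<le> supb (A j) \<kappa>" using mono by blast
  next
    fix i :: 'o assume i: "i < om 1"
    then have m: "max i i0 < om 1" using i0 by simp
    then obtain j where j: "max i i0 < j" "j < om 1" using om_limit by blast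
    have "supb (A i) \<kappa> \<le> supb (A (max i i0)) \<kappa>" by (rule mono) (use m in auto)
    also have "\<dots> < supb (lim A) \<kappa>"
    proof (rule supb_gt)
      show "supb (A (max i i0)) \<kappa> \<in> lim A" using s[of "max i i0" j] j unfolding lim_def by auto
    qed (rule lt[OF m])
    finally show "supb (A i) \<kappa> < supb (lim A) \<kappa>" .
  next
    fix x assume "x < supb (lim A) \<kappa>"
    then obtain y where y: "y \<in> lim A" "y < \<kappa>" "x \<le> y" using less_supb by blast
    then obtain i where i: "i < om 1" "y \<in> A i" unfolding lim_def by blast
    then have "y < supb (A i) \<kappa>" using supb_gt y(2) by blast
    then show "\<exists>i< om 1. x < supb (A i) \<kappa>" using i(1) y(3) le_less_trans by blast
  next
    fix i x assume i: "i < om 1" and l: "{..<i} \<noteq> {} \<and> (\<forall>k<i. \<exists>j. k < j \<and> j < i)" and x: "x < supb (A i) \<kappa>"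
    from l obtain w where w: "w < i" by auto
    from x obtain y where y: "y \<in> A i" "y < \<kappa>" "x \<le> y" using less_supb by blast
    obtain j where j: "j < i" "y \<in> A j" using chainD(5)[OF ch i w _ y(1)] l by blast
    then have "y < supb (A j) \<kappa>" using supb_gt y(2) by blast
    then show "\<exists>j<i. x < supb (A j) \<kappa>" using j(1) y(3) le_less_trans by blast
  qed
qed

text \<open>The least bound that the scale obeys at \<open>n\<close> on some club of \<gamma>. No
  chain occurs in it, so the \<gamma> below \<open>lam b\<close> yield at most \<open>lam b\<close>
  such functions.\<close>

definition Gf :: "nat set \<Rightarrow> 'o \<Rightarrow> nat \<Rightarrow> 'o" where
  "Gf b \<gamma> n = (LEAST z. \<exists>E. club \<gamma> E \<and> (\<forall>\<epsilon>\<in>E. scale b \<epsilon> n \<le> z))"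

abbreviation Ch :: "('o \<Rightarrow> 'o set) \<Rightarrow> nat \<Rightarrow> 'o" where "Ch A n \<equiv> supb (lim A) (om n)"

text \<open>The characteristic function of the limit of a chain is, up to a set in the ideal which itself
  belongs to the chain, determined by the single ordinal \<open>\<gamma>\<close>.\<close>

lemma Ch_eq_Gf:
  assumes ch: "chain A B" and b: "b \<subseteq> a0" "b \<noteq> {}" and i0: "i0 < om 1" "b \<in> B i0"
  obtains \<gamma> \<xi> \<epsilon> j where "\<gamma> < lam b" "\<xi> < lam b" "\<epsilon> < lam b" "j < om 1" "badset b \<xi> \<epsilon> \<in> B j"
    "lam (badset b \<xi> \<epsilon>) < lam b" "\<And>n. n \<in> b \<Longrightarrow> n \<notin> badset b \<xi> \<epsilon> \<Longrightarrow> Ch A n = Gf b \<gamma> n"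
proof -
  let ?\<kappa> = "lam b"
  define \<gamma> where "\<gamma> = supb (lim A) ?\<kappa>"
  let ?s = "\<lambda>i. supb (A i) ?\<kappa>"
  note ck = cof_lam[OF b]
  have gk: "\<gamma> < ?\<kappa>" unfolding \<gamma>_def by (rule supb(1)[OF ck chain_lim_card[OF ch]])
  have sA: "?s i \<in> A j" if "i0 \<le> i" "i < j" "j < om 1" for i j
  proof (rule chainD(3)[OF ch that(3,2)])
    have "b \<in> B i" using chain_mono(2)[OF ch _ that(1) i0(2)] that by auto
    then show "?s i \<in> stepA (A i) (B i)" by (rule stepA(4))
  qed
  have N: "normal_to (om 1) \<gamma> ?s" unfolding \<gamma>_def by (rule chain_normal[OF ch ck i0(1) sA])
  note Nm = normal_toD(1)[OF N] and Nl = normal_toD(2)[OF N]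
  have c1: "cof_gt (UNIV::nat set) (om 1 :: 'o)" by (rule cof_om_nat) simp
  have cg: "cof_gt (UNIV::nat set) \<gamma>" by (rule normal_to_cof[OF N c1])
  \<comment> \<open>For \<epsilon> among the suprema \<open>?s i\<close> beyond
    \<open>?s i0\<close>, the scale value at \<open>n\<close> enters a later stage and so lies below
    the supremum of the limit. This gives the half
    \<open>Gf b \<gamma> n \<le> Ch A n\<close>.\<close>
  have ex: "\<exists>E. club \<gamma> E \<and> (\<forall>\<epsilon>\<in>E. scale b \<epsilon> n \<le> Ch A n)" if n: "n \<in> b" for n
  proof (intro exI conjI ballI)
    let ?E = "?s ` {..< om 1} \<inter> {y. ?s i0 < y \<and> y < \<gamma>}"
    show "club \<gamma> ?E" by (intro club_Int cg club_range[OF N] club_tail Nl i0)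
    fix y assume "y \<in> ?E"
    then obtain i where i: "i < om 1" "y = ?s i" "?s i0 < ?s i" "y < \<gamma>" by auto
    have i0i: "i0 \<le> i" using Nm[of i i0] i i0 by (meson leD linear)
    obtain j where j: "i < j" "j < om 1" using om_limit[OF i(1)] by blast
    obtain k where k: "j < k" "k < om 1" using om_limit[OF j(2)] by blast
    have "y \<in> A j" using sA[OF i0i j] i(2) by simp
    moreover have "b \<in> B j" by (rule chain_mono(2)[OF ch j(2) _ i0(2)]) (use i0i j in auto)
    ultimately have "scale b y n \<in> A k" using chainD(3)[OF ch k(2,1)] stepA(2) by blast
    then have m: "scale b y n \<in> lim A" using k(2) unfolding lim_def by blast
    have "y < ?\<kappa>" using i(4) gk by (rule less_trans)
    then have "scale b y n < om n" using prdD[OF scale_prd[OF b]] n by blast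
    then show "scale b y n \<le> Ch A n" using supb_gt[OF m] by (blast intro: less_imp_le)
  qed
  have Gle: "Gf b \<gamma> n \<le> Ch A n" if "n \<in> b" for n
    unfolding Gf_def by (rule Least_le) (rule ex[OF that])
  have "\<exists>E. club \<gamma> E \<and> (\<forall>\<epsilon>\<in>E. scale b \<epsilon> n \<le> Gf b \<gamma> n)" if "n \<in> b" for n
    unfolding Gf_def by (rule LeastI_ex) (use ex[OF that] in blast)
  then obtain E where E: "\<And>n. n \<in> b \<Longrightarrow> club \<gamma> (E n)" "\<And>n \<epsilon>. n \<in> b \<Longrightarrow> \<epsilon> \<in> E n \<Longrightarrow> scale b \<epsilon> n \<le> Gf b \<gamma> n"
    by metis
  define EE where "EE = {..<\<gamma>} \<inter> (\<Inter>n\<in>b. E n)"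
  have "club \<gamma> EE"
    unfolding EE_def by (rule club_INT[OF cg _ _ E(1)]) (auto intro: card_of_mono1)
  then have I: "club (om 1) {i. i < om 1 \<and> ?s i \<in> EE}" by (rule club_vimage[OF N c1])
  \<comment> \<open>Where \<open>Gf\<close> falls short, an element of the limit witnesses it, and
    the countably many witnesses all appear by one stage \<open>m\<close>. The scale function at
    \<xi> dominates that stage; a later \<epsilon> on all the clubs has its values bounded by
    \<open>Gf\<close> but, off the bad set, above those at \<xi>.\<close>
  have "\<exists>i m. i < om 1 \<and> (n \<in> b \<and> Gf b \<gamma> n < Ch A n \<longrightarrow> m \<in> A i \<and> m < om n \<and> Gf b \<gamma> n \<le> m)" for n
  proof (cases "n \<in> b \<and> Gf b \<gamma> n < Ch A n")
    case True
    then obtain m where "m \<in> lim A" "m < om n" "Gf b \<gamma> n \<le> m" using less_supb by blast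
    then show ?thesis unfolding lim_def by blast
  qed (use i0 in blast)
  then obtain ii mm where im: "\<And>n. ii n < om 1"
    "\<And>n. n \<in> b \<Longrightarrow> Gf b \<gamma> n < Ch A n \<Longrightarrow> mm n \<in> A (ii n) \<and> mm n < om n \<and> Gf b \<gamma> n \<le> mm n" by metis
  have "insert i0 (range ii) \<subseteq> aleph 1" "|insert i0 (range ii)| \<le>o |UNIV::nat set|"
    using im(1) i0(1) by (auto simp: countable_iff_le[symmetric])
  from cof_gtD[OF c1 this] obtain m where mt: "m < om 1" "i0 < m" "\<And>n. ii n < m" by auto
  define \<xi> where "\<xi> = domi b (A m)"
  note xi = domi[OF b chainD(1)[OF ch mt(1)], folded \<xi>_def]
  obtain j0 where j0: "m < j0" "j0 < om 1" using om_limit[OF mt(1)] by blast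
  have xij: "\<xi> \<in> A j0"
  proof (rule chainD(3)[OF ch j0(2,1)])
    have "b \<in> B m" by (rule chain_mono(2)[OF ch mt(1) less_imp_le[OF mt(2)] i0(2)])
    then show "\<xi> \<in> stepA (A m) (B m)" unfolding \<xi>_def by (rule stepA(5))
  qed
  obtain i' where i': "j0 < i'" "i' < om 1" "?s i' \<in> EE" using clubD_unb[OF I j0(2)] by blast
  define \<epsilon> where "\<epsilon> = ?s i'"
  have "\<xi> \<in> A i'" using chain_mono(1)[OF ch i'(2) less_imp_le[OF i'(1)] xij] .
  then have xe: "\<xi> < \<epsilon>" unfolding \<epsilon>_def by (rule supb_gt) (rule xi(1))
  have ek: "\<epsilon> < ?\<kappa>" using Nl[OF i'(2)] gk unfolding \<epsilon>_def by (rule less_trans)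
  obtain j where j: "i' < j" "j < om 1" using om_limit[OF i'(2)] by blast
  obtain k where k: "j < k" "k < om 1" using om_limit[OF j(2)] by blast
  have i0i': "i0 \<le> i'" using mt(2) j0(1) i'(1) by auto
  have "badset b \<xi> \<epsilon> \<in> B k"
  proof (rule chainD(4)[OF ch k(2,1)], rule stepB(2))
    show "b \<in> B j" by (rule chain_mono(2)[OF ch j(2) _ i0(2)]) (use i0i' j in auto)
    show "\<xi> \<in> A j" by (rule chain_mono(1)[OF ch j(2) _ xij]) (use i' j in auto)
    show "\<epsilon> \<in> A j" unfolding \<epsilon>_def by (rule sA[OF i0i' j])
  qed
  moreover have "lam (badset b \<xi> \<epsilon>) < lam b"
    unfolding badset_def by (rule scale_increasing[OF b ek xe])
  moreover have "Ch A n = Gf b \<gamma> n" if n: "n \<in> b" "n \<notin> badset b \<xi> \<epsilon>" for n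
  proof (rule ccontr)
    assume "Ch A n \<noteq> Gf b \<gamma> n"
    then have lt: "Gf b \<gamma> n < Ch A n" using Gle[OF n(1)] by auto
    note mm = im(2)[OF n(1) lt]
    have "mm n \<in> A m" using chain_mono(1)[OF ch mt(1) less_imp_le[OF mt(3)]] mm by blast
    then have "mm n < supb (A m) (om n)" using supb_gt mm by blast
    also have "\<dots> \<le> scale b \<xi> n" by (rule xi(2)[OF n(1)])
    also have "\<dots> < scale b \<epsilon> n" using n unfolding badset_def by auto
    also have "\<dots> \<le> Gf b \<gamma> n" by (rule E(2)[OF n(1)]) (use i'(3) n(1) in \<open>auto simp: EE_def \<epsilon>_def\<close>)
    finally show False using mm by auto
  qed
  ultimately show ?thesis using that gk xi(1) ek k(2) by blast
qed

text \<open>Off the exceptional set the function is \<open>Gf b \<gamma>\<close>. That set has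
  smaller \<open>lam\<close> and occurs in the same chain, so the induction hypothesis applies to
  it. The count comes from the triples of ordinals below \<open>lam b\<close>.\<close>

lemma Ch_determined:
  "b \<subseteq> a0 \<Longrightarrow> \<exists>\<G>. |\<G>| \<le>o |{..<max (lam b) (om 3)}| \<and>
    (\<forall>A B. chain A B \<longrightarrow> (\<exists>i< om 1. b \<in> B i) \<longrightarrow> (\<exists>g\<in>\<G>. \<forall>n\<in>b. Ch A n = g n))"
proof (induction "lam b" arbitrary: b rule: less_induct)
  case less
  let ?I = "{..<max (lam b) (om 3)}"
  have "aleph 3 \<subseteq> ?I" by auto
  then have inf: "infinite ?I" using infinite_aleph finite_subset by blast
  show ?case
  proof (cases "b = {}")
    case True
    have "|{zero}| \<le>o |?I|" by (rule le_finite[OF inf]) simp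
    then show ?thesis using True by blast
  next
    case ne: False
    have "\<forall>c. \<exists>\<G>. c \<subseteq> a0 \<and> lam c < lam b \<longrightarrow> |\<G>| \<le>o |{..<max (lam c) (om 3)}| \<and>
      (\<forall>A B. chain A B \<longrightarrow> (\<exists>i< om 1. c \<in> B i) \<longrightarrow> (\<exists>g\<in>\<G>. \<forall>n\<in>c. Ch A n = g n))"
    proof (intro allI)
      fix c
      show "\<exists>\<G>. c \<subseteq> a0 \<and> lam c < lam b \<longrightarrow> |\<G>| \<le>o |{..<max (lam c) (om 3)}| \<and>
        (\<forall>A B. chain A B \<longrightarrow> (\<exists>i< om 1. c \<in> B i) \<longrightarrow> (\<exists>g\<in>\<G>. \<forall>n\<in>c. Ch A n = g n))"
      proof (cases "c \<subseteq> a0 \<and> lam c < lam b")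
        case True
        from less.hyps[OF conjunct2[OF True] conjunct1[OF True]] show ?thesis
          by (elim exE, intro exI impI)
      next
        case False
        then show ?thesis by (intro exI impI) simp
      qed
    qed
    from choice[OF this] obtain \<G> where G: "\<forall>c. c \<subseteq> a0 \<and> lam c < lam b \<longrightarrow> |\<G> c| \<le>o |{..<max (lam c) (om 3)}| \<and>
      (\<forall>A B. chain A B \<longrightarrow> (\<exists>i< om 1. c \<in> B i) \<longrightarrow> (\<exists>g\<in>\<G> c. \<forall>n\<in>c. Ch A n = g n))"
      by (rule exE)
    have Gsz: "|\<G> c| \<le>o |?I|" if "c \<subseteq> a0" "lam c < lam b" for c
    proof (rule ordLeq_transitive)
      show "|\<G> c| \<le>o |{..<max (lam c) (om 3)}|" using G that by blast
      show "|{..<max (lam c) (om 3)}| \<le>o |?I|" using that(2) by (intro card_of_mono1) (auto simp: less_max_iff_disj le_max_iff_disj)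
    qed
    have GC: "\<exists>g\<in>\<G> c. \<forall>n\<in>c. Ch A n = g n"
      if "c \<subseteq> a0" "lam c < lam b" "chain A B" "i < om 1" "c \<in> B i" for c A B i
      using G that by blast
    let ?T = "{..<lam b} \<times> {..<lam b} \<times> {..<lam b}"
    define \<H> where "\<H> = (\<Union>(\<gamma>, \<xi>, \<epsilon>)\<in>?T. if lam (badset b \<xi> \<epsilon>) < lam b
      then (\<lambda>h n. if n \<in> badset b \<xi> \<epsilon> then h n else Gf b \<gamma> n) ` \<G> (badset b \<xi> \<epsilon>) else {})"
    have sub: "badset b \<xi> \<epsilon> \<subseteq> a0" for \<xi> \<epsilon> using less.prems unfolding badset_def by auto
    have "|{..<lam b}| \<le>o |?I|" by (rule card_of_mono1) auto
    then have T: "|?T| \<le>o |?I|" by (intro le_Times inf)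
    have "|\<H>| \<le>o |?I|"
      unfolding \<H>_def
    proof (rule le_UN[OF inf T])
      fix x assume "x \<in> ?T"
      obtain \<gamma> \<xi> \<epsilon> where x: "x = (\<gamma>, \<xi>, \<epsilon>)" by (cases x) auto
      show "|case x of (\<gamma>, \<xi>, \<epsilon>) \<Rightarrow> if lam (badset b \<xi> \<epsilon>) < lam b
        then (\<lambda>h n. if n \<in> badset b \<xi> \<epsilon> then h n else Gf b \<gamma> n) ` \<G> (badset b \<xi> \<epsilon>) else {}| \<le>o |?I|"
      proof (cases "lam (badset b \<xi> \<epsilon>) < lam b")
        case True
        then show ?thesis unfolding x using le_image[OF Gsz[OF sub True]] by simp
      next
        case False
        then show ?thesis unfolding x by (simp only: prod.case if_False card_of_empty)
      qed
    qed
    moreover have "\<exists>g\<in>\<H>. \<forall>n\<in>b. Ch A n = g n" if ch: "chain A B" and i0: "i0 < om 1" "b \<in> B i0" for A B i0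
    proof -
      obtain \<gamma> \<xi> \<epsilon> j where r: "\<gamma> < lam b" "\<xi> < lam b" "\<epsilon> < lam b" "j < om 1" "badset b \<xi> \<epsilon> \<in> B j"
        "lam (badset b \<xi> \<epsilon>) < lam b" "\<And>n. n \<in> b \<Longrightarrow> n \<notin> badset b \<xi> \<epsilon> \<Longrightarrow> Ch A n = Gf b \<gamma> n"
        using Ch_eq_Gf[OF ch less.prems ne i0] by blast
      obtain h where h: "h \<in> \<G> (badset b \<xi> \<epsilon>)" "\<forall>n\<in>badset b \<xi> \<epsilon>. Ch A n = h n"
        using GC[OF sub r(6) ch r(4,5)] by auto
      let ?g = "\<lambda>n. if n \<in> badset b \<xi> \<epsilon> then h n else Gf b \<gamma> n"
      have "?g \<in> \<H>" unfolding \<H>_def using r(1-3,6) h(1) by (intro UN_I[of "(\<gamma>, \<xi>, \<epsilon>)"]) auto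
      moreover have "\<forall>n\<in>b. Ch A n = ?g n" using r(7) h(2) by simp
      ultimately show ?thesis by (intro bexI[of _ ?g])
    qed
    ultimately show ?thesis by blast
  qed
qed

text \<open>Stage \<open>k\<close> covers the part of a chain's limit below
  \<open>\<omega>\<^sub>k\<^sub>+\<^sub>3\<close>, using only its characteristic function
  \<open>g\<close>. All of \<open>\<omega>\<^sub>3\<close> is taken at the start; one level up,
  elements are decoded through the chosen small club in \<open>g (k + 4)\<close>.\<close>

primrec recover :: "(nat \<Rightarrow> 'o) \<Rightarrow> nat \<Rightarrow> 'o set" where
  "recover g 0 = aleph 3"
| "recover g (Suc k) = recover g k \<union>
    (\<Union>\<alpha> \<in> small_club (g (k + 4)) \<inter> aleph (k + 4). {\<beta>. \<beta> < \<alpha> \<and> code \<alpha> \<beta> \<in> recover g k})"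

lemma recover_card: "|recover g k| \<le>o |aleph 3|"
proof (induction k)
  case (Suc k)
  have "|\<Union>\<alpha> \<in> small_club (g (k + 4)) \<inter> aleph (k + 4). {\<beta>. \<beta> < \<alpha> \<and> code \<alpha> \<beta> \<in> recover g k}| \<le>o |aleph 3|"
  proof (rule le_UN[OF infinite_aleph])
    show "|small_club (g (k + 4)) \<inter> aleph (k + 4)| \<le>o |aleph 3|"
      by (rule le_subset[OF Int_lower1 small_club(1)])
    fix \<alpha> assume "\<alpha> \<in> small_club (g (k + 4)) \<inter> aleph (k + 4)"
    then have "\<alpha> < om (Suc (k + 3))" by (simp add: eval_nat_numeral)
    from code(1)[OF this] have "inj_on (code \<alpha>) {\<beta>. \<beta> < \<alpha> \<and> code \<alpha> \<beta> \<in> recover g k}"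
      by (rule inj_on_subset) auto
    then have "|{\<beta>. \<beta> < \<alpha> \<and> code \<alpha> \<beta> \<in> recover g k}| \<le>o |recover g k|" by (rule card_of_ordLeqI) auto
    then show "|{\<beta>. \<beta> < \<alpha> \<and> code \<alpha> \<beta> \<in> recover g k}| \<le>o |aleph 3|" using Suc.IH by (rule ordLeq_transitive)
  qed
  then show ?case unfolding recover.simps by (intro le_Un infinite_aleph Suc.IH)
qed (simp add: card_of_mono1)

text \<open>The suprema of the stages are normal in the characteristic value, so some late one lies
  in the small club, although that club was chosen without knowing the chain. Such an \<alpha> above
  \<beta> is in the limit together with \<beta>, hence so is \<open>code \<alpha> \<beta>\<close>,
  one level down.\<close>

lemma chain_subset_recover:
  assumes ch: "chain A B" and g: "\<And>n. n \<in> a0 \<Longrightarrow> Ch A n = g n"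
  shows "lim A \<inter> aleph (k + 3) \<subseteq> recover g k"
proof (induction k)
  case (Suc k)
  show ?case
  proof
    fix \<beta> assume "\<beta> \<in> lim A \<inter> aleph (Suc k + 3)"
    then have be: "\<beta> \<in> lim A" "\<beta> < om (k + 4)" by (auto simp: eval_nat_numeral)
    let ?\<kappa> = "om (k + 4) :: 'o"
    let ?s = "\<lambda>i. supb (A i) ?\<kappa>"
    have ck: "cof_gt (aleph 3) ?\<kappa>" by (rule cof_om_le[of 3]) (auto intro: card_of_mono1)
    have sA: "?s i \<in> A j" if "i < j" "j < om 1" for i j
      by (rule chainD(3)[OF ch that(2,1)]) (rule stepA(3))
    obtain z where z: "z < (om 1 :: 'o)" using om_pos by blast
    have N: "normal_to (om 1) (Ch A (k + 4)) ?s" by (rule chain_normal[OF ch ck z sA])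
    have c1: "cof_gt (UNIV::nat set) (om 1 :: 'o)" by (rule cof_om_nat) simp
    have "|?s ` aleph 1| \<le>o |aleph 3|" by (rule le_image) (rule aleph_mono, simp)
    from small_club(3)[OF club_range[OF N] this]
    have C: "club (Ch A (k + 4)) (small_club (Ch A (k + 4)))" .
    obtain i where i: "i < om 1" "\<beta> \<in> A i" using be(1) unfolding lim_def by blast
    obtain i' where i': "i < i'" "i' < om 1" "?s i' \<in> small_club (Ch A (k + 4))"
      using clubD_unb[OF club_vimage[OF N c1 C] i(1)] by blast
    define \<alpha> where "\<alpha> = ?s i'"
    have bi': "\<beta> \<in> A i'" using chain_mono(1)[OF ch i'(2) less_imp_le[OF i'(1)] i(2)] .
    then have ba: "\<beta> < \<alpha>" unfolding \<alpha>_def using be(2) by (rule supb_gt)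
    have ak: "\<alpha> < ?\<kappa>" using less_le_trans[OF normal_toD(2)[OF N i'(2)] supb_le] unfolding \<alpha>_def .
    obtain j where j: "i' < j" "j < om 1" using om_limit[OF i'(2)] by blast
    obtain l where l: "j < l" "l < om 1" using om_limit[OF j(2)] by blast
    have "\<alpha> \<in> A j" unfolding \<alpha>_def by (rule sA[OF j])
    moreover have "\<beta> \<in> A j" using chain_mono(1)[OF ch j(2) less_imp_le[OF j(1)] bi'] .
    ultimately have "code \<alpha> \<beta> \<in> A l" by (intro chainD(3)[OF ch l(2,1)] stepA(6))
    then have "code \<alpha> \<beta> \<in> lim A" using l(2) unfolding lim_def by blast
    moreover have "code \<alpha> \<beta> < om (k + 3)" by (rule code(2)[OF _ ba]) (use ak in \<open>simp add: eval_nat_numeral\<close>)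
    ultimately have "code \<alpha> \<beta> \<in> recover g k" using Suc.IH by blast
    moreover have "\<alpha> \<in> small_club (g (k + 4))" using i'(3) g[of "k + 4"] unfolding \<alpha>_def by simp
    ultimately show "\<beta> \<in> recover g (Suc k)" using ak ba by auto
  qed
qed simp

theorem covering:
  "\<exists>\<N> :: 'o set set. |\<N>| \<le>o |{..<lam a0}| \<and> (\<forall>N\<in>\<N>. |N| \<le>o |aleph 3| \<and> N \<subseteq> Kw) \<and>
    (\<forall>X\<subseteq>Kw. countable X \<longrightarrow> (\<exists>N\<in>\<N>. X \<subseteq> N))"
proof -
  obtain \<G> where G: "|\<G>| \<le>o |{..<max (lam a0) (om 3)}|"
    "\<forall>A B. chain A B \<longrightarrow> (\<exists>i< om 1. a0 \<in> B i) \<longrightarrow> (\<exists>g\<in>\<G>. \<forall>n\<in>a0. Ch A n = g n)"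
    using Ch_determined[of a0] by auto
  have "om 3 < lam a0" by (rule om3_less_lam) auto
  then have mx: "max (lam a0) (om 3) = lam a0" by simp
  define \<N> where "\<N> = (\<lambda>g. (\<Union>k. recover g k) \<inter> Kw) ` \<G>"
  show ?thesis
  proof (intro exI[of _ \<N>] conjI ballI allI impI)
    show "|\<N>| \<le>o |{..<lam a0}|" unfolding \<N>_def by (rule le_image) (use G(1) mx in simp)
    fix N assume "N \<in> \<N>"
    then obtain g where N: "N = (\<Union>k. recover g k) \<inter> Kw" unfolding \<N>_def by blast
    have "|\<Union>k. recover g k| \<le>o |aleph 3|"
      by (rule le_UN[OF infinite_aleph le_countable[OF infinite_aleph] recover_card]) simp
    then show "|N| \<le>o |aleph 3|" unfolding N by (rule le_subset[OF Int_lower1])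
    show "N \<subseteq> Kw" unfolding N by blast
  next
    fix X assume X: "X \<subseteq> Kw" "countable X"
    obtain A B where AB: "chain A B" "\<And>i. X \<subseteq> A i" "\<And>i. a0 \<in> B i" using ex_chain[OF X(2)] by blast
    obtain z where z: "z < (om 1 :: 'o)" using om_pos by blast
    obtain g where g: "g \<in> \<G>" "\<And>n. n \<in> a0 \<Longrightarrow> Ch A n = g n" using G(2) AB z by blast
    have "X \<subseteq> (\<Union>k. recover g k)"
    proof
      fix x assume x: "x \<in> X"
      then obtain n where "x < om n" using X(1) unfolding Kw_def by blast
      then have "x < om (n + 3)" using om_mono[of n "n + 3"] by (auto intro: less_le_trans)
      moreover have "x \<in> lim A" using AB(2) x z unfolding lim_def by blast
      ultimately show "x \<in> (\<Union>k. recover g k)" using chain_subset_recover[OF AB(1) g(2), of n] by blast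
    qed
    then show "\<exists>N\<in>\<N>. X \<subseteq> N" using g(1) X(1) unfolding \<N>_def by blast
  qed
qed

end

text \<open>\<open>\<Phi>\<close> may consult the sequence up to and including \<open>k\<close>.
  Taking suprema over all earlier stages builds continuity at limits into the recursion.\<close>

lemma ex_recursive_ssup:
  fixes \<Phi> :: "('o::wellorder \<Rightarrow> 'o) \<Rightarrow> 'o \<Rightarrow> 'o"
  assumes "\<And>f g k. (\<And>j. j \<le> k \<Longrightarrow> f j = g j) \<Longrightarrow> \<Phi> f k = \<Phi> g k"
  shows "\<exists>\<rho>. \<forall>i. \<rho> i = ssup (\<Phi> \<rho> ` {..<i})"
proof (rule dependent_wellorder_choice)
  fix r :: 'o and f g :: "'o \<Rightarrow> 'o" and x assume "\<And>y. y < x \<Longrightarrow> f y = g y"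
  then have "\<Phi> f ` {..<x} = \<Phi> g ` {..<x}"
    by (intro image_cong refl assms) auto
  then show "(r = ssup (\<Phi> f ` {..<x})) = (r = ssup (\<Phi> g ` {..<x}))" by simp
qed auto

section \<open>Club guessing\<close>

context large_wellorder
begin

text \<open>The supremum of \<open>E\<close> up to and including \<beta>. For a club
  \<open>E\<close> it belongs to \<open>E\<close> as soon as some member is at or below
  \<beta>.\<close>

definition drop :: "'o set \<Rightarrow> 'o \<Rightarrow> 'o" where "drop E \<beta> = (LEAST z. \<forall>x\<in>E. x \<le> \<beta> \<longrightarrow> x \<le> z)"

lemma drop: "drop E \<beta> \<le> \<beta>" "x \<in> E \<Longrightarrow> x \<le> \<beta> \<Longrightarrow> x \<le> drop E \<beta>"
  "y < drop E \<beta> \<Longrightarrow> \<exists>x\<in>E. x \<le> \<beta> \<and> y < x"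
proof -
  show "drop E \<beta> \<le> \<beta>" unfolding drop_def by (rule Least_le) simp
  have "\<forall>x\<in>E. x \<le> \<beta> \<longrightarrow> x \<le> drop E \<beta>" unfolding drop_def by (rule LeastI[of _ \<beta>]) simp
  then show "x \<in> E \<Longrightarrow> x \<le> \<beta> \<Longrightarrow> x \<le> drop E \<beta>" by simp
  show "y < drop E \<beta> \<Longrightarrow> \<exists>x\<in>E. x \<le> \<beta> \<and> y < x"
    using not_less_Least[of y "\<lambda>z. \<forall>x\<in>E. x \<le> \<beta> \<longrightarrow> x \<le> z"] unfolding drop_def by (auto simp: not_le)
qed

lemma drop_antimono: "E' \<subseteq> E \<Longrightarrow> drop E' \<beta> \<le> drop E \<beta>"
  unfolding drop_def[of E'] by (rule Least_le) (use drop(2) in blast)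

lemma drop_mem:
  assumes E: "club \<kappa> E" and b: "\<beta> < \<kappa>" and x: "x \<in> E" "x \<le> \<beta>"
  shows "drop E \<beta> \<in> E"
proof (rule ccontr)
  assume n: "drop E \<beta> \<notin> E"
  have lt: "z < drop E \<beta>" if "z \<in> E" "z \<le> \<beta>" for z
    using drop(2)[OF that] n that(1) by (cases "z = drop E \<beta>") auto
  have "drop E \<beta> \<in> E"
  proof (rule clubD_closed[OF E _ lt[OF x]])
    show "drop E \<beta> < \<kappa>" using drop(1) b by (rule le_less_trans)
    fix y assume "y < drop E \<beta>"
    then obtain z where "z \<in> E" "z \<le> \<beta>" "y < z" using drop(3) by blast
    then show "\<exists>z\<in>E. y < z \<and> z < drop E \<beta>" using lt by blast
  qed
  then show False using n by simp
qed

lemma antimono_stabilizes: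
  fixes F :: "'o \<Rightarrow> 'c::wellorder"
  assumes "\<And>i j. i \<le> j \<Longrightarrow> j < \<kappa> \<Longrightarrow> F j \<le> F i" "w < \<kappa>"
  shows "\<exists>i<\<kappa>. \<forall>j. i \<le> j \<and> j < \<kappa> \<longrightarrow> F j = F i"
proof -
  define v where "v = (LEAST v. \<exists>i<\<kappa>. F i = v)"
  have "\<exists>i<\<kappa>. F i = v" unfolding v_def by (rule LeastI[of _ "F w"]) (use assms(2) in blast)
  then obtain i where i: "i < \<kappa>" "F i = v" by blast
  have "F j = v" if "i \<le> j" "j < \<kappa>" for j
  proof (rule antisym)
    show "F j \<le> v" using assms(1)[OF that] i(2) by simp
    show "v \<le> F j" unfolding v_def by (rule Least_le) (use that in blast)
  qed
  then show ?thesis using i by auto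
qed

definition ladder :: "'o \<Rightarrow> 'o set" where
  "ladder \<alpha> = (if \<exists>c\<subseteq>{..<\<alpha>}. |c| \<le>o |aleph 1| \<and> (\<forall>x<\<alpha>. \<exists>y\<in>c. x < y)
    then SOME c. c \<subseteq> {..<\<alpha>} \<and> |c| \<le>o |aleph 1| \<and> (\<forall>x<\<alpha>. \<exists>y\<in>c. x < y) else {})"

lemma ladder:
  assumes "c \<subseteq> {..<\<alpha>}" "|c| \<le>o |aleph 1|" "\<forall>x<\<alpha>. \<exists>y\<in>c. x < y"
  shows "ladder \<alpha> \<subseteq> {..<\<alpha>}" "|ladder \<alpha>| \<le>o |aleph 1|" "\<forall>x<\<alpha>. \<exists>y\<in>ladder \<alpha>. x < y"
proof -
  have ex: "\<exists>c\<subseteq>{..<\<alpha>}. |c| \<le>o |aleph 1| \<and> (\<forall>x<\<alpha>. \<exists>y\<in>c. x < y)" using assms by blast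
  have "ladder \<alpha> \<subseteq> {..<\<alpha>} \<and> |ladder \<alpha>| \<le>o |aleph 1| \<and> (\<forall>x<\<alpha>. \<exists>y\<in>ladder \<alpha>. x < y)"
    unfolding ladder_def if_P[OF ex] by (rule someI_ex[OF ex])
  then show "ladder \<alpha> \<subseteq> {..<\<alpha>}" "|ladder \<alpha>| \<le>o |aleph 1|" "\<forall>x<\<alpha>. \<exists>y\<in>ladder \<alpha>. x < y" by simp_all
qed

definition dropped :: "'o set \<Rightarrow> 'o \<Rightarrow> 'o set" where
  "dropped E \<alpha> = drop E ` {\<beta>\<in>ladder \<alpha>. \<exists>x\<in>E. x \<le> \<beta>}"

text \<open>The limit of \<open>\<omega>\<^sub>1\<close> increasing steps in \<open>E\<close> has
  uncountable cofinality and still admits a ladder of size \<open>\<aleph>\<^sub>1\<close>.\<close>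

lemma club_limit_omega1:
  fixes E :: "'o set"
  assumes E: "club (om 3) E"
  obtains \<alpha> where "\<alpha> < om 3" "\<forall>x<\<alpha>. \<exists>e\<in>E. x < e \<and> e < \<alpha>" "cof_gt (UNIV::nat set) \<alpha>"
    "\<exists>c\<subseteq>{..<\<alpha>}. |c| \<le>o |aleph 1| \<and> (\<forall>x<\<alpha>. \<exists>y\<in>c. x < y)"
proof -
  have c3: "cof_gt (aleph 1) (om 3 :: 'o)" by (rule cof_om_le[of 1]) (auto intro: card_of_mono1)
  let ?N = "\<lambda>z. SOME e. e \<in> E \<and> z \<le> e"
  have N: "?N z \<in> E" "z \<le> ?N z" if "z < om 3" for z
  proof -
    have "\<exists>e. e \<in> E \<and> z \<le> e" using clubD_unb[OF E that] less_imp_le by blast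
    from someI_ex[OF this] show "?N z \<in> E" "z \<le> ?N z" by simp_all
  qed
  have "\<exists>\<rho>. \<forall>i::'o. \<rho> i = ssup ((\<lambda>k. ?N (\<rho> k)) ` {..<i})"
    by (rule ex_recursive_ssup[of "\<lambda>f k. ?N (f k)"]) simp
  then obtain \<rho> where "\<forall>i::'o. \<rho> i = ssup ((\<lambda>k. ?N (\<rho> k)) ` {..<i})" by (rule exE)
  note r = this[rule_format]
  have small: "|{..<i}| \<le>o |aleph 1|" if "i < om 1" for i :: 'o
    by (rule card_of_mono1) (use that in auto)
  have rb: "\<rho> i < om 3" if "i < om 1" for i
    using that
  proof (induction i rule: less_induct)
    case (less i)
    have "(\<lambda>k. ?N (\<rho> k)) ` {..<i} \<subseteq> aleph 3"
      using less.IH less.prems N(1) clubD_sub[OF E] by (auto intro: less_trans)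
    from cof_gt_ssup(1)[OF c3 this le_image[OF small[OF less.prems]]] show ?case unfolding r[of i] .
  qed
  let ?t = "(\<lambda>k. ?N (\<rho> k)) ` aleph 1"
  have tE: "?t \<subseteq> E" using N(1) rb by auto
  have tb: "?t \<subseteq> aleph 3" using tE clubD_sub[OF E] by blast
  have ts: "|?t| \<le>o |aleph 1|" by (rule le_image) (simp add: card_of_mono1)
  define \<alpha> where "\<alpha> = ssup ?t"
  note al = cof_gt_ssup[OF c3 tb ts, folded \<alpha>_def]
  have inc: "?N (\<rho> i) < ?N (\<rho> j)" if "i < j" "j < om 1" for i j
  proof -
    have "(\<lambda>k. ?N (\<rho> k)) ` {..<j} \<subseteq> aleph 3" using tb that by (auto intro: less_trans)
    from cof_gt_ssup(2)[OF c3 this le_image[OF small[OF that(2)]]] have "?N (\<rho> i) < \<rho> j"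
      unfolding r[of j] using that(1) by blast
    then show ?thesis using N(2)[OF rb[OF that(2)]] by (rule less_le_trans)
  qed
  have unb: "\<exists>i< om 1. x < ?N (\<rho> i)" if x: "x < \<alpha>" for x
  proof -
    obtain i where i: "i < om 1" "x \<le> ?N (\<rho> i)" using less_ssup[OF x[unfolded \<alpha>_def]] by auto
    obtain j where j: "i < j" "j < om 1" using om_limit[OF i(1)] by blast
    show ?thesis using i(2) inc[OF j] j(2) le_less_trans by blast
  qed
  show ?thesis
  proof (rule that[OF al(1)])
    show "\<forall>x<\<alpha>. \<exists>e\<in>E. x < e \<and> e < \<alpha>"
    proof (intro allI impI)
      fix x assume "x < \<alpha>"
      then obtain i where i: "i < om 1" "x < ?N (\<rho> i)" using unb by blast
      then show "\<exists>e\<in>E. x < e \<and> e < \<alpha>" using al(2) N(1)[OF rb] by blast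
    qed
    show "cof_gt (UNIV::nat set) \<alpha>"
      unfolding cof_gt_def
    proof (intro allI impI)
      fix Q assume Q: "Q \<subseteq> {..<\<alpha>}" "|Q| \<le>o |UNIV::nat set|"
      then have "\<forall>q\<in>Q. \<exists>i. i < om 1 \<and> q < ?N (\<rho> i)" using unb by blast
      then obtain i where i: "\<And>q. q \<in> Q \<Longrightarrow> i q < om 1 \<and> q < ?N (\<rho> (i q))" by metis
      have "i ` Q \<subseteq> aleph 1" using i by auto
      from cof_gtD[OF cof_om_nat this le_image[OF Q(2)]]
      obtain x where x: "x < om 1" "\<forall>q\<in>i ` Q. q < x" by auto
      have "q < ?N (\<rho> x)" if "q \<in> Q" for q
        using i[OF that] inc[of "i q" x] x that by (auto intro: less_trans)
      then show "\<exists>x<\<alpha>. \<forall>q\<in>Q. q < x" using al(2) x(1) by blast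
    qed
    show "\<exists>c\<subseteq>{..<\<alpha>}. |c| \<le>o |aleph 1| \<and> (\<forall>x<\<alpha>. \<exists>y\<in>c. x < y)"
    proof (intro exI[of _ ?t] conjI allI impI)
      show "?t \<subseteq> {..<\<alpha>}" using al(2) by blast
      show "|?t| \<le>o |aleph 1|" by (rule ts)
      fix x assume "x < \<alpha>"
      then obtain i where "i < om 1" "x < ?N (\<rho> i)" using unb by blast
      then show "\<exists>y\<in>?t. x < y" by (intro bexI[of _ "?N (\<rho> i)"] imageI) simp_all
    qed
  qed
qed

text \<open>Shelah's argument: if none of \<open>\<omega>\<^sub>2\<close> many successive corrections \<open>E i\<close> of the ladder system guessed
  clubs, then at a suitable \<open>\<alpha>\<close> the corrected ladder would already be stable below \<open>\<omega>\<^sub>2\<close>.\<close>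

theorem club_guessing:
  "\<exists>C :: 'o \<Rightarrow> 'o set. \<forall>D. club (om 3) D \<longrightarrow> (\<exists>\<alpha>< om 3. C \<alpha> \<subseteq> D \<and> uncountable (C \<alpha>))"
proof -
  have "\<exists>E. club (om 3) E \<and> (\<forall>D. club (om 3) D \<longrightarrow> (\<exists>\<alpha>< om 3. dropped E \<alpha> \<subseteq> D \<and> uncountable (dropped E \<alpha>)))"
  proof (rule ccontr)
    assume neg: "\<not> ?thesis"
    have "\<forall>E. \<exists>D. club (om 3) E \<longrightarrow> club (om 3) D \<and> (\<forall>\<alpha>< om 3. dropped E \<alpha> \<subseteq> D \<longrightarrow> countable (dropped E \<alpha>))"
    proof (intro allI)
      fix E :: "'o set"
      show "\<exists>D. club (om 3) E \<longrightarrow> club (om 3) D \<and> (\<forall>\<alpha>< om 3. dropped E \<alpha> \<subseteq> D \<longrightarrow> countable (dropped E \<alpha>))"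
      proof (cases "club (om 3) E")
        case True
        have "\<not> (\<forall>D. club (om 3) D \<longrightarrow> (\<exists>\<alpha>< om 3. dropped E \<alpha> \<subseteq> D \<and> uncountable (dropped E \<alpha>)))"
        proof
          assume a: "\<forall>D. club (om 3) D \<longrightarrow> (\<exists>\<alpha>< om 3. dropped E \<alpha> \<subseteq> D \<and> uncountable (dropped E \<alpha>))"
          show False by (rule notE[OF neg]) (rule exI, rule conjI[OF True a])
        qed
        then obtain D where D: "club (om 3) D"
          "\<not> (\<exists>\<alpha>< om 3. dropped E \<alpha> \<subseteq> D \<and> uncountable (dropped E \<alpha>))"
          by (simp only: not_all not_imp) (elim exE conjE)
        then have "club (om 3) D \<and> (\<forall>\<alpha>< om 3. dropped E \<alpha> \<subseteq> D \<longrightarrow> countable (dropped E \<alpha>))" by simp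
        then show ?thesis by (intro exI impI)
      qed simp
    qed
    from choice[OF this] obtain D where D: "\<And>E. club (om 3) E \<Longrightarrow> club (om 3) (D E)"
      "\<And>E \<alpha>. club (om 3) E \<Longrightarrow> \<alpha> < om 3 \<Longrightarrow> dropped E \<alpha> \<subseteq> D E \<Longrightarrow> countable (dropped E \<alpha>)" by auto
    \<comment> \<open>Every later club lies inside the one that refutes guessing by an earlier one:
      \<open>E j \<subseteq> D (E i)\<close> for \<open>i < j\<close>.\<close>
    have "\<exists>E. \<forall>i::'o. E i = aleph 3 \<inter> (\<Inter>j\<in>{..<i}. E j \<inter> D (E j))"
    proof (rule dependent_wellorder_choice)
      fix r and f g :: "'o \<Rightarrow> 'o set" and x :: 'o assume "\<And>y. y < x \<Longrightarrow> f y = g y"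
      then show "(r = aleph 3 \<inter> (\<Inter>j\<in>{..<x}. f j \<inter> D (f j))) = (r = aleph 3 \<inter> (\<Inter>j\<in>{..<x}. g j \<inter> D (g j)))"
        by simp
    qed (rule exI, rule refl)
    then obtain E where E: "\<forall>i::'o. E i = aleph 3 \<inter> (\<Inter>j\<in>{..<i}. E j \<inter> D (E j))" by (rule exE)
    have c3: "cof_gt (aleph 2) (om 3 :: 'o)" by (rule cof_om_le[of 2]) (auto intro: card_of_mono1)
    have c3n: "cof_gt (UNIV::nat set) (om 3 :: 'o)" by (rule cof_om_nat) simp
    have cE: "club (om 3) (E i)" if "i < om 2" for i
      using that
    proof (induction i rule: less_induct)
      case (less i)
      have "|{..<i}| \<le>o |aleph 2|" by (rule card_of_mono1) (use less.prems in auto)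
      then have "club (om 3) (aleph 3 \<inter> (\<Inter>j\<in>{..<i}. E j \<inter> D (E j)))"
      proof (rule club_INT[OF c3 infinite_aleph])
        fix j assume "j \<in> {..<i}"
        then have "club (om 3) (E j)" using less by (auto intro: less_trans)
        then show "club (om 3) (E j \<inter> D (E j))" using D(1) club_Int[OF c3n] by simp
      qed
      then show ?case unfolding E[rule_format, of i] .
    qed
    have Esub: "E j \<subseteq> E i \<inter> D (E i)" if "i < j" for i j
      unfolding E[rule_format, of j] using that by auto
    have Emono: "E j \<subseteq> E i" if "i \<le> j" for i j using Esub[of i j] that by (cases "i = j") auto
    define Es where "Es = aleph 3 \<inter> (\<Inter>i\<in>aleph 2. E i)"
    have "club (om 3) Es"
      unfolding Es_def by (rule club_INT[OF c3 infinite_aleph]) (use cE in \<open>auto intro: card_of_mono1\<close>)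
    then obtain \<alpha> where al: "\<alpha> < om 3" "\<forall>x<\<alpha>. \<exists>e\<in>Es. x < e \<and> e < \<alpha>" "cof_gt (UNIV::nat set) \<alpha>"
      "\<exists>c\<subseteq>{..<\<alpha>}. |c| \<le>o |aleph 1| \<and> (\<forall>x<\<alpha>. \<exists>y\<in>c. x < y)"
      by (rule club_limit_omega1)
    from al(4) obtain c where "c \<subseteq> {..<\<alpha>}" "|c| \<le>o |aleph 1|" "\<forall>x<\<alpha>. \<exists>y\<in>c. x < y" by auto
    note lad = ladder[OF this]
    obtain w where w: "w < (om 2 :: 'o)" using om_pos by blast
    \<comment> \<open>For fixed \<beta> the ordinals \<open>drop (E j) \<beta>\<close> can only
      decrease, so they become constant. The ladder has \<open>\<aleph>\<^sub>1\<close> points, so a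
      single stage below \<open>\<omega>\<^sub>2\<close> is late enough for all of them.\<close>
    have "\<exists>i< om 2. \<forall>j. i \<le> j \<and> j < om 2 \<longrightarrow> drop (E j) \<beta> = drop (E i) \<beta> \<and>
        ((\<exists>x\<in>E j. x \<le> \<beta>) \<longleftrightarrow> (\<exists>x\<in>E i. x \<le> \<beta>))" for \<beta>
    proof -
      obtain i1 where i1: "i1 < om 2" "\<forall>j. i1 \<le> j \<and> j < om 2 \<longrightarrow> drop (E j) \<beta> = drop (E i1) \<beta>"
        using antimono_stabilizes[of "om 2" "\<lambda>i. drop (E i) \<beta>", OF drop_antimono[OF Emono] w] by auto
      let ?P = "\<lambda>i. if \<exists>x\<in>E i. x \<le> \<beta> then 1 else (0::nat)"
      have "?P j \<le> ?P i" if "i \<le> j" for i j using Emono[OF that] by auto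
      then obtain i2 where i2: "i2 < om 2" "\<forall>j. i2 \<le> j \<and> j < om 2 \<longrightarrow> ?P j = ?P i2"
        using antimono_stabilizes[of "om 2" ?P, OF _ w] by auto
      have P: "(\<exists>x\<in>E j. x \<le> \<beta>) \<longleftrightarrow> (\<exists>x\<in>E i2. x \<le> \<beta>)" if "i2 \<le> j" "j < om 2" for j
        using i2(2) that by (auto split: if_splits)
      show ?thesis
      proof (intro exI[of _ "max i1 i2"] conjI allI impI)
        show "max i1 i2 < om 2" using i1 i2 by simp
        fix j assume j: "max i1 i2 \<le> j \<and> j < om 2"
        then have j': "i1 \<le> j \<and> j < om 2" "i2 \<le> j" "j < om 2" by simp_all
        have m: "i1 \<le> max i1 i2 \<and> max i1 i2 < om 2" "i2 \<le> max i1 i2" "max i1 i2 < om 2" using i1(1) i2(1) by simp_all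
        show "drop (E j) \<beta> = drop (E (max i1 i2)) \<beta>"
          by (rule trans[OF i1(2)[rule_format, OF j'(1)] i1(2)[rule_format, OF m(1), symmetric]])
        show "(\<exists>x\<in>E j. x \<le> \<beta>) \<longleftrightarrow> (\<exists>x\<in>E (max i1 i2). x \<le> \<beta>)"
          by (rule trans[OF P[OF j'(2,3)] P[OF m(2,3), symmetric]])
      qed
    qed
    then obtain st where st: "\<And>\<beta>. st \<beta> < om 2"
      "\<And>\<beta> j. st \<beta> \<le> j \<Longrightarrow> j < om 2 \<Longrightarrow> drop (E j) \<beta> = drop (E (st \<beta>)) \<beta>"
      "\<And>\<beta> j. st \<beta> \<le> j \<Longrightarrow> j < om 2 \<Longrightarrow> (\<exists>x\<in>E j. x \<le> \<beta>) \<longleftrightarrow> (\<exists>x\<in>E (st \<beta>). x \<le> \<beta>)" by metis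
    have c2: "cof_gt (aleph 1) (om 2 :: 'o)" by (rule cof_om_le[of 1]) (auto intro: card_of_mono1)
    have "st ` ladder \<alpha> \<subseteq> aleph 2" using st(1) by auto
    from cof_gtD[OF c2 this le_image[OF lad(2)]]
    obtain i where i: "i < om 2" "\<And>\<beta>. \<beta> \<in> ladder \<alpha> \<Longrightarrow> st \<beta> < i" by auto
    obtain j where j: "i < j" "j < om 2" using om_limit[OF i(1)] by blast
    have "dropped (E i) \<alpha> \<subseteq> E j"
    proof
      fix y assume "y \<in> dropped (E i) \<alpha>"
      then obtain \<beta> x where b: "\<beta> \<in> ladder \<alpha>" "x \<in> E i" "x \<le> \<beta>" "y = drop (E i) \<beta>"
        unfolding dropped_def by auto
      have "st \<beta> \<le> i" "st \<beta> \<le> j" using i(2)[OF b(1)] j(1) by auto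
      then have y: "y = drop (E j) \<beta>" and ex: "\<exists>x\<in>E j. x \<le> \<beta>"
        using st(2)[of \<beta> i] st(2)[of \<beta> j] st(3)[of \<beta> i] st(3)[of \<beta> j] i(1) j(2) b(2-4) by auto
      have "\<beta> < om 3" using lad(1) b(1) al(1) by (auto intro: less_trans)
      then show "y \<in> E j" unfolding y using drop_mem[OF cE[OF j(2)]] ex by blast
    qed
    then have "dropped (E i) \<alpha> \<subseteq> D (E i)" using Esub[OF j(1)] by blast
    from D(2)[OF cE[OF i(1)] al(1) this] have cnt: "countable (dropped (E i) \<alpha>)" .
    \<comment> \<open>The stable set is countable by the choice of \<open>D\<close>, yet cofinal in
      \<alpha>: members of \<open>Es\<close> are cofinal in \<alpha>, and dropping a ladder point
      never passes below such a member.\<close>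
    have sub: "dropped (E i) \<alpha> \<subseteq> {..<\<alpha>}"
      unfolding dropped_def using lad(1) drop(1) by (auto intro: le_less_trans)
    from cof_gtD[OF al(3) this] cnt obtain x where x: "x < \<alpha>" "\<forall>q\<in>dropped (E i) \<alpha>. q < x"
      using countable_iff_le by blast
    obtain e where e: "e \<in> Es" "x < e" "e < \<alpha>" using al(2) x(1) by blast
    obtain \<beta> where b: "\<beta> \<in> ladder \<alpha>" "e < \<beta>" using lad(3) e(3) by blast
    have eE: "e \<in> E i" using e(1) i(1) unfolding Es_def by auto
    then have "drop (E i) \<beta> \<in> dropped (E i) \<alpha>" unfolding dropped_def using b by (auto intro: less_imp_le)
    then have "drop (E i) \<beta> < x" using x(2) by blast
    moreover have "e \<le> drop (E i) \<beta>" using drop(2)[OF eE] b(2) by simp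
    ultimately show False using e(2) by simp
  qed
  then show ?thesis by blast
qed

end

section \<open>Sparseness of the scale\<close>

text \<open>Each member of \<open>X'\<close> has at most \<open>|I|\<close> predecessors in
  \<open>X\<close>, whereas \<open>X'\<close> itself has more than \<open>|I|\<close> members, so no
  small subset of \<open>X'\<close> is cofinal in it.\<close>

lemma thin_directed:
  fixes X :: "'o::wellorder set"
  assumes "\<not> |X| \<le>o |I|" "infinite I"
  obtains X' where "X' \<subseteq> X" "X' \<noteq> {}" "\<forall>Q\<subseteq>X'. |Q| \<le>o |I| \<longrightarrow> (\<exists>x\<in>X'. \<forall>q\<in>Q. q < x)"
proof -
  define X' where "X' = {x \<in> X. |X \<inter> {..<x}| \<le>o |I|}"
  have big: "\<not> |X'| \<le>o |I|"
  proof
    assume s: "|X'| \<le>o |I|"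
    have "X \<noteq> X'" using s assms(1) by metis
    then have ex: "\<exists>x. x \<in> X \<and> x \<notin> X'" unfolding X'_def by blast
    define x where "x = (LEAST x. x \<in> X \<and> x \<notin> X')"
    have x: "x \<in> X \<and> x \<notin> X'" unfolding x_def by (rule LeastI_ex[OF ex])
    have "X \<inter> {..<x} \<subseteq> X'" using not_less_Least unfolding x_def by blast
    then have "|X \<inter> {..<x}| \<le>o |I|" using s by (rule le_subset)
    then show False using x unfolding X'_def by simp
  qed
  show ?thesis
  proof (rule that[of X'])
    show "X' \<subseteq> X" unfolding X'_def by blast
    show "X' \<noteq> {}" using big card_of_empty by metis
    show "\<forall>Q\<subseteq>X'. |Q| \<le>o |I| \<longrightarrow> (\<exists>x\<in>X'. \<forall>q\<in>Q. q < x)"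
    proof (intro allI impI, rule ccontr)
      fix Q assume Q: "Q \<subseteq> X'" "|Q| \<le>o |I|"
      assume n: "\<not> (\<exists>x\<in>X'. \<forall>q\<in>Q. q < x)"
      have "X' \<subseteq> (\<Union>q\<in>Q. insert q (X \<inter> {..<q}))"
      proof
        fix x assume x: "x \<in> X'"
        then obtain q where "q \<in> Q" "\<not> q < x" using n by blast
        then show "x \<in> (\<Union>q\<in>Q. insert q (X \<inter> {..<q}))" using x unfolding X'_def by (intro UN_I[of q]) auto
      qed
      moreover have "|\<Union>q\<in>Q. insert q (X \<inter> {..<q})| \<le>o |I|"
        by (rule le_UN[OF assms(2) Q(2)]) (rule le_insert[OF assms(2)], use Q(1) X'_def in blast)
      ultimately show False using big le_subset by blast
    qed
  qed
qed

text \<open>A continuous increasing sequence \<open>\<rho>\<close> interleaved with a sequence \<open>x\<close> in \<open>X\<close>, where \<open>x k\<close> may be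
  required to meet a demand depending on \<open>\<rho>\<close> up to \<open>k\<close>.\<close>

lemma interleaved_sequence:
  fixes X :: "'o::wellorder set" and P :: "('o \<Rightarrow> 'o) \<Rightarrow> 'o \<Rightarrow> 'o \<Rightarrow> bool"
  assumes dir: "\<And>Q. Q \<subseteq> X \<Longrightarrow> |Q| \<le>o |I| \<Longrightarrow> \<exists>x\<in>X. \<forall>q\<in>Q. q < x" and ne: "X \<noteq> {}"
    and small: "\<And>i. i < \<kappa> \<Longrightarrow> |{..<i}| \<le>o |I|"
    and P: "\<And>\<rho> k z. k < \<kappa> \<Longrightarrow> z \<in> X \<Longrightarrow> \<exists>x\<in>X. z < x \<and> P \<rho> k x"
    and local: "\<And>f g k. (\<And>j. j \<le> k \<Longrightarrow> f j = g j) \<Longrightarrow> P f k = P g k"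
  shows "\<exists>\<rho> x. (\<forall>i. \<rho> i = ssup (x ` {..<i})) \<and> (\<forall>k<\<kappa>. x k \<in> X \<and> \<rho> k < x k \<and> P \<rho> k (x k))"
proof -
  define \<Phi> where "\<Phi> f k = (SOME x. x \<in> X \<and> f k < x \<and> P f k x)" for f k
  have "\<exists>\<rho>. \<forall>i. \<rho> i = ssup (\<Phi> \<rho> ` {..<i})"
  proof (rule ex_recursive_ssup)
    fix f g :: "'o \<Rightarrow> 'o" and k assume a: "\<And>j. j \<le> k \<Longrightarrow> f j = g j"
    have "P f k = P g k" by (rule local[OF a])
    moreover have "f k = g k" by (rule a) simp
    ultimately show "\<Phi> f k = \<Phi> g k" unfolding \<Phi>_def by simp
  qed
  then obtain \<rho> where "\<forall>i. \<rho> i = ssup (\<Phi> \<rho> ` {..<i})" by (rule exE)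
  note r = this[rule_format]
  have main: "\<Phi> \<rho> k \<in> X \<and> \<rho> k < \<Phi> \<rho> k \<and> P \<rho> k (\<Phi> \<rho> k)" if "k < \<kappa>" for k
    using that
  proof (induction k rule: less_induct)
    case (less k)
    have "\<Phi> \<rho> ` {..<k} \<subseteq> X" using less by (auto intro: less_trans)
    from dir[OF this le_image[OF small[OF less.prems]]]
    obtain z where z: "z \<in> X" "\<forall>q\<in>\<Phi> \<rho> ` {..<k}. q < z" by blast
    have "\<rho> k \<le> z" unfolding r[of k] by (rule ssup_le[OF z(2)])
    moreover obtain y where "y \<in> X" "z < y" "P \<rho> k y" using P[OF less.prems z(1)] by blast
    ultimately have "\<exists>x. x \<in> X \<and> \<rho> k < x \<and> P \<rho> k x" by (intro exI[of _ y]) auto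
    from someI_ex[OF this] show ?case unfolding \<Phi>_def .
  qed
  show ?thesis by (rule exI[of _ \<rho>], rule exI[of _ "\<Phi> \<rho>"]) (use r main in simp)
qed

lemma interleaved_normal:
  fixes \<rho> x :: "'o::wellorder \<Rightarrow> 'o"
  assumes "\<forall>i. \<rho> i = ssup (x ` {..<i})" and "\<forall>k<\<kappa>. \<rho> k < x k"
    and b: "\<forall>q\<in>x ` {..<\<kappa>}. q < z" and "\<forall>k<\<kappa>. \<exists>j. k < j \<and> j < \<kappa>"
  shows "i < j \<Longrightarrow> j \<le> \<kappa> \<Longrightarrow> x i < \<rho> j"
    and "normal_to \<kappa> (\<rho> \<kappa>) \<rho>" and "\<rho> \<kappa> \<le> z"
proof -
  note r = assms(1)[rule_format] and x = assms(2)[rule_format] and lim = assms(4)[rule_format]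
  have xr: "x i < \<rho> j" if "i < j" "j \<le> \<kappa>" for i j
    unfolding r[of j] by (rule ssup_gt[of _ z]) (use b that in auto)
  then show "i < j \<Longrightarrow> j \<le> \<kappa> \<Longrightarrow> x i < \<rho> j" .
  have inc: "\<rho> i < \<rho> j" if "i < j" "j \<le> \<kappa>" for i j
    by (rule less_trans[OF x[OF less_le_trans[OF that]] xr[OF that]])
  have below: "\<exists>j<i. y < \<rho> j" if il: "i \<le> \<kappa>" "\<And>k. k < i \<Longrightarrow> \<exists>j. k < j \<and> j < i" "y < \<rho> i" for i y
  proof -
    obtain k where k: "k < i" "y \<le> x k" using less_ssup[OF il(3)[unfolded r[of i]]] by auto
    obtain j where j: "k < j" "j < i" using il(2)[OF k(1)] by blast
    have "x k < \<rho> j" by (rule xr[OF j(1)]) (use j(2) il(1) in auto)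
    then show ?thesis using k(2) j(2) le_less_trans by blast
  qed
  show "normal_to \<kappa> (\<rho> \<kappa>) \<rho>"
    unfolding normal_to_def
  proof (intro conjI allI impI)
    show "\<And>i j. i \<le> j \<and> j < \<kappa> \<Longrightarrow> \<rho> i \<le> \<rho> j" using inc by (metis le_less)
    show "\<And>i. i < \<kappa> \<Longrightarrow> \<rho> i < \<rho> \<kappa>" using inc by blast
    show "\<And>x. x < \<rho> \<kappa> \<Longrightarrow> \<exists>i<\<kappa>. x < \<rho> i" using below[of \<kappa>] lim by blast
    show "\<exists>j<i. y < \<rho> j" if "i < \<kappa>" "{..<i} \<noteq> {} \<and> (\<forall>k<i. \<exists>j. k < j \<and> j < i)" "y < \<rho> i" for i y
      using below[of i y] that by auto
  qed
  show "\<rho> \<kappa> \<le> z" unfolding r[of \<kappa>] by (rule ssup_le[OF b])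
qed

context large_wellorder
begin

abbreviation L :: 'o where "L \<equiv> lam a0"
abbreviation sc :: "'o \<Rightarrow> nat \<Rightarrow> 'o" where "sc \<equiv> scale a0"

definition nul :: "nat set \<Rightarrow> bool" where "nul c \<longleftrightarrow> lam c < L"

lemma om3_less_L: "om 3 < L"
  by (rule om3_less_lam) auto

lemma nul_mono: "c \<subseteq> d \<Longrightarrow> nul d \<Longrightarrow> nul c"
  unfolding nul_def using lam_mono le_less_trans by blast

lemma nul_Un: "nul c \<Longrightarrow> nul d \<Longrightarrow> nul (c \<union> d)"
proof -
  assume cd: "nul c" "nul d"
  let ?\<theta> = "max (lam c) (max (lam d) (om 3))"
  have "aleph 3 \<subseteq> {..<?\<theta>}" by (simp add: le_max_iff_disj)
  then have "infinite {..<?\<theta>}" using infinite_aleph finite_subset by blast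
  then have "lam (c \<union> d) \<le> ?\<theta>" by (intro lam_Un) (auto simp: le_max_iff_disj)
  also have "?\<theta> < L" using cd om3_less_L unfolding nul_def by simp
  finally show ?thesis unfolding nul_def .
qed

lemma not_nul: "nul c \<Longrightarrow> \<exists>n\<in>a0. n \<notin> c"
proof (rule ccontr)
  assume "nul c" "\<not> (\<exists>n\<in>a0. n \<notin> c)"
  then have "a0 \<subseteq> c" by blast
  from nul_mono[OF this \<open>nul c\<close>] show False unfolding nul_def by simp
qed

lemma sc_inc: "\<xi> < L \<Longrightarrow> \<eta> < \<xi> \<Longrightarrow> nul {n\<in>a0. sc \<xi> n \<le> sc \<eta> n}"
  unfolding nul_def by (rule scale_increasing) auto

lemma sc_club: "\<xi> < L \<Longrightarrow> \<eta> \<in> small_club \<xi> \<Longrightarrow> n \<in> a0 \<Longrightarrow> sc \<eta> n \<le> sc \<xi> n"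
  by (rule scale_club) auto

text \<open>At the limit \<delta> of an \<open>\<omega>\<^sub>3\<close>-sequence \<rho>, continuity
  makes any later function dominate, off one null set, the functions along a whole club. The
  \<open>x k\<close> should do the same for the indices up to \<open>k\<close>, but they are chosen
  before that club is known, and the ideal need not be closed under long unions. Club guessing
  leaves only \<open>\<aleph>\<^sub>3\<close> candidates \<open>C \<alpha>\<close>, and directedness
  of \<open>X\<close> lets \<open>x k\<close> treat all of them at once.\<close>

lemma sparse_scale_aleph3:
  assumes Z: "countable Z"
  shows "|{\<xi>. \<xi> < L \<and> (\<forall>n\<in>a0. sc \<xi> n \<in> Z)}| \<le>o |aleph 3|"
proof (rule ccontr)
  assume neg: "\<not> ?thesis"
  obtain X where X: "X \<subseteq> {\<xi>. \<xi> < L \<and> (\<forall>n\<in>a0. sc \<xi> n \<in> Z)}" "X \<noteq> {}"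
    and "\<forall>Q\<subseteq>X. |Q| \<le>o |aleph 3| \<longrightarrow> (\<exists>x\<in>X. \<forall>q\<in>Q. q < x)"
    by (rule thin_directed[OF neg infinite_aleph])
  then have dir: "\<And>Q. Q \<subseteq> X \<Longrightarrow> |Q| \<le>o |aleph 3| \<Longrightarrow> \<exists>x\<in>X. \<forall>q\<in>Q. q < x" by simp
  have XL: "x < L" if "x \<in> X" for x using X(1) that by auto
  obtain C :: "'o \<Rightarrow> 'o set"
    where "\<forall>D. club (om 3) D \<longrightarrow> (\<exists>\<alpha>< om 3. C \<alpha> \<subseteq> D \<and> uncountable (C \<alpha>))"
    using club_guessing by (rule exE)
  then have C: "\<And>D. club (om 3) D \<Longrightarrow> \<exists>\<alpha>< om 3. C \<alpha> \<subseteq> D \<and> uncountable (C \<alpha>)" by simp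
  define exc where "exc \<rho> \<alpha> k y = {n\<in>a0. \<exists>j\<in>C \<alpha>. j \<le> k \<and> sc y n < sc (\<rho> j) n}" for \<rho> \<alpha> k y
  define P where "P \<rho> k x \<longleftrightarrow> (\<forall>\<alpha>< om 3. (\<exists>y\<in>X. nul (exc \<rho> \<alpha> k y)) \<longrightarrow> nul (exc \<rho> \<alpha> k x))" for \<rho> k x
  have exP: "\<exists>x\<in>X. z < x \<and> P \<rho> k x" if z: "z \<in> X" for \<rho> k z
  proof -
    have "\<forall>\<alpha>. \<exists>y. y \<in> X \<and> ((\<exists>y\<in>X. nul (exc \<rho> \<alpha> k y)) \<longrightarrow> nul (exc \<rho> \<alpha> k y))" using z by blast
    from choice[OF this] obtain y
      where "\<forall>\<alpha>. y \<alpha> \<in> X \<and> ((\<exists>y\<in>X. nul (exc \<rho> \<alpha> k y)) \<longrightarrow> nul (exc \<rho> \<alpha> k (y \<alpha>)))" by (rule exE)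
    then have y: "\<And>\<alpha>. y \<alpha> \<in> X"
      "\<And>\<alpha>. (\<exists>y\<in>X. nul (exc \<rho> \<alpha> k y)) \<Longrightarrow> nul (exc \<rho> \<alpha> k (y \<alpha>))" by simp_all
    have "insert z (y ` aleph 3) \<subseteq> X" using z y(1) by auto
    from dir[OF this le_insert[OF infinite_aleph card_of_image]] obtain x where x: "x \<in> X" "z < x" "\<And>\<alpha>. \<alpha> < om 3 \<Longrightarrow> y \<alpha> < x" by auto
    have "P \<rho> k x"
      unfolding P_def
    proof (intro allI impI)
      fix \<alpha> assume a: "\<alpha> < om 3" "\<exists>y\<in>X. nul (exc \<rho> \<alpha> k y)"
      have "exc \<rho> \<alpha> k x \<subseteq> exc \<rho> \<alpha> k (y \<alpha>) \<union> {n\<in>a0. sc x n \<le> sc (y \<alpha>) n}"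
        unfolding exc_def by (auto simp: not_le intro: less_trans)
      then show "nul (exc \<rho> \<alpha> k x)"
        by (rule nul_mono) (intro nul_Un y(2)[OF a(2)] sc_inc XL x a)
    qed
    then show ?thesis using x by blast
  qed
  have "\<exists>\<rho> x. (\<forall>i. \<rho> i = ssup (x ` {..<i})) \<and> (\<forall>k< om 3. x k \<in> X \<and> \<rho> k < x k \<and> P \<rho> k (x k))"
  proof (rule interleaved_sequence[OF dir X(2)])
    show "|{..<i}| \<le>o |aleph 3|" if "i < om 3" for i :: 'o
      by (rule card_of_mono1) (use that in auto)
    show "\<exists>x\<in>X. z < x \<and> P \<rho> k x" if "z \<in> X" for \<rho> k z by (rule exP[OF that])
    fix f g :: "'o \<Rightarrow> 'o" and k assume "\<And>j. j \<le> k \<Longrightarrow> f j = g j"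
    then have "exc f \<alpha> k y = exc g \<alpha> k y" for \<alpha> y unfolding exc_def by auto
    then show "P f k = P g k" unfolding P_def by simp
  qed
  then obtain \<rho> x where rx: "\<forall>i. \<rho> i = ssup (x ` {..<i})"
    "\<forall>k< om 3. x k \<in> X \<and> \<rho> k < x k \<and> P \<rho> k (x k)" by (elim exE conjE)
  have x: "x k \<in> X" "\<rho> k < x k" "P \<rho> k (x k)" if "k < om 3" for k using rx(2) that by simp_all
  have "x ` aleph 3 \<subseteq> X" using x(1) by auto
  from dir[OF this card_of_image] obtain z where z: "z \<in> X" "\<forall>q\<in>x ` aleph 3. q < z" by blast
  have "\<forall>k< om 3. \<rho> k < x k" "\<forall>k< om 3. \<exists>j. k < j \<and> j < (om 3 :: 'o)" using x(2) om_limit by simp_all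
  note N = interleaved_normal[OF rx(1) this(1) z(2) this(2)]
  define \<delta> where "\<delta> = \<rho> (om 3)"
  have dL: "\<delta> < L" unfolding \<delta>_def by (rule le_less_trans[OF N(3) XL[OF z(1)]])
  obtain y where y: "y \<in> X" "z < y" using dir[of "{z}"] z(1) le_finite[OF infinite_aleph, of "{z}" 3] by auto
  have dy: "\<delta> < y" unfolding \<delta>_def by (rule le_less_trans[OF N(3) y(2)])
  have sz: "|\<rho> ` aleph 3| \<le>o |aleph 3|" by (rule card_of_image)
  have cl: "club \<delta> (small_club \<delta>)"
    unfolding \<delta>_def by (rule small_club(3)[OF club_range[OF N(2)] sz])
  have c3: "cof_gt (UNIV::nat set) (om 3 :: 'o)" by (rule cof_om_nat) simp
  have "club (om 3) {i. i < om 3 \<and> \<rho> i \<in> small_club \<delta>}"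
    unfolding \<delta>_def by (rule club_vimage[OF N(2) c3 cl[unfolded \<delta>_def]])
  from C[OF this] obtain \<alpha> where al: "\<alpha> < om 3" "C \<alpha> \<subseteq> {i. i < om 3 \<and> \<rho> i \<in> small_club \<delta>}"
    "uncountable (C \<alpha>)" by blast
  have C3: "k < om 3" if "k \<in> C \<alpha>" for k using al(2) that by blast
  \<comment> \<open>A member \<open>y\<close> of \<open>X\<close> beyond \<delta> shows that success
    was possible for the guessed \<open>C \<alpha>\<close> at every \<open>k\<close>; by
    \<open>P\<close> the chosen \<open>x k\<close> succeeds too.\<close>
  have nulx: "nul (exc \<rho> \<alpha> k (x k))" if "k < om 3" for k
  proof -
    have "exc \<rho> \<alpha> k y \<subseteq> {n\<in>a0. sc y n \<le> sc \<delta> n}"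
    proof
      fix n assume "n \<in> exc \<rho> \<alpha> k y"
      then obtain j where j: "n \<in> a0" "j \<in> C \<alpha>" "sc y n < sc (\<rho> j) n" unfolding exc_def by blast
      have "sc (\<rho> j) n \<le> sc \<delta> n" by (rule sc_club[OF dL _ j(1)]) (use al(2) j(2) in blast)
      then show "n \<in> {n\<in>a0. sc y n \<le> sc \<delta> n}" using j by auto
    qed
    then have "nul (exc \<rho> \<alpha> k y)" by (rule nul_mono) (rule sc_inc[OF XL[OF y(1)] dy])
    then show ?thesis using x(3)[OF that] al(1) y(1) unfolding P_def by blast
  qed
  \<comment> \<open>Only a possible last element is discarded, so that \<open>nxt\<close> is
    meaningful.\<close>
  define Ca where "Ca = {k \<in> C \<alpha>. \<exists>l\<in>C \<alpha>. k < l}"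
  have "C \<alpha> - Ca \<subseteq> {LEAST k. k \<in> C \<alpha> - Ca}"
  proof
    fix k assume k: "k \<in> C \<alpha> - Ca"
    then have le: "(LEAST k. k \<in> C \<alpha> - Ca) \<le> k" by (rule Least_le)
    have "(LEAST k. k \<in> C \<alpha> - Ca) \<in> C \<alpha> - Ca" using k by (rule LeastI)
    then have "\<not> (LEAST k. k \<in> C \<alpha> - Ca) < k" using k unfolding Ca_def by blast
    then show "k \<in> {LEAST k. k \<in> C \<alpha> - Ca}" using le by simp
  qed
  then have "countable (C \<alpha> - Ca)" by (rule countable_subset) simp
  then have uCa: "uncountable Ca" using al(3) uncountable_minus_countable countable_Un
    by (metis Diff_partition Ca_def mem_Collect_eq subsetI)
  define nxt where "nxt k = (LEAST l. l \<in> C \<alpha> \<and> k < l)" for k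
  have nxt: "nxt k \<in> C \<alpha>" "k < nxt k" if "k \<in> Ca" for k
  proof -
    have "\<exists>l. l \<in> C \<alpha> \<and> k < l" using that unfolding Ca_def by blast
    from LeastI_ex[OF this] show "nxt k \<in> C \<alpha>" "k < nxt k" unfolding nxt_def by simp_all
  qed
  have nxt_le: "nxt k \<le> l" if "k < l" "l \<in> C \<alpha>" for k l
    unfolding nxt_def by (rule Least_le) (use that in simp)
  \<comment> \<open>At such an \<open>n\<close> the value of \<open>x k\<close> is below that of
    \<open>\<rho> (nxt k)\<close>, which is at most that of \<open>x l\<close> for any later
    \<open>l\<close> with the same \<open>n\<close>. Uncountably many \<open>k\<close> share one
    \<open>n\<close>, so \<open>Z\<close> would receive uncountably many values.\<close>
  have "\<exists>n\<in>a0. n \<notin> exc \<rho> \<alpha> k (x k) \<union> {n\<in>a0. sc (\<rho> (nxt k)) n \<le> sc (x k) n}" if k: "k \<in> Ca" for k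
  proof (rule not_nul, rule nul_Un)
    have k3: "k < om 3" using C3 k unfolding Ca_def by blast
    have n3: "nxt k < om 3" by (rule C3[OF nxt(1)[OF k]])
    show "nul (exc \<rho> \<alpha> k (x k))" by (rule nulx[OF k3])
    have "\<rho> (nxt k) < L" using less_trans[OF x(2)[OF n3] XL[OF x(1)[OF n3]]] .
    then show "nul {n\<in>a0. sc (\<rho> (nxt k)) n \<le> sc (x k) n}"
      by (rule sc_inc) (rule N(1)[OF nxt(2)[OF k] less_imp_le[OF n3]])
  qed
  then have "\<forall>k\<in>Ca. \<exists>n. n \<in> a0 \<and> n \<notin> exc \<rho> \<alpha> k (x k) \<union> {n\<in>a0. sc (\<rho> (nxt k)) n \<le> sc (x k) n}"
    by blast
  from bchoice[OF this] obtain nn where "\<forall>k\<in>Ca. nn k \<in> a0 \<and>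
    nn k \<notin> exc \<rho> \<alpha> k (x k) \<union> {n\<in>a0. sc (\<rho> (nxt k)) n \<le> sc (x k) n}" by (rule exE)
  then have nn: "\<And>k. k \<in> Ca \<Longrightarrow> nn k \<in> a0" "\<And>k. k \<in> Ca \<Longrightarrow> nn k \<notin> exc \<rho> \<alpha> k (x k)"
    "\<And>k. k \<in> Ca \<Longrightarrow> nn k \<notin> {n\<in>a0. sc (\<rho> (nxt k)) n \<le> sc (x k) n}" by simp_all
  have "Ca = (\<Union>n. {k\<in>Ca. nn k = n})" by blast
  then obtain n where n: "uncountable {k\<in>Ca. nn k = n}"
    using uCa countable_UN[of "UNIV::nat set" "\<lambda>n. {k\<in>Ca. nn k = n}"] by auto
  have inj: "inj_on (\<lambda>k. sc (x k) n) {k\<in>Ca. nn k = n}"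
  proof (rule linorder_inj_onI)
    fix k l assume kl: "k < l" "k \<in> {k\<in>Ca. nn k = n}" "l \<in> {k\<in>Ca. nn k = n}"
    have l: "l \<in> C \<alpha>" using kl unfolding Ca_def by blast
    have n0: "n \<in> a0" using nn(1)[of k] kl by auto
    have "sc (x k) n < sc (\<rho> (nxt k)) n" using nn(3)[of k] kl n0 by (auto simp: not_le)
    also have "\<dots> \<le> sc (x l) n"
    proof (rule ccontr)
      assume "\<not> ?thesis"
      then have "n \<in> exc \<rho> \<alpha> l (x l)" unfolding exc_def
        using n0 nxt(1)[of k] nxt_le[OF kl(1) l] kl by auto
      then show False using nn(2)[of l] kl by auto
    qed
    finally show "sc (x k) n \<noteq> sc (x l) n" by simp
  qed auto
  have sub: "(\<lambda>k. sc (x k) n) ` {k\<in>Ca. nn k = n} \<subseteq> Z"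
  proof
    fix v assume "v \<in> (\<lambda>k. sc (x k) n) ` {k\<in>Ca. nn k = n}"
    then obtain k where k: "k \<in> Ca" "nn k = n" "v = sc (x k) n" by blast
    then have "k < om 3" using C3 unfolding Ca_def by blast
    then have "x k \<in> X" by (rule x(1))
    moreover have "n \<in> a0" using nn(1)[OF k(1)] k(2) by simp
    ultimately show "v \<in> Z" using X(1) k(3) by blast
  qed
  from countable_image_inj_on[OF countable_subset[OF sub Z] inj] n show False by simp
qed

text \<open>Covering sets are tagged by members of the scale.\<close>

theorem sparse_cofinal_Kw:
  assumes k: "infinite \<kappa>" and sparse: "\<And>Z. countable Z \<Longrightarrow> |{\<xi>. \<xi> < L \<and> (\<forall>n\<in>a0. sc \<xi> n \<in> Z)}| \<le>o |\<kappa>|"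
  shows "sparse_cofinal \<kappa> Kw"
proof -
  obtain \<N> :: "'o set set" where "|\<N>| \<le>o |{..<L}| \<and> (\<forall>N\<in>\<N>. |N| \<le>o |aleph 3| \<and> N \<subseteq> Kw) \<and>
    (\<forall>X\<subseteq>Kw. countable X \<longrightarrow> (\<exists>N\<in>\<N>. X \<subseteq> N))"
    using covering by (rule exE)
  then have N: "|\<N>| \<le>o |{..<L}|" "\<And>N. N \<in> \<N> \<Longrightarrow> |N| \<le>o |aleph 3|"
    "\<And>N. N \<in> \<N> \<Longrightarrow> N \<subseteq> Kw" "\<And>X. X \<subseteq> Kw \<Longrightarrow> countable X \<Longrightarrow> \<exists>N\<in>\<N>. X \<subseteq> N" by simp_all
  obtain \<tau> where t: "inj_on \<tau> \<N>" "\<tau> ` \<N> \<subseteq> {..<L}" using N(1) unfolding card_of_ordLeq[symmetric] by blast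
  have "\<forall>N. \<exists>\<F>. N \<in> \<N> \<longrightarrow> sparse_cofinal_family \<kappa> N \<F>"
    using sparse_cofinal_le_aleph[OF N(2) k] unfolding sparse_cofinal_def by blast
  from choice[OF this] obtain \<F> where "\<forall>N. N \<in> \<N> \<longrightarrow> sparse_cofinal_family \<kappa> N (\<F> N)" by (rule exE)
  then have "\<And>N. N \<in> \<N> \<Longrightarrow> sparse_cofinal_family \<kappa> N (\<F> N)" by simp
  note F = sparse_cofinal_familyD[OF this]
  define tag where "tag N = (\<lambda>n. sc (\<tau> N) n) ` a0" for N
  have tag: "countable (tag N)" for N unfolding tag_def by simp
  have tagK: "tag N \<subseteq> Kw" if N: "N \<in> \<N>" for N
  proof -
    have "\<tau> N < L" using t(2) N by auto
    then have "sc (\<tau> N) \<in> prd a0" by (intro scale_prd) auto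
    then show ?thesis unfolding tag_def Kw_def using prdD by blast
  qed
  let ?G = "{tag N \<union> A | N A. N \<in> \<N> \<and> A \<in> \<F> N}"
  have "sparse_cofinal_family \<kappa> Kw ?G"
    unfolding sparse_cofinal_family_def
  proof (intro conjI ballI allI impI)
    fix A assume "A \<in> ?G"
    then obtain N B where A: "A = tag N \<union> B" "N \<in> \<N>" "B \<in> \<F> N" by blast
    show "A \<subseteq> Kw" using tagK[OF A(2)] F(1)[OF A(2,3)] N(3)[OF A(2)] A(1) by blast
    show "countable A" using tag F(2)[OF A(2,3)] A(1) by simp
  next
    fix C assume C: "C \<subseteq> Kw" "countable C"
    then obtain N where N': "N \<in> \<N>" "C \<subseteq> N" using N(4) by blast
    then obtain A where "A \<in> \<F> N" "C \<subseteq> A" using F(3)[OF N' C(2)] by blast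
    then show "\<exists>A\<in>?G. C \<subseteq> A" using N'(1) by blast
  next
    fix Z assume Z: "Z \<subseteq> Kw" "countable Z"
    \<comment> \<open>A member of the family inside \<open>Z\<close> brings its tag into
      \<open>Z\<close>, so few covering sets are involved; for each of them its own sparse family is
      counted.\<close>
    define \<N>Z where "\<N>Z = {N \<in> \<N>. tag N \<subseteq> Z}"
    have "|\<N>Z| \<le>o |{\<xi>. \<xi> < L \<and> (\<forall>n\<in>a0. sc \<xi> n \<in> Z)}|"
    proof (rule card_of_ordLeqI[of \<tau>])
      show "inj_on \<tau> \<N>Z" by (rule inj_on_subset[OF t(1)]) (auto simp: \<N>Z_def)
      show "\<tau> N \<in> {\<xi>. \<xi> < L \<and> (\<forall>n\<in>a0. sc \<xi> n \<in> Z)}" if "N \<in> \<N>Z" for N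
        using that t(2) unfolding \<N>Z_def tag_def by blast
    qed
    then have NZ: "|\<N>Z| \<le>o |\<kappa>|" using sparse[OF Z(2)] ordLeq_transitive by blast
    have "{A \<in> ?G. A \<subseteq> Z} \<subseteq> (\<Union>N\<in>\<N>Z. (\<lambda>A. tag N \<union> A) ` {A\<in>\<F> N. A \<subseteq> Z \<inter> N})"
    proof
      fix A assume "A \<in> {A \<in> ?G. A \<subseteq> Z}"
      then obtain N B where A: "A = tag N \<union> B" "N \<in> \<N>" "B \<in> \<F> N" "A \<subseteq> Z" by blast
      then have "N \<in> \<N>Z" unfolding \<N>Z_def by blast
      moreover have "B \<subseteq> Z \<inter> N" using A(1,4) F(1)[OF A(2,3)] by blast
      ultimately show "A \<in> (\<Union>N\<in>\<N>Z. (\<lambda>A. tag N \<union> A) ` {A\<in>\<F> N. A \<subseteq> Z \<inter> N})" using A(1,3) by blast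
    qed
    moreover have "|\<Union>N\<in>\<N>Z. (\<lambda>A. tag N \<union> A) ` {A\<in>\<F> N. A \<subseteq> Z \<inter> N}| \<le>o |\<kappa>|"
    proof (rule le_UN[OF k NZ], rule le_image)
      fix N assume "N \<in> \<N>Z"
      then have "N \<in> \<N>" unfolding \<N>Z_def by blast
      then show "|{A\<in>\<F> N. A \<subseteq> Z \<inter> N}| \<le>o |\<kappa>|" by (rule F(4)) (use Z in auto)
    qed
    ultimately show "|{A \<in> ?G. A \<subseteq> Z}| \<le>o |\<kappa>|" by (rule le_subset)
  qed
  then show ?thesis unfolding sparse_cofinal_def by blast
qed

end

section \<open>Sparseness of the scale from stationary reflection\<close>

definition stationary :: "'o::wellorder \<Rightarrow> 'o set \<Rightarrow> bool" where
  "stationary \<kappa> S \<longleftrightarrow> (\<forall>D. club \<kappa> D \<longrightarrow> (\<exists>x\<in>S. x \<in> D))"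

definition cof_omega :: "'o::wellorder \<Rightarrow> bool" where
  "cof_omega \<beta> \<longleftrightarrow> (\<exists>v. countable v \<and> v \<subseteq> {..<\<beta>} \<and> (\<forall>z<\<beta>. \<exists>u\<in>v. z < u))"

context large_wellorder
begin

text \<open>\<open>normal_to (om 1) \<gamma> e\<close> expresses that \<gamma> has cofinality
  \<open>\<omega>\<^sub>1\<close>.\<close>

definition joint_reflection :: bool where
  "joint_reflection \<longleftrightarrow> (\<forall>S :: nat \<Rightarrow> 'o set.
    (\<forall>k. (\<forall>\<beta>\<in>S k. \<beta> < om 2 \<and> cof_omega \<beta>) \<and> stationary (om 2) (S k)) \<longrightarrow>
    (\<exists>\<gamma> e. \<gamma> < om 2 \<and> normal_to (om 1) \<gamma> e \<and> (\<forall>k. stationary \<gamma> (S k))))"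

text \<open>The pairs \<open>(z, m)\<close> for which \<open>sc (\<rho> i) m > z\<close> holds for stationarily many \<open>i\<close> form a countable
  family, so one reflection point \<open>\<gamma>\<close> handles all of them, and \<open>sc (\<rho> \<gamma>)\<close> is then too large.\<close>

lemma sparse_scale_aleph1:
  assumes refl: joint_reflection and Z: "countable Z"
  shows "|{\<xi>. \<xi> < L \<and> (\<forall>n\<in>a0. sc \<xi> n \<in> Z)}| \<le>o |aleph 1|"
proof (rule ccontr)
  assume neg: "\<not> ?thesis"
  obtain X where X: "X \<subseteq> {\<xi>. \<xi> < L \<and> (\<forall>n\<in>a0. sc \<xi> n \<in> Z)}" "X \<noteq> {}"
    and "\<forall>Q\<subseteq>X. |Q| \<le>o |aleph 1| \<longrightarrow> (\<exists>x\<in>X. \<forall>q\<in>Q. q < x)"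
    by (rule thin_directed[OF neg infinite_aleph])
  then have dir: "\<And>Q. Q \<subseteq> X \<Longrightarrow> |Q| \<le>o |aleph 1| \<Longrightarrow> \<exists>x\<in>X. \<forall>q\<in>Q. q < x" by simp
  have XL: "x < L" if "x \<in> X" for x using X(1) that by auto
  have small: "|{..<i}| \<le>o |aleph 1|" if "i < om 2" for i :: 'o
    by (rule om_Suc(2)) (use that in \<open>simp add: numeral_2_eq_2\<close>)
  have "\<exists>\<rho> x :: 'o \<Rightarrow> 'o. (\<forall>i. \<rho> i = ssup (x ` {..<i})) \<and> (\<forall>k< om 2. x k \<in> X \<and> \<rho> k < x k \<and> True)"
  proof (rule interleaved_sequence[of X "aleph 1" "om 2" "\<lambda>_ _ _. True", OF dir X(2) small])
    fix z assume "z \<in> X"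
    then show "\<exists>x\<in>X. z < x \<and> True" using dir[of "{z}"] le_finite[OF infinite_aleph, of "{z}" 1] by auto
  qed simp_all
  then obtain \<rho> x :: "'o \<Rightarrow> 'o" where rx: "\<forall>i. \<rho> i = ssup (x ` {..<i})" "\<forall>k< om 2. x k \<in> X \<and> \<rho> k < x k \<and> True"
    by (elim exE conjE)
  have x: "x k \<in> X" "\<rho> k < x k" if "k < om 2" for k using rx(2) that by simp_all
  have bound: "\<exists>z\<in>X. \<forall>q\<in>x ` {..<j}. q < z" if "j < om 2" for j
    by (rule dir[OF _ le_image[OF small[OF that]]]) (use x(1) that in \<open>auto intro: less_trans\<close>)
  have xr: "x i < \<rho> j" if ij: "i < j" "j < om 2" for i j
  proof -
    obtain z where "\<forall>q\<in>x ` {..<j}. q < z" using bound[OF ij(2)] by blast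
    then show ?thesis unfolding rx(1)[rule_format, of j] by (rule ssup_gt) (use ij in simp)
  qed
  have rL: "\<rho> i < L" if "i < om 2" for i using less_trans[OF x(2)[OF that] XL[OF x(1)[OF that]]] .
  define A where "A z m = {i. i < om 2 \<and> cof_omega i \<and> z < sc (\<rho> i) m}" for z m
  define W where "W = {i :: 'o. i < om 2 \<and> cof_omega i}"
  have c2: "cof_gt (UNIV::nat set) (om 2 :: 'o)" by (rule cof_om_nat) simp
  have statW: "stationary (om 2) W"
    unfolding stationary_def
  proof (intro allI impI)
    fix D :: "'o set" assume D: "club (om 2) D"
    obtain w where "w < (om 2 :: 'o)" using om_pos by blast
    then obtain y where "y \<in> D" "cof_omega y"
      unfolding cof_omega_def by (rule club_cof_omega[OF c2 D])
    then show "\<exists>x\<in>W. x \<in> D" unfolding W_def using clubD_sub[OF D] by blast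
  qed
  define PS where "PS = {(z, m) \<in> Z \<times> a0. stationary (om 2) (A z m)}"
  \<comment> \<open>\<open>W\<close> keeps the family nonempty, so that \<open>from_nat_into\<close>
    enumerates it.\<close>
  define \<S> where "\<S> = insert W ((\<lambda>(z, m). A z m) ` PS)"
  have "countable PS" unfolding PS_def by (rule countable_subset[of _ "Z \<times> a0"]) (use Z in auto)
  then have cS: "countable \<S>" unfolding \<S>_def by simp
  have neS: "\<S> \<noteq> {}" unfolding \<S>_def by simp
  have S1: "(\<forall>\<beta>\<in>B. \<beta> < om 2 \<and> cof_omega \<beta>) \<and> stationary (om 2) B" if "B \<in> \<S>" for B
    using that statW unfolding \<S>_def PS_def A_def W_def by auto
  from refl[unfolded joint_reflection_def, rule_format, of "from_nat_into \<S>"]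
  have "\<exists>\<gamma> e. \<gamma> < om 2 \<and> normal_to (om 1) \<gamma> e \<and> (\<forall>k. stationary \<gamma> (from_nat_into \<S> k))"
    using S1[OF from_nat_into[OF neS]] by blast
  then obtain \<gamma> e where g: "\<gamma> < om 2" "normal_to (om 1) \<gamma> e" "\<And>k. stationary \<gamma> (from_nat_into \<S> k)"
    by blast
  have statg: "stationary \<gamma> B" if B: "B \<in> \<S>" for B
  proof -
    obtain k where "B = from_nat_into \<S> k" using from_nat_into_surj[OF cS B] by auto
    then show ?thesis using g(3) by simp
  qed
  have limg: "\<forall>k<\<gamma>. \<exists>j. k < j \<and> j < \<gamma>"
  proof (intro allI impI)
    fix k assume "k < \<gamma>"
    then obtain i where "i < om 1" "k < e i" using normal_toD(3)[OF g(2)] by blast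
    then show "\<exists>j. k < j \<and> j < \<gamma>" using normal_toD(2)[OF g(2)] by blast
  qed
  obtain z where z: "\<forall>q\<in>x ` {..<\<gamma>}. q < z" using bound[OF g(1)] by blast
  have "\<forall>k<\<gamma>. \<rho> k < x k" using x(2) g(1) by (auto intro: less_trans)
  from interleaved_normal(2)[OF rx(1) this z limg]
  have N: "normal_to \<gamma> (\<rho> \<gamma>) \<rho>" .
  define \<delta> where "\<delta> = \<rho> \<gamma>"
  have dL: "\<delta> < L" unfolding \<delta>_def by (rule rL[OF g(1)])
  have "|aleph 1| \<le>o |aleph 3|" by (rule aleph_mono) simp
  then have sz: "|\<rho> ` {..<\<gamma>}| \<le>o |aleph 3|" using le_image[OF small[OF g(1)]] ordLeq_transitive by blast
  have c1: "cof_gt (UNIV::nat set) (om 1 :: 'o)" by (rule cof_om_nat) simp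
  have cl: "club \<gamma> {i. i < \<gamma> \<and> \<rho> i \<in> small_club \<delta>}"
    unfolding \<delta>_def
    by (rule club_vimage[OF N normal_to_cof[OF g(2) c1] small_club(3)[OF club_range[OF N] sz[unfolded \<delta>_def]]])
  have high: "z < sc \<delta> m" if zm: "(z, m) \<in> PS" for z m
  proof -
    have "A z m \<in> \<S>" unfolding \<S>_def using zm by force
    from statg[OF this] cl obtain i where i: "i \<in> A z m" "\<rho> i \<in> small_club \<delta>" unfolding stationary_def by blast
    have "m \<in> a0" using zm unfolding PS_def by blast
    then have "sc (\<rho> i) m \<le> sc \<delta> m" by (rule sc_club[OF dL i(2)])
    then show ?thesis using i(1) unfolding A_def by auto
  qed
  \<comment> \<open>Every nonstationary \<open>A z m\<close> is avoided by a club. A point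
    \<epsilon> in all these countably many clubs can lie in \<open>A z m\<close> only if that set is
    stationary.\<close>
  have "\<forall>p. \<exists>D. club (om 2) D \<and> (p \<in> Z \<times> a0 - PS \<longrightarrow> A (fst p) (snd p) \<inter> D = {})"
  proof
    fix p :: "'o \<times> nat"
    obtain w where "w < (om 2 :: 'o)" using om_pos by blast
    then have c: "club (om 2) {y. w < y \<and> y < (om 2 :: 'o)}" by (rule club_tail[OF c2])
    show "\<exists>D. club (om 2) D \<and> (p \<in> Z \<times> a0 - PS \<longrightarrow> A (fst p) (snd p) \<inter> D = {})"
    proof (cases "p \<in> Z \<times> a0 - PS")
      case True
      then have "\<not> stationary (om 2) (A (fst p) (snd p))" unfolding PS_def by auto
      then obtain D where "club (om 2) D" "A (fst p) (snd p) \<inter> D = {}" unfolding stationary_def by blast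
      then show ?thesis by blast
    next
      case False
      then show ?thesis using c by blast
    qed
  qed
  from choice[OF this] obtain D where "\<forall>p. club (om 2) (D p) \<and> (p \<in> Z \<times> a0 - PS \<longrightarrow> A (fst p) (snd p) \<inter> D p = {})"
    by (rule exE)
  note D = conjunct1[OF spec[OF this]] conjunct2[OF spec[OF this], rule_format]
  have "countable (Z \<times> a0)" using Z by simp
  then have "|Z \<times> a0| \<le>o |UNIV::nat set|" using countable_iff_le by blast
  then have "club (om 2) (aleph 2 \<inter> (\<Inter>p\<in>Z \<times> a0. D p))" by (intro club_INT[OF c2] D(1)) simp_all
  then obtain \<epsilon> where ep: "\<epsilon> \<in> aleph 2 \<inter> (\<Inter>p\<in>Z \<times> a0. D p)" "\<gamma> < \<epsilon>" "cof_omega \<epsilon>"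
    unfolding cof_omega_def by (rule club_cof_omega[OF c2 _ g(1)])
  have e2: "\<epsilon> < om 2" using ep(1) by simp
  have n1: "nul {n\<in>a0. sc (x \<gamma>) n \<le> sc \<delta> n}"
    unfolding \<delta>_def by (rule sc_inc[OF XL[OF x(1)[OF g(1)]] x(2)[OF g(1)]])
  have n2: "nul {n\<in>a0. sc (\<rho> \<epsilon>) n \<le> sc (x \<gamma>) n}"
    by (rule sc_inc[OF rL[OF e2] xr[OF ep(2) e2]])
  \<comment> \<open>With \<open>z = sc (x \<gamma>) m\<close> this reads
    \<open>sc \<delta> m < z < sc (\<rho> \<epsilon>) m\<close>. The right half puts
    \<open>(z, m)\<close> into \<open>PS\<close>, and then \<open>high\<close> contradicts the left
    half.\<close>
  obtain m where m: "m \<in> a0" "sc \<delta> m < sc (x \<gamma>) m" "sc (x \<gamma>) m < sc (\<rho> \<epsilon>) m"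
    using not_nul[OF nul_Un[OF n1 n2]] by (auto simp: not_le)
  have zZ: "sc (x \<gamma>) m \<in> Z" using X(1) x(1)[OF g(1)] m(1) by blast
  have eA: "\<epsilon> \<in> A (sc (x \<gamma>) m) m" unfolding A_def using e2 ep(3) m(3) by simp
  have "(sc (x \<gamma>) m, m) \<in> PS"
  proof (rule ccontr)
    assume "(sc (x \<gamma>) m, m) \<notin> PS"
    then have p: "(sc (x \<gamma>) m, m) \<in> Z \<times> a0 - PS" using zZ m(1) by simp
    have "\<epsilon> \<in> D (sc (x \<gamma>) m, m)" using ep(1) zZ m(1) by blast
    then show False using D(2)[OF p] eA by auto
  qed
  from high[OF this] m(2) show False by simp
qed

end

section \<open>Martin's Maximum for isomorphic forcing notions\<close>

context
  fixes r :: "'q rel" and j :: "'q \<Rightarrow> 'p" and r' :: "'p rel"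
  assumes inj: "inj_on j (Field r)" and r': "r' = map_prod j j ` r"
begin

private lemma rel: "q \<in> Field r \<Longrightarrow> p \<in> Field r \<Longrightarrow> (j q, j p) \<in> r' \<longleftrightarrow> (q, p) \<in> r"
proof
  assume qp: "q \<in> Field r" "p \<in> Field r" "(j q, j p) \<in> r'"
  then obtain a b where ab: "(a, b) \<in> r" "j a = j q" "j b = j p" unfolding r' by auto
  have "a \<in> Field r" "b \<in> Field r" using ab(1) unfolding Field_def by auto
  then show "(q, p) \<in> r" using ab qp(1,2) inj by (metis inj_onD)
qed (auto simp: r')

private lemma relE: "(q', j p) \<in> r' \<Longrightarrow> p \<in> Field r \<Longrightarrow> \<exists>q. q' = j q \<and> q \<in> Field r \<and> (q, p) \<in> r"
proof -
  assume a: "(q', j p) \<in> r'" "p \<in> Field r"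
  then obtain a b where ab: "(a, b) \<in> r" "j a = q'" "j b = j p" unfolding r' by auto
  have F: "a \<in> Field r" "b \<in> Field r" using ab(1) unfolding Field_def by auto
  then have "b = p" using ab(3) a(2) inj by (metis inj_onD)
  then show ?thesis using ab F by blast
qed

private lemma Field': "Field r' = j ` Field r"
  unfolding r' Field_def by force

private lemma all_below:
  "p \<in> Field r \<Longrightarrow> (\<forall>q'. (q', j p) \<in> r' \<longrightarrow> Q q') \<longleftrightarrow> (\<forall>q. (q, p) \<in> r \<longrightarrow> Q (j q))"
proof
  assume p: "p \<in> Field r"
  show "\<forall>q'. (q', j p) \<in> r' \<longrightarrow> Q q' \<Longrightarrow> \<forall>q. (q, p) \<in> r \<longrightarrow> Q (j q)"
    unfolding r' by force
  show "\<forall>q. (q, p) \<in> r \<longrightarrow> Q (j q) \<Longrightarrow> \<forall>q'. (q', j p) \<in> r' \<longrightarrow> Q q'"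
    using relE[OF _ p] by blast
qed

private lemma ex_below:
  "p \<in> Field r \<Longrightarrow> (\<exists>q'. (q', j p) \<in> r' \<and> Q q') \<longleftrightarrow> (\<exists>q. (q, p) \<in> r \<and> Q (j q))"
  using all_below[of p "\<lambda>x. \<not> Q x"] by blast

private lemma below_Field: "(q, p) \<in> r \<Longrightarrow> q \<in> Field r"
  unfolding Field_def by auto

private lemma f_ex': 
  assumes "p \<in> Field r" "\<And>x p. x \<in> A \<Longrightarrow> p \<in> Field r \<Longrightarrow> \<phi>' x (j p) \<longleftrightarrow> \<phi> x p"
  shows "f_ex r' A \<phi>' (j p) \<longleftrightarrow> f_ex r A \<phi> p"
proof -
  have "(\<exists>t. (t, j q) \<in> r' \<and> (\<exists>x\<in>A. \<phi>' x t)) \<longleftrightarrow> (\<exists>t. (t, q) \<in> r \<and> (\<exists>x\<in>A. \<phi> x t))" if "(q, p) \<in> r" for q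
    unfolding ex_below[OF below_Field[OF that]] using assms(2) below_Field by blast
  then show ?thesis unfolding f_ex_def all_below[OF assms(1)] by blast
qed

private lemma f_imp':
  assumes "p \<in> Field r" "\<And>p. p \<in> Field r \<Longrightarrow> \<phi>' (j p) \<longleftrightarrow> \<phi> p" "\<And>p. p \<in> Field r \<Longrightarrow> \<psi>' (j p) \<longleftrightarrow> \<psi> p"
  shows "f_imp r' \<phi>' \<psi>' (j p) \<longleftrightarrow> f_imp r \<phi> \<psi> p"
  unfolding f_imp_def all_below[OF assms(1)] using assms(2,3) below_Field by blast

private lemma f_mem':
  assumes p: "p \<in> Field r" and N: "N \<subseteq> UNIV \<times> Field r'"
  shows "f_mem r' N a (j p) \<longleftrightarrow> f_mem r {(a, s). s \<in> Field r \<and> (a, j s) \<in> N} a p"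
proof -
  have "(\<exists>t s. (t, j q) \<in> r' \<and> (a, s) \<in> N \<and> (t, s) \<in> r') \<longleftrightarrow>
      (\<exists>t s. (t, q) \<in> r \<and> (a, s) \<in> {(a, s). s \<in> Field r \<and> (a, j s) \<in> N} \<and> (t, s) \<in> r)" if q: "(q, p) \<in> r" for q
  proof -
    have "(\<exists>t s. (t, j q) \<in> r' \<and> (a, s) \<in> N \<and> (t, s) \<in> r') \<longleftrightarrow>
      (\<exists>t. (t, j q) \<in> r' \<and> (\<exists>s. (a, s) \<in> N \<and> (t, s) \<in> r'))" by blast
    also have "\<dots> \<longleftrightarrow> (\<exists>t. (t, q) \<in> r \<and> (\<exists>s. (a, s) \<in> N \<and> (j t, s) \<in> r'))"
      by (rule ex_below[OF below_Field[OF q]])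
    also have "\<dots> \<longleftrightarrow> (\<exists>t. (t, q) \<in> r \<and> (\<exists>s. s \<in> Field r \<and> (a, j s) \<in> N \<and> (t, s) \<in> r))"
    proof -
      have "(\<exists>s. (a, s) \<in> N \<and> (j t, s) \<in> r') \<longleftrightarrow> (\<exists>s. s \<in> Field r \<and> (a, j s) \<in> N \<and> (t, s) \<in> r)"
        if t: "t \<in> Field r" for t
      proof
        assume "\<exists>s. (a, s) \<in> N \<and> (j t, s) \<in> r'"
        then obtain s' where s': "(a, s') \<in> N" "(j t, s') \<in> r'" by blast
        then obtain s where s: "s \<in> Field r" "s' = j s" using N Field' by blast
        then show "\<exists>s. s \<in> Field r \<and> (a, j s) \<in> N \<and> (t, s) \<in> r" using s' rel[OF t s(1)] by blast
      next
        assume "\<exists>s. s \<in> Field r \<and> (a, j s) \<in> N \<and> (t, s) \<in> r"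
        then show "\<exists>s. (a, s) \<in> N \<and> (j t, s) \<in> r'" using rel[OF t] by blast
      qed
      then show ?thesis using below_Field by blast
    qed
    finally show ?thesis by blast
  qed
  then show ?thesis unfolding f_mem_def all_below[OF p] by blast
qed

private lemma f_club':
  assumes p: "p \<in> Field r" and N: "N \<subseteq> UNIV \<times> Field r'"
  shows "f_club r' N (j p) \<longleftrightarrow> f_club r {(a, s). s \<in> Field r \<and> (a, j s) \<in> N} p"
proof -
  let ?N = "{(a, s). s \<in> Field r \<and> (a, j s) \<in> N}"
  note m = f_mem'[OF _ N]
  have e: "f_ex r' A (f_mem r' N) (j p) \<longleftrightarrow> f_ex r A (f_mem r ?N) p" if "p \<in> Field r" for A p
    by (rule f_ex'[OF that]) (rule m)
  have i: "f_imp r' (f_all U (\<lambda>a. f_ex r' (W a) (f_mem r' N))) (f_mem r' N d) (j p) \<longleftrightarrow>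
    f_imp r (f_all U (\<lambda>a. f_ex r (W a) (f_mem r ?N))) (f_mem r ?N d) p" if "p \<in> Field r" for U W d p
    by (rule f_imp'[OF that]) (simp add: f_all_def e, rule m)
  show ?thesis
    unfolding f_club_def f_conj_def f_all_def[of "Field aleph1"] f_all_def[of "{d \<in> Field aleph1. underS aleph1 d \<noteq> {}}"]
      e[OF p] i[OF p] by (rule refl)
qed

private lemma preserves_stationary':
  assumes "preserves_stationary r" shows "preserves_stationary r'"
  unfolding preserves_stationary_def forces_stationary_def
proof (intro allI impI ballI)
  fix S N p' assume S: "stationary_omega1 S" and N: "name_omega1 r' N" and "p' \<in> Field r'"
  then obtain p where p: "p' = j p" "p \<in> Field r" unfolding Field' by blast
  let ?N = "{(a, s). s \<in> Field r \<and> (a, j s) \<in> N}"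
  have N1: "N \<subseteq> UNIV \<times> Field r'" and N2: "name_omega1 r ?N" using N unfolding name_omega1_def by auto
  have e: "f_ex r' S (f_mem r' N) (j p) \<longleftrightarrow> f_ex r S (f_mem r ?N) p" if "p \<in> Field r" for p
    by (rule f_ex'[OF that]) (rule f_mem'[OF _ N1])
  have "f_imp r (f_club r ?N) (f_ex r S (f_mem r ?N)) p"
    using assms S N2 p(2) unfolding preserves_stationary_def forces_stationary_def by blast
  then show "f_imp r' (f_club r' N) (f_ex r' S (f_mem r' N)) p'"
    unfolding p(1) using f_imp'[of p "f_club r' N" "f_club r ?N" "f_ex r' S (f_mem r' N)" "f_ex r S (f_mem r ?N)",
        OF p(2) f_club'[OF _ N1] e] by simp
qed

private lemma forcing_notion':
  assumes "forcing_notion r" shows "forcing_notion r'"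
proof -
  have ne: "r \<noteq> {}" and rf: "refl_on (Field r) r" and tr: "trans r"
    using assms unfolding forcing_notion_def preorder_on_def by auto
  have "r' \<noteq> {}" using ne unfolding r' by simp
  moreover have "refl_on (Field r') r'"
    unfolding refl_on_def Field' using rf rel unfolding refl_on_def by auto
  moreover have "r' \<subseteq> Field r' \<times> Field r'" unfolding Field_def by auto
  moreover have "trans r'"
  proof (rule transI)
    fix x y z assume xy: "(x, y) \<in> r'" "(y, z) \<in> r'"
    then obtain a b where ab: "x = j a" "y = j b" "(a, b) \<in> r" unfolding r' by auto
    from xy(2) have "z \<in> j ` Field r" using Field' unfolding Field_def by blast
    then obtain c where c: "z = j c" "c \<in> Field r" by blast
    have F: "a \<in> Field r" "b \<in> Field r" using ab(3) unfolding Field_def by auto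
    then have "(b, c) \<in> r" using xy(2) rel c unfolding ab(2) by blast
    then have "(a, c) \<in> r" using ab(3) tr by (meson transD)
    then show "(x, z) \<in> r'" using rel F c ab(1) by blast
  qed
  ultimately show ?thesis unfolding forcing_notion_def preorder_on_def by blast
qed

text \<open>The axiom speaks of conditions of type \<open>'p\<close>, so the forcing notion is
  copied along \<open>j\<close>. Names over the copy are pulled back to transfer preservation of
  stationary sets, and the resulting filter is pulled back as well.\<close>

lemma martins_maximum_embed:
  assumes MM: "martins_maximum TYPE('p)" and fn: "forcing_notion r" and ps: "preserves_stationary r"
    and D: "|\<D>| \<le>o aleph1" "\<And>D. D \<in> \<D> \<Longrightarrow> dense_in r D"
  shows "\<exists>G. filter_in r G \<and> (\<forall>D\<in>\<D>. G \<inter> D \<noteq> {})"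
proof -
  have "|(`) j ` \<D>| \<le>o aleph1" using card_of_image D(1) ordLeq_transitive by blast
  moreover have "\<forall>D\<in>(`) j ` \<D>. dense_in r' D"
  proof
    fix D' assume "D' \<in> (`) j ` \<D>"
    then obtain D where D': "D' = j ` D" "D \<in> \<D>" by blast
    then have d: "D \<subseteq> Field r" "\<forall>p\<in>Field r. \<exists>d\<in>D. (d, p) \<in> r" using assms(5) unfolding dense_in_def by auto
    show "dense_in r' D'" unfolding dense_in_def Field' D'(1)
    proof (intro conjI ballI)
      show "j ` D \<subseteq> j ` Field r" using d(1) by blast
      fix p' assume "p' \<in> j ` Field r"
      then obtain p where p: "p \<in> Field r" "p' = j p" by blast
      then obtain d where "d \<in> D" "(d, p) \<in> r" using d(2) by blast
      then show "\<exists>d'\<in>j ` D. (d', p') \<in> r'" using rel[of d p] d(1) p by blast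
    qed
  qed
  ultimately obtain G' where G': "filter_in r' G'" "\<forall>D\<in>(`) j ` \<D>. G' \<inter> D \<noteq> {}"
    using MM[unfolded martins_maximum_def, rule_format, of r' "(`) j ` \<D>"]
      forcing_notion'[OF fn] preserves_stationary'[OF ps] by auto
  define G where "G = {q \<in> Field r. j q \<in> G'}"
  have sub: "G' \<subseteq> j ` Field r" using G'(1) unfolding filter_in_def Field' by blast
  have ne: "G' \<noteq> {}" and up: "\<And>p q. p \<in> G' \<Longrightarrow> (p, q) \<in> r' \<Longrightarrow> q \<in> G'"
    and dn: "\<And>p q. p \<in> G' \<Longrightarrow> q \<in> G' \<Longrightarrow> \<exists>t\<in>G'. (t, p) \<in> r' \<and> (t, q) \<in> r'"
    using G'(1) unfolding filter_in_def by auto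
  have "filter_in r G"
    unfolding filter_in_def
  proof (intro conjI ballI allI impI)
    show "G \<noteq> {}" using ne sub unfolding G_def by blast
    show "G \<subseteq> Field r" unfolding G_def by blast
    fix p assume p: "p \<in> G"
    then have pF: "p \<in> Field r" "j p \<in> G'" unfolding G_def by auto
    {
      fix q assume pq: "(p, q) \<in> r"
      then have "q \<in> Field r" unfolding Field_def by auto
      then show "q \<in> G" using up[OF pF(2)] rel pF(1) pq unfolding G_def by blast
    next
      fix q assume "q \<in> G"
      then have qF: "q \<in> Field r" "j q \<in> G'" unfolding G_def by auto
      obtain t' where t': "t' \<in> G'" "(t', j p) \<in> r'" "(t', j q) \<in> r'" using dn[OF pF(2) qF(2)] by blast
      then obtain t where t: "t \<in> Field r" "t' = j t" using sub by blast
      then show "\<exists>t\<in>G. (t, p) \<in> r \<and> (t, q) \<in> r" using t' rel pF(1) qF(1) unfolding G_def by blast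
    }
  qed
  moreover have "G \<inter> D \<noteq> {}" if DD: "D \<in> \<D>" for D
  proof -
    have "G' \<inter> j ` D \<noteq> {}" using G'(2) DD by blast
    then obtain d where d: "d \<in> D" "j d \<in> G'" by blast
    then show ?thesis using assms(5)[OF DD] unfolding dense_in_def G_def by blast
  qed
  ultimately show ?thesis by blast
qed

end

section \<open>Stationary subsets of \<open>\<omega>\<^sub>1\<close>\<close>

definition lim_ord :: "'o::wellorder \<Rightarrow> bool" where
  "lim_ord i \<longleftrightarrow> (\<exists>w. w < i) \<and> (\<forall>k<i. \<exists>j. k < j \<and> j < i)"

lemma club_lim_ord:
  fixes \<kappa> :: "'o::wellorder"
  assumes c: "cof_gt (UNIV::nat set) \<kappa>" shows "club \<kappa> {i. i < \<kappa> \<and> lim_ord i}"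
  unfolding club_def
proof (intro conjI allI impI)
  fix x assume x: "x < \<kappa>"
  have "\<exists>y. x < y \<and> y < \<kappa>" if "x < \<kappa>" for x
    using clubD_unb[OF club_tail[OF c that] that] by auto
  then obtain N where N: "\<And>x. x < \<kappa> \<Longrightarrow> x < N x \<and> N x < \<kappa>" by metis
  obtain s y where s: "s 0 = x" "\<And>n::nat. s (Suc n) = N (s n)" "\<And>n. s n < y" "y < \<kappa>"
    "\<And>z. z < y \<Longrightarrow> \<exists>n. z < s n"
    using omega_iterate[OF c N x] by blast
  have "lim_ord y" unfolding lim_ord_def using s(3,5) by blast
  moreover have "x < y" using s(1) s(3)[of 0] by simp
  ultimately show "\<exists>y\<in>{i. i < \<kappa> \<and> lim_ord i}. x < y" using s(4) by blast
next
  fix y assume y: "y < \<kappa>" "{..<y} \<noteq> {} \<and> (\<forall>x<y. \<exists>z\<in>{i. i < \<kappa> \<and> lim_ord i}. x < z \<and> z < y)"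
  then have "lim_ord y" unfolding lim_ord_def by blast
  then show "y \<in> {i. i < \<kappa> \<and> lim_ord i}" using y(1) by blast
qed auto

lemma stationary_mono: "stationary \<kappa> A \<Longrightarrow> A \<subseteq> B \<Longrightarrow> stationary \<kappa> B"
  unfolding stationary_def by blast

lemma stationaryD: "stationary \<kappa> S \<Longrightarrow> club \<kappa> D \<Longrightarrow> \<exists>x\<in>S. x \<in> D"
  unfolding stationary_def by simp

lemma stationary_split:
  fixes A :: "'o::wellorder set" and c :: "'o \<Rightarrow> nat"
  assumes cof: "cof_gt (UNIV::nat set) \<kappa>" and A: "stationary \<kappa> A"
  shows "\<exists>k. stationary \<kappa> {i\<in>A. c i = k}"
proof (rule ccontr)
  assume "\<not> ?thesis"
  then have "\<forall>k. \<exists>D. club \<kappa> D \<and> (\<forall>i\<in>D. i \<in> A \<longrightarrow> c i \<noteq> k)" unfolding stationary_def by blast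
  from choice[OF this] obtain D where "\<forall>k. club \<kappa> (D k) \<and> (\<forall>i\<in>D k. i \<in> A \<longrightarrow> c i \<noteq> k)" by (rule exE)
  then have D: "\<And>k. club \<kappa> (D k)" "\<And>k i. i \<in> D k \<Longrightarrow> i \<in> A \<Longrightarrow> c i \<noteq> k" by simp_all
  have "club \<kappa> ({..<\<kappa>} \<inter> (\<Inter>k. D k))"
    by (rule club_INT[OF cof _ card_of_mono1[OF order_refl] D(1)]) simp
  from stationaryD[OF A this] obtain i where "i \<in> A" "\<And>k. i \<in> D k" by auto
  then show False using D(2)[of i "c i"] by simp
qed

context large_wellorder
begin

text \<open>Ulam: the injections of all \<open>\<alpha> < \<omega>\<^sub>1\<close> into \<open>\<nat>\<close> yield infinitely many disjoint stationary sets.\<close>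

lemma stationary_partition: "\<exists>c :: 'o \<Rightarrow> nat. \<forall>k. stationary (om 1) {i. i < om 1 \<and> c i = k}"
proof -
  have c1: "cof_gt (UNIV::nat set) (om 1 :: 'o)" by (rule cof_om_nat) simp
  have "\<exists>h :: 'o \<Rightarrow> nat. \<alpha> < om 1 \<longrightarrow> inj_on h {..<\<alpha>}" for \<alpha> :: 'o
  proof (cases "\<alpha> < om 1")
    case True
    then have "|{..<\<alpha>}| \<le>o |aleph 0|" by (intro om_Suc(2)) simp
    then have "countable {..<\<alpha>}" using countable_aleph0 by (rule le_countable_set)
    then show ?thesis unfolding countable_def by blast
  qed simp
  then obtain h :: "'o \<Rightarrow> 'o \<Rightarrow> nat" where h: "\<And>\<alpha>. \<alpha> < om 1 \<Longrightarrow> inj_on (h \<alpha>) {..<\<alpha>}" by metis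
  \<comment> \<open>A row of the Ulam matrix: for some \<open>n\<close> the \<alpha> with
    \<open>h \<alpha> \<beta> = n\<close> are stationary. Infinitely many \<beta> share the same
    \<open>n\<close>, and their sets are disjoint because each \<open>h \<alpha>\<close> is
    injective.\<close>
  have st: "\<exists>n. stationary (om 1) {\<alpha> \<in> {\<alpha>. \<beta> < \<alpha> \<and> \<alpha> < om 1}. h \<alpha> \<beta> = n}" if b: "\<beta> < om 1" for \<beta>
  proof (rule stationary_split[OF c1])
    show "stationary (om 1) {\<alpha>. \<beta> < \<alpha> \<and> \<alpha> < om 1}"
      unfolding stationary_def
    proof (intro allI impI)
      fix D :: "'o set" assume D: "club (om 1) D"
      from clubD_unb[OF this b] show "\<exists>x\<in>{\<alpha>. \<beta> < \<alpha> \<and> \<alpha> < om 1}. x \<in> D" using clubD_sub[OF D] by blast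
    qed
  qed
  have "\<forall>\<beta>. \<exists>n. \<beta> < om 1 \<longrightarrow> stationary (om 1) {\<alpha> \<in> {\<alpha>. \<beta> < \<alpha> \<and> \<alpha> < om 1}. h \<alpha> \<beta> = n}"
    using st by blast
  from choice[OF this] obtain nn
    where nn: "\<forall>\<beta>. \<beta> < om 1 \<longrightarrow> stationary (om 1) {\<alpha> \<in> {\<alpha>. \<beta> < \<alpha> \<and> \<alpha> < om 1}. h \<alpha> \<beta> = nn \<beta>}" by (rule exE)
  have "aleph 1 = (\<Union>n. {\<beta>. \<beta> < om 1 \<and> nn \<beta> = n})" by blast
  moreover have "\<not> countable (aleph 1)"
  proof
    assume "countable (aleph 1)"
    then have "|aleph (Suc 0)| \<le>o |aleph 0|" by (intro le_countable infinite_aleph) simp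
    then show False using om_Suc(1)[of 0] not_ordLess_ordLeq by blast
  qed
  ultimately obtain n where "uncountable {\<beta>. \<beta> < om 1 \<and> nn \<beta> = n}"
    using countable_UN[of "UNIV::nat set" "\<lambda>n. {\<beta>. \<beta> < om 1 \<and> nn \<beta> = n}"] by auto
  then have "infinite {\<beta>. \<beta> < om 1 \<and> nn \<beta> = n}" using countable_finite by blast
  then obtain w :: "nat \<Rightarrow> 'o" where w: "inj w" "range w \<subseteq> {\<beta>. \<beta> < om 1 \<and> nn \<beta> = n}"
    using infinite_countable_subset by blast
  define A where "A k = {\<alpha>. w k < \<alpha> \<and> \<alpha> < om 1 \<and> h \<alpha> (w k) = n}" for k
  have stA: "stationary (om 1) (A k)" for k
  proof (rule stationary_mono)
    have "w k < om 1 \<and> nn (w k) = n" using w(2) by blast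
    then show "stationary (om 1) {\<alpha> \<in> {\<alpha>. w k < \<alpha> \<and> \<alpha> < om 1}. h \<alpha> (w k) = n}" using nn by blast
  qed (auto simp: A_def)
  have disj: "k = l" if "\<alpha> \<in> A k" "\<alpha> \<in> A l" for \<alpha> k l
  proof -
    have "w k = w l"
      by (rule inj_onD[OF h[of \<alpha>]]) (use that in \<open>auto simp: A_def\<close>)
    then show ?thesis using w(1) by (simp add: inj_eq)
  qed
  define c where "c \<alpha> = (THE k. \<alpha> \<in> A k)" for \<alpha>
  have "c \<alpha> = k" if "\<alpha> \<in> A k" for \<alpha> k unfolding c_def using that disj by blast
  then have "A k \<subseteq> {i. i < om 1 \<and> c i = k}" for k unfolding A_def by blast
  then show ?thesis using stA stationary_mono by blast
qed

text \<open>Links the \<open>\<omega>\<^sub>1\<close> in the definition of Martin's Maximum with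
  \<open>om 1\<close>. Proper segments of \<open>om 1\<close> are countable, so its order is a
  cardinal order, isomorphic to \<open>aleph1\<close>.\<close>

lemma aleph1_iso:
  "\<exists>\<pi> :: 'o \<Rightarrow> nat set. bij_betw \<pi> (aleph 1) (Field aleph1) \<and> (\<forall>x\<in>aleph 1. \<forall>y\<in>aleph 1. (\<pi> x, \<pi> y) \<in> aleph1 \<longleftrightarrow> x \<le> y)"
proof -
  define r where "r = {(x, y :: 'o). x \<le> y \<and> y < om 1}"
  have F: "Field r = aleph 1" unfolding r_def Field_def by (auto intro: le_less_trans)
  have wf: "wf (r - Id)"
    by (rule wf_subset[OF wf]) (auto simp: r_def)
  have wo: "Well_order r"
    unfolding F well_order_on_def linear_order_on_def partial_order_on_def preorder_on_def
      refl_on_def trans_def antisym_def total_on_def using wf by (auto simp: r_def intro: le_less_trans)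
  have "Restr r (underS r a) <o |Field r|" if a: "a \<in> Field r" for a
  proof -
    let ?R = "Restr r (underS r a)"
    have wR: "Well_order ?R" by (rule Well_order_Restr[OF wo])
    have "Field ?R \<subseteq> {..<a}" unfolding Field_def underS_def r_def by auto
    then have sm: "|Field ?R| \<le>o |aleph 0|"
      using om_Suc(2)[of a 0] a F by (intro le_subset[of "Field ?R" "{..<a}"]) auto
    have "\<not> |Field r| \<le>o ?R"
    proof
      assume "|Field r| \<le>o ?R"
      from card_of_mono2[OF this] have "|aleph (Suc 0)| \<le>o |Field ?R|" by (simp add: Field_card_of F)
      then have "|aleph (Suc 0)| \<le>o |aleph 0|" using sm by (rule ordLeq_transitive)
      then show False using om_Suc(1)[of 0] not_ordLess_ordLeq by blast
    qed
    then show ?thesis by (rule iffD1[OF not_ordLeq_iff_ordLess[OF wR card_of_Well_order]])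
  qed
  then have co: "Card_order r" using Card_order_iff_Restr_underS[OF wo] by blast
  have "r =o |aleph 1|" using co F Card_order_iff_ordIso_card_of by metis
  moreover have "|aleph (Suc 0)| =o cardSuc |aleph 0|" by (rule alephSuc_ordIso)
  moreover have "cardSuc |aleph 0| =o aleph1"
    using cardSuc_invar_ordIso[OF card_of_Card_order natLeq_Card_order] aleph0_ordIso by blast
  ultimately have "r =o aleph1" by (metis One_nat_def ordIso_transitive)
  then obtain \<pi> where pi: "iso r aleph1 \<pi>" unfolding ordIso_def by blast
  have woa: "Well_order aleph1" by (rule cardSuc_Well_order[OF natLeq_Card_order])
  have bij: "bij_betw \<pi> (aleph 1) (Field aleph1)" using pi F unfolding iso_def by simp
  have fw: "(\<pi> x, \<pi> y) \<in> aleph1" if "(x, y) \<in> r" for x y using iso_forward[OF that pi] .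
  have "(\<pi> x, \<pi> y) \<in> aleph1 \<longleftrightarrow> x \<le> y" if x: "x \<in> aleph 1" and y: "y \<in> aleph 1" for x y
  proof
    show "x \<le> y \<Longrightarrow> (\<pi> x, \<pi> y) \<in> aleph1" by (rule fw) (use y in \<open>simp add: r_def\<close>)
    assume p: "(\<pi> x, \<pi> y) \<in> aleph1"
    show "x \<le> y"
    proof (rule ccontr)
      assume "\<not> x \<le> y"
      then have "(\<pi> y, \<pi> x) \<in> aleph1" by (intro fw) (use x in \<open>simp add: r_def\<close>)
      moreover have "antisym aleph1"
        using woa unfolding well_order_on_def linear_order_on_def partial_order_on_def by blast
      ultimately have "\<pi> x = \<pi> y" using p unfolding antisym_def by blast
      then have "x = y" using bij x y unfolding bij_betw_def inj_on_def by blast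
      then show False using \<open>\<not> x \<le> y\<close> by simp
    qed
  qed
  then show ?thesis using bij by blast
qed

end

section \<open>Reflection from Martin's Maximum\<close>

text \<open>\<open>c\<close> prescribes which \<open>S k\<close> a generic sequence must enter at
  which limit position. As every fibre of \<open>c\<close> is stationary, each \<open>S k\<close>
  will be entered stationarily often.\<close>

locale reflection_forcing = large_wellorder T for T :: "'o::wellorder itself" +
  fixes S :: "nat \<Rightarrow> 'o set" and c :: "'o \<Rightarrow> nat"
  assumes S: "\<And>k \<beta>. \<beta> \<in> S k \<Longrightarrow> \<beta> < om 2 \<and> cof_omega \<beta>" "\<And>k. stationary (om 2) (S k)"
    and c: "\<And>k. stationary (om 1) {i. i < om 1 \<and> c i = k}"
begin

text \<open>A condition \<open>(a, s)\<close> stands for the sequence of length \<open>a + 1\<close> given by \<open>s\<close>; the padding by \<open>\<omega>\<^sub>2\<close>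
  makes this encoding injective.\<close>

definition cond :: "'o \<times> ('o \<Rightarrow> 'o) \<Rightarrow> bool" where
  "cond p \<longleftrightarrow> fst p < om 1 \<and> (\<forall>i\<le>fst p. snd p i < om 2) \<and> (\<forall>j\<le>fst p. \<forall>i<j. snd p i < snd p j) \<and>
    (\<forall>i\<le>fst p. lim_ord i \<longrightarrow> snd p i \<in> S (c i) \<and> (\<forall>y<snd p i. \<exists>j<i. y < snd p j)) \<and>
    (\<forall>i. fst p < i \<longrightarrow> snd p i = om 2)"

definition ext :: "'o \<times> ('o \<Rightarrow> 'o) \<Rightarrow> 'o \<times> ('o \<Rightarrow> 'o) \<Rightarrow> bool" where
  "ext q p \<longleftrightarrow> fst p \<le> fst q \<and> (\<forall>i\<le>fst p. snd q i = snd p i)"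

definition top :: "'o \<times> ('o \<Rightarrow> 'o) \<Rightarrow> 'o" where "top p = snd p (fst p)"

lemma condD:
  assumes "cond p"
  shows "fst p < om 1" "i \<le> fst p \<Longrightarrow> snd p i < om 2" "j \<le> fst p \<Longrightarrow> i < j \<Longrightarrow> snd p i < snd p j"
    "i \<le> fst p \<Longrightarrow> lim_ord i \<Longrightarrow> snd p i \<in> S (c i)"
    "i \<le> fst p \<Longrightarrow> lim_ord i \<Longrightarrow> y < snd p i \<Longrightarrow> \<exists>j<i. y < snd p j" "fst p < i \<Longrightarrow> snd p i = om 2"
  using assms unfolding cond_def by simp_all

lemma ext_refl: "ext p p"
  unfolding ext_def by simp

lemma ext_trans: "ext t q \<Longrightarrow> ext q p \<Longrightarrow> ext t p"
  unfolding ext_def by (auto intro: order_trans)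

lemma ext_val: "ext q p \<Longrightarrow> i \<le> fst p \<Longrightarrow> snd q i = snd p i"
  and ext_len: "ext q p \<Longrightarrow> fst p \<le> fst q"
  unfolding ext_def by simp_all

lemma top_mono: assumes "cond q" "ext q p" shows "top p \<le> top q"
proof -
  have "top p = snd q (fst p)" using ext_val[OF assms(2) order_refl] by (simp add: top_def)
  moreover have "snd q (fst p) \<le> snd q (fst q)"
    using condD(3)[OF assms(1) order_refl, of "fst p"] ext_len[OF assms(2)]
    by (cases "fst p = fst q") (auto simp: order.order_iff_strict)
  ultimately show ?thesis by (simp add: top_def)
qed

lemma top_less: "cond p \<Longrightarrow> top p < om 2"
  unfolding top_def by (rule condD(2)) simp_all

lemma le_top: "cond p \<Longrightarrow> i \<le> fst p \<Longrightarrow> snd p i \<le> top p"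
  unfolding top_def using condD(3)[of p "fst p" i] by (cases "i = fst p") (auto simp: order.order_iff_strict)

text \<open>The union of \<omega> conditions extends to a condition only if its supremum \<beta>
  happens to lie in \<open>S (c \<alpha>)\<close>. The forcing notion need not be countably closed,
  and arranging this is the main difficulty below.\<close>

lemma cond_glue:
  fixes p :: "nat \<Rightarrow> 'o \<times> ('o \<Rightarrow> 'o)"
  assumes p: "\<And>n. cond (p n)" "\<And>n. ext (p (Suc n)) (p n)"
    and al: "\<And>n. fst (p n) < \<alpha>" "\<And>x. x < \<alpha> \<Longrightarrow> \<exists>n. x < fst (p n)" "\<alpha> < om 1"
    and be: "\<And>n. top (p n) < \<beta>" "\<And>y. y < \<beta> \<Longrightarrow> \<exists>n. y < top (p n)" "\<beta> \<in> S (c \<alpha>)"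
  shows "\<exists>t. cond t \<and> fst t = \<alpha> \<and> top t = \<beta> \<and> (\<forall>n. ext t (p n))"
proof -
  have mono: "ext (p n) (p m)" if "m \<le> n" for m n
    using that by (induction n rule: dec_induct) (auto intro: ext_refl ext_trans p(2))
  define N where "N i = (LEAST n. i \<le> fst (p n))" for i
  define s where "s i = (if i < \<alpha> then snd (p (N i)) i else if i = \<alpha> then \<beta> else om 2)" for i
  have s: "s i = snd (p n) i" if "i \<le> fst (p n)" for i n
  proof -
    have "i < \<alpha>" using that al(1) by (rule le_less_trans)
    moreover have "N i \<le> n" unfolding N_def using that by (rule Least_le)
    moreover have "i \<le> fst (p (N i))" unfolding N_def using that by (rule LeastI)
    ultimately show ?thesis using ext_val[OF mono] unfolding s_def by simp
  qed
  have below: "\<exists>n. i \<le> fst (p n)" if "i < \<alpha>" for i using al(2)[OF that] less_imp_le by blast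
  have sa: "s \<alpha> = \<beta>" unfolding s_def by simp
  have sb: "s i < \<beta>" if "i < \<alpha>" for i
  proof -
    obtain n where n: "i \<le> fst (p n)" using below[OF \<open>i < \<alpha>\<close>] by blast
    have "s i \<le> top (p n)" unfolding s[OF n] by (rule le_top[OF p(1) n])
    then show ?thesis using be(1) by (rule le_less_trans)
  qed
  have b2: "\<beta> < om 2" using S(1)[OF be(3)] by simp
  have "cond (\<alpha>, s)"
    unfolding cond_def fst_conv snd_conv
  proof (intro conjI allI impI)
    show "\<alpha> < om 1" by (rule al(3))
    show "s i < om 2" if "i \<le> \<alpha>" for i
      using less_trans[OF sb[of i] b2] sa b2 that by (cases "i = \<alpha>") auto
    show "s i < s j" if ij: "j \<le> \<alpha>" "i < j" for i j
    proof (cases "j = \<alpha>")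
      case True
      then show ?thesis using sb ij sa by simp
    next
      case False
      then have "j < \<alpha>" using ij by simp
      from below[OF this] obtain n where n: "j \<le> fst (p n)" by blast
      then have "i \<le> fst (p n)" using ij by simp
      then show ?thesis using s n condD(3)[OF p(1) n ij(2)] by simp
    qed
    fix i assume i: "i \<le> \<alpha>" "lim_ord i"
    show "s i \<in> S (c i)"
    proof (cases "i = \<alpha>")
      case True
      then show ?thesis using sa be(3) by simp
    next
      case False
      then have "i < \<alpha>" using i by simp
      from below[OF this] obtain n where n: "i \<le> fst (p n)" by blast
      show ?thesis unfolding s[OF n] by (rule condD(4)[OF p(1) n i(2)])
    qed
    fix y assume y: "y < s i"
    show "\<exists>j<i. y < s j"
    proof (cases "i = \<alpha>")
      case True
      then obtain n where n: "y < top (p n)" using be(2)[of y] y sa by auto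
      then show ?thesis using True al(1)[of n] s[of "fst (p n)" n] unfolding top_def
        by (intro exI[of _ "fst (p n)"]) simp
    next
      case False
      then have "i < \<alpha>" using i by simp
      from below[OF this] obtain n where n: "i \<le> fst (p n)" by blast
      obtain j where j: "j < i" "y < snd (p n) j" using condD(5)[OF p(1) n i(2)] y s[OF n] by auto
      then show ?thesis using s[of j n] n by (intro exI[of _ j]) simp
    qed
  next
    fix i assume "\<alpha> < i"
    then have "\<not> i < \<alpha>" "i \<noteq> \<alpha>" by auto
    then show "s i = om 2" unfolding s_def by simp
  qed
  moreover have "ext (\<alpha>, s) (p n)" for n
    unfolding ext_def using s al(1)[of n] by simp
  ultimately show ?thesis using sa by (intro exI[of _ "(\<alpha>, s)"]) (simp add: top_def)
qed

lemma cond_succ: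
  assumes p: "cond p" and y: "\<eta> < om 2"
  shows "\<exists>t. cond t \<and> ext t p \<and> fst t = ssup {fst p} \<and> \<eta> < top t"
proof -
  let ?a = "ssup {fst p}"
  have c1: "cof_gt (UNIV::nat set) (om 1 :: 'o)" and c2: "cof_gt (UNIV::nat set) (om 2 :: 'o)"
    by (rule cof_om_nat, simp)+
  have f: "|{x}| \<le>o |UNIV::nat set|" for x :: 'o by (rule le_finite) simp_all
  have a: "?a < om 1" "fst p < ?a"
    using cof_gt_ssup[OF c1 _ f, of "fst p"] condD(1)[OF p] by auto
  have le: "x \<le> fst p" if "x < ?a" for x using less_ssup[OF that] by simp
  have nl: "\<not> lim_ord ?a" unfolding lim_ord_def using a(2) le by (meson not_le)
  have "max \<eta> (top p) < om 2" using y top_less[OF p] by simp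
  then obtain v where v: "max \<eta> (top p) < v" "v < om 2" using om_limit by blast
  define s where "s i = (if i \<le> fst p then snd p i else if i = ?a then v else om 2)" for i
  have s1: "s i = snd p i" if "i \<le> fst p" for i using that unfolding s_def by simp
  have s2: "s ?a = v" using a(2) unfolding s_def by (auto dest: leD)
  have cs: "i = ?a \<or> i \<le> fst p" if "i \<le> ?a" for i using that le[of i] by (auto simp: le_less)
  have "cond (?a, s)"
    unfolding cond_def fst_conv snd_conv
  proof (intro conjI allI impI)
    show "?a < om 1" by (rule a(1))
    show "s i < om 2" if "i \<le> ?a" for i
      using cs[OF that] s1 s2 v(2) condD(2)[OF p] by auto
    show "s i < s j" if ij: "j \<le> ?a" "i < j" for i j
    proof (cases "j = ?a")
      case True
      then have i: "i \<le> fst p" using le ij by simp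
      have "s i \<le> top p" unfolding s1[OF i] by (rule le_top[OF p i])
      also have "top p < v" using v(1) by simp
      finally show ?thesis using True s2 by simp
    next
      case False
      then have j: "j \<le> fst p" using cs[OF ij(1)] by simp
      then show ?thesis using s1 ij(2) condD(3)[OF p j ij(2)] by simp
    qed
    fix i assume i: "i \<le> ?a" "lim_ord i"
    then have ip: "i \<le> fst p" using cs[OF i(1)] nl by auto
    show "s i \<in> S (c i)" unfolding s1[OF ip] by (rule condD(4)[OF p ip i(2)])
    fix y assume "y < s i"
    then obtain j where "j < i" "y < snd p j" using condD(5)[OF p ip i(2)] s1[OF ip] by auto
    then show "\<exists>j<i. y < s j" using s1[of j] ip by (intro exI[of _ j]) simp
  next
    fix i assume "?a < i"
    then have "\<not> i \<le> fst p" "i \<noteq> ?a" using a(2) by auto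
    then show "s i = om 2" unfolding s_def by simp
  qed
  moreover have "ext (?a, s) p" unfolding ext_def using s1 a(2) by simp
  moreover have "\<eta> < top (?a, s)" using s2 v(1) by (simp add: top_def)
  ultimately show ?thesis by (intro exI[of _ "(?a, s)"]) simp
qed

text \<open>Given a strategy \<open>N\<close> for extending conditions, a closure point \<open>\<beta>\<close> of \<open>top\<close> along all plays is
  found first; then plays using only ordinals below \<open>\<alpha>\<close> and from a countable cofinal \<open>v \<subseteq> \<beta>\<close> can be
  amalgamated to a condition with last entry \<open>(\<alpha>, \<beta>)\<close>.\<close>

abbreviation play :: "('o \<times> ('o \<Rightarrow> 'o) \<Rightarrow> 'o \<times> 'o \<Rightarrow> 'o \<times> ('o \<Rightarrow> 'o)) \<Rightarrow> 'o \<times> ('o \<Rightarrow> 'o) \<Rightarrow> ('o \<times> 'o) list \<Rightarrow> 'o \<times> ('o \<Rightarrow> 'o)"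
  where "play N p0 l \<equiv> fold (\<lambda>e p. N p e) l p0"

lemma moves_mono:
  fixes \<alpha> \<alpha>' \<beta> :: 'o
  assumes "set l \<subseteq> {..<\<alpha>} \<times> v" "\<alpha> \<le> \<alpha>'" "v \<subseteq> w"
  shows "set l \<subseteq> {..<\<alpha>'} \<times> w"
  by (rule order_trans[OF assms(1)]) (rule Sigma_mono, use assms(2,3) in auto)

definition strategy where
  "strategy D \<alpha>' N \<longleftrightarrow> (\<forall>p\<in>D. cond p \<and> (\<forall>b<\<alpha>'. \<forall>\<eta>< om 2.
    N p (b, \<eta>) \<in> D \<and> ext (N p (b, \<eta>)) p \<and> b < fst (N p (b, \<eta>)) \<and> \<eta> < top (N p (b, \<eta>))))"

lemma strategyD:
  assumes "strategy D \<alpha>' N" "p \<in> D"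
  shows "cond p" "b < \<alpha>' \<Longrightarrow> \<eta> < om 2 \<Longrightarrow> N p (b, \<eta>) \<in> D" "b < \<alpha>' \<Longrightarrow> \<eta> < om 2 \<Longrightarrow> ext (N p (b, \<eta>)) p"
    "b < \<alpha>' \<Longrightarrow> \<eta> < om 2 \<Longrightarrow> b < fst (N p (b, \<eta>))" "b < \<alpha>' \<Longrightarrow> \<eta> < om 2 \<Longrightarrow> \<eta> < top (N p (b, \<eta>))"
  using assms unfolding strategy_def by auto

lemma play_in:
  assumes N: "strategy D \<alpha>' N" and p0: "p0 \<in> D"
  shows "set l \<subseteq> {..<\<alpha>'} \<times> {..<om 2} \<Longrightarrow> play N p0 l \<in> D"
proof (induction l rule: rev_induct)
  case (snoc e l)
  then show ?case using strategyD(2)[OF N, of "play N p0 l" "fst e" "snd e"] by (cases e) auto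
qed (simp add: p0)

text \<open>There are at most \<open>\<aleph>\<^sub>1\<close> moves below a given \<beta>, so the
  \<beta> closed under all finite plays form a club in \<open>\<omega>\<^sub>2\<close> and meet
  \<open>S k\<close>. A countable cofinal \<open>v\<close> then thins out the moves.\<close>

lemma ex_closed_top:
  assumes N: "strategy D \<alpha>' N" and p0: "p0 \<in> D" and a: "\<alpha>' \<le> om 1" and y: "y0 < om 2"
  obtains \<beta> v where "\<beta> \<in> S k" "y0 < \<beta>" "countable v" "v \<subseteq> {..<\<beta>}" "\<forall>z<\<beta>. \<exists>u\<in>v. z < u"
    "\<forall>l. set l \<subseteq> {..<\<alpha>'} \<times> v \<longrightarrow> top (play N p0 l) < \<beta>"
proof -
  let ?Q = "\<lambda>\<beta>. {..<\<alpha>'} \<times> {..<\<beta>}"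
  have c2: "cof_gt (aleph 1) (om 2 :: 'o)" by (rule cof_om_le[of 1]) (auto intro: card_of_mono1)
  have c2n: "cof_gt (UNIV::nat set) (om 2 :: 'o)" by (rule cof_om_nat) simp
  have C: "club (om 2) {\<beta>. \<beta> < om 2 \<and> (\<forall>l. set l \<subseteq> ?Q \<beta> \<longrightarrow> top (play N p0 l) < \<beta>)}"
  proof (rule club_closure_points[OF c2 infinite_aleph])
    fix \<beta> :: 'o assume b: "\<beta> < om 2"
    have "|{..<\<beta>}| \<le>o |aleph 1|" by (rule om_Suc(2)) (use b in \<open>simp add: numeral_2_eq_2\<close>)
    moreover have "|{..<\<alpha>'}| \<le>o |aleph 1|" by (rule card_of_mono1) (use a in auto)
    ultimately show "|?Q \<beta>| \<le>o |aleph 1|" by (intro le_Times infinite_aleph)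
    fix l assume "set l \<subseteq> ?Q \<beta>"
    then have "set l \<subseteq> {..<\<alpha>'} \<times> {..<om 2}" by (rule moves_mono[OF _ order_refl]) (use b in auto)
    then show "top (play N p0 l) < om 2" by (intro top_less strategyD(1)[OF N] play_in[OF N p0])
  next
    show "?Q \<alpha> \<subseteq> ?Q \<beta>" if "\<alpha> \<le> \<beta>" for \<alpha> \<beta> :: 'o using that by auto
  next
    fix \<alpha> w :: 'o and e assume lim: "\<And>x. x < \<alpha> \<Longrightarrow> \<exists>z. x < z \<and> z < \<alpha>" and e: "e \<in> ?Q \<alpha>"
    from e have "snd e < \<alpha>" by auto
    from lim[OF this] obtain z where "snd e < z" "z < \<alpha>" by blast
    then show "\<exists>\<beta><\<alpha>. e \<in> ?Q \<beta>" using e by (intro exI[of _ z]) auto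
  qed
  from stationaryD[OF S(2) club_Int[OF c2n C club_tail[OF c2n y]]]
  obtain \<beta> where b: "\<beta> \<in> S k" "y0 < \<beta>" "\<forall>l. set l \<subseteq> ?Q \<beta> \<longrightarrow> top (play N p0 l) < \<beta>" by blast
  obtain v where v: "countable v" "v \<subseteq> {..<\<beta>}" "\<forall>z<\<beta>. \<exists>u\<in>v. z < u"
    using S(1)[OF b(1)] unfolding cof_omega_def by auto
  have "top (play N p0 l) < \<beta>" if "set l \<subseteq> {..<\<alpha>'} \<times> v" for l
  proof -
    have "set l \<subseteq> ?Q \<beta>" by (rule moves_mono[OF that order_refl v(2)])
    then show ?thesis using b(3) by blast
  qed
  then show ?thesis using that b(1,2) v by blast
qed

text \<open>One play of length \<omega> makes all moves from the countable set
  \<open>{..<\<alpha>} \<times> v\<close>. Each move lifts length and top above its entries, while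
  closure keeps every finite stage below \<alpha> and \<beta>, so the suprema are exactly \<alpha>
  and \<beta>.\<close>

lemma limit_condition:
  assumes N: "strategy D \<alpha>' N" and p0: "p0 \<in> D" and a: "\<alpha> \<le> \<alpha>'" "\<alpha> < om 1"
    and cl: "\<forall>l. set l \<subseteq> {..<\<alpha>} \<times> v \<longrightarrow> fst (play N p0 l) < \<alpha>"
    and b: "\<beta> \<in> S (c \<alpha>)" and v: "countable v" "v \<subseteq> {..<\<beta>}" "\<forall>z<\<beta>. \<exists>u\<in>v. z < u"
    and top: "\<forall>l. set l \<subseteq> {..<\<alpha>} \<times> v \<longrightarrow> top (play N p0 l) < \<beta>"
  obtains t e where "cond t" "fst t = \<alpha>" "top t = \<beta>" "range e = {..<\<alpha>} \<times> v"
    "\<forall>n::nat. ext t (play N p0 (map e [0..<n]))"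
proof -
  have b2: "\<beta> < om 2" using S(1)[OF b] by simp
  have p0a: "fst p0 < \<alpha>" "top p0 < \<beta>" using cl[rule_format, of "[]"] top[rule_format, of "[]"] by simp_all
  then have v0: "v \<noteq> {}" using v(3) by blast
  have "|{..<\<alpha>}| \<le>o |aleph 0|" by (rule om_Suc(2)) (use a in simp)
  then have "countable {..<\<alpha>}" using countable_aleph0 by (rule le_countable_set)
  then have "countable ({..<\<alpha>} \<times> v)" using v(1) by simp
  moreover have "{..<\<alpha>} \<times> v \<noteq> {}" using p0a(1) v0 by auto
  ultimately have re: "range (from_nat_into ({..<\<alpha>} \<times> v)) = {..<\<alpha>} \<times> v" by (rule range_from_nat_into[rotated])
  define e where "e = from_nat_into ({..<\<alpha>} \<times> v)"
  note re = re[folded e_def]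
  define p where "p n = play N p0 (map e [0..<n])" for n
  have sub: "set (map e [0..<n]) \<subseteq> {..<\<alpha>} \<times> v" for n using re by auto
  have vb: "u < om 2" if "u \<in> v" for u using v(2) that b2 by (auto intro: less_trans)
  have "set (map e [0..<n]) \<subseteq> {..<\<alpha>'} \<times> {..<om 2}" for n
    by (rule moves_mono[OF sub a(1)]) (use vb in auto)
  then have pD: "p n \<in> D" for n unfolding p_def by (rule play_in[OF N p0])
  have ps: "p (Suc n) = N (p n) (fst (e n), snd (e n))" for n unfolding p_def by simp
  have ev: "fst (e n) < \<alpha>'" "snd (e n) < om 2" for n
  proof -
    have "e n \<in> {..<\<alpha>} \<times> v" using re by auto
    then show "fst (e n) < \<alpha>'" "snd (e n) < om 2" using a(1) vb by auto
  qed
  note sD = strategyD[OF N pD]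
  have "\<exists>t. cond t \<and> fst t = \<alpha> \<and> top t = \<beta> \<and> (\<forall>n. ext t (p n))"
  proof (rule cond_glue[OF sD(1)])
    show "ext (p (Suc n)) (p n)" for n unfolding ps by (rule sD(3)[OF ev(1)[of n] ev(2)[of n]])
    show "fst (p n) < \<alpha>" for n using cl sub unfolding p_def by blast
    show "top (p n) < \<beta>" for n using top sub unfolding p_def by blast
    show "\<alpha> < om 1" "\<beta> \<in> S (c \<alpha>)" by fact+
    show "\<exists>n. x < fst (p n)" if x: "x < \<alpha>" for x
    proof -
      obtain u where "u \<in> v" using v0 by blast
      then have "(x, u) \<in> range e" using re x by auto
      then obtain n where "e n = (x, u)" by auto
      then show ?thesis using sD(4)[OF ev(1)[of n] ev(2)[of n], of n] ps[of n] by (intro exI[of _ "Suc n"]) simp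
    qed
    show "\<exists>n. y < top (p n)" if y: "y < \<beta>" for y
    proof -
      obtain u where u: "u \<in> v" "y < u" using v(3) y by blast
      then have "(fst p0, u) \<in> range e" using re p0a by auto
      then obtain n where "e n = (fst p0, u)" by auto
      then have "u < top (p (Suc n))" using sD(5)[OF ev(1)[of n] ev(2)[of n], of n] ps[of n] by simp
      then show ?thesis using u(2) by (blast intro: less_trans)
    qed
  qed
  then show ?thesis using that re unfolding p_def by blast
qed

text \<open>The limit case is where stationarity enters: the induction hypothesis provides a
  strategy staying below length \<open>a\<close>, and the tops of its plays can be steered to a
  point of \<open>S (c a)\<close>.\<close>

lemma cond_dense:
  "a < om 1 \<Longrightarrow> cond p \<Longrightarrow> fst p < a \<Longrightarrow> \<eta> < om 2 \<Longrightarrow> \<exists>t. cond t \<and> ext t p \<and> fst t = a \<and> \<eta> < top t"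
proof (induction a arbitrary: p \<eta> rule: less_induct)
  case (less a)
  show ?case
  proof (cases "\<exists>a'<a. a = ssup {a'}")
    case True
    then obtain a' where a': "a' < a" "a = ssup {a'}" by blast
    have "fst p \<le> a'" using less_ssup[OF less.prems(3)[unfolded a'(2)]] by simp
    then obtain q where q: "cond q" "ext q p" "fst q = a'"
    proof (cases "fst p = a'")
      case True
      then show ?thesis using that less.prems(2) ext_refl by blast
    next
      case False
      then show ?thesis
        using less.IH[OF a'(1) _ less.prems(2) _ less.prems(4)] that \<open>fst p \<le> a'\<close> a'(1) less.prems(1)
        by (metis le_less less_trans)
    qed
    obtain t where "cond t" "ext t q" "fst t = ssup {fst q}" "\<eta> < top t"
      using cond_succ[OF q(1) less.prems(4)] by blast
    then show ?thesis using q a'(2) ext_trans by metis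
  next
    case False
    have lim: "\<exists>j. k < j \<and> j < a" if k: "k < a" for k
    proof -
      have "ssup {k} \<noteq> a" using False k by blast
      moreover have "k < ssup {k}" by (rule ssup_gt[of _ a]) (use k in auto)
      moreover have "ssup {k} \<le> a" by (rule ssup_le) (use k in auto)
      ultimately show ?thesis by (intro exI[of _ "ssup {k}"]) auto
    qed
    define D where "D = {q. cond q \<and> ext q p \<and> fst q < a}"
    have step: "\<exists>q. q \<in> D \<and> ext q r \<and> b < fst q \<and> y < top q" if r: "r \<in> D" "b < a" "y < om 2" for r b y
    proof -
      have m: "max b (fst r) < a" using r unfolding D_def by simp
      then obtain a' where a': "max b (fst r) < a'" "a' < a" using lim by blast
      have "\<exists>t. cond t \<and> ext t r \<and> fst t = a' \<and> y < top t"
        by (rule less.IH[OF a'(2)]) (use r a' less.prems(1) in \<open>auto simp: D_def\<close>)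
      then obtain t where t: "cond t" "ext t r" "fst t = a'" "y < top t" by blast
      then have "t \<in> D" using a'(2) r(1) ext_trans unfolding D_def by blast
      then show ?thesis using t a'(1) by (intro exI[of _ t]) simp
    qed
    then have "\<forall>x. \<exists>q. fst x \<in> D \<and> fst (snd x) < a \<and> snd (snd x) < om 2 \<longrightarrow>
      q \<in> D \<and> ext q (fst x) \<and> fst (snd x) < fst q \<and> snd (snd x) < top q" by blast
    from choice[OF this] obtain N where "\<forall>x. fst x \<in> D \<and> fst (snd x) < a \<and> snd (snd x) < om 2 \<longrightarrow>
      N x \<in> D \<and> ext (N x) (fst x) \<and> fst (snd x) < fst (N x) \<and> snd (snd x) < top (N x)" by (rule exE)
    then have st: "strategy D a (\<lambda>p e. N (p, e))" unfolding strategy_def by (auto simp: D_def)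
    have pD: "p \<in> D" using less.prems ext_refl unfolding D_def by simp
    obtain \<beta> v where bv: "\<beta> \<in> S (c a)" "\<eta> < \<beta>" "countable v" "v \<subseteq> {..<\<beta>}" "\<forall>z<\<beta>. \<exists>u\<in>v. z < u"
      "\<forall>l. set l \<subseteq> {..<a} \<times> v \<longrightarrow> top (play (\<lambda>p e. N (p, e)) p l) < \<beta>"
      by (rule ex_closed_top[OF st pD less_imp_le[OF less.prems(1)] less.prems(4)])
    have b2: "\<beta> < om 2" using S(1)[OF bv(1)] by simp
    have "fst (play (\<lambda>p e. N (p, e)) p l) < a" if l: "set l \<subseteq> {..<a} \<times> v" for l
    proof -
      have "set l \<subseteq> {..<a} \<times> {..<om 2}" by (rule moves_mono[OF l order_refl]) (use less_trans[OF _ b2] bv(4) in auto)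
      from play_in[OF st pD this] show ?thesis unfolding D_def by simp
    qed
    then have cl: "\<forall>l. set l \<subseteq> {..<a} \<times> v \<longrightarrow> fst (play (\<lambda>p e. N (p, e)) p l) < a" by blast
    obtain t e where t: "cond t" "fst t = a" "top t = \<beta>" "range e = {..<a} \<times> v"
      "\<forall>n::nat. ext t (play (\<lambda>p e. N (p, e)) p (map e [0..<n]))"
      by (rule limit_condition[OF st pD order_refl less.prems(1) cl bv(1,3-6)])
    have "ext t p" using t(5)[rule_format, of 0] by simp
    then show ?thesis using t(1-3) bv(2) by blast
  qed
qed

section \<open>The forcing notion and preservation of stationary sets\<close>

definition frc :: "('o \<times> ('o \<Rightarrow> 'o)) rel" where
  "frc = {(q, p). cond q \<and> cond p \<and> ext q p}"

lemma Field_frc: "Field frc = {p. cond p}"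
  unfolding frc_def Field_def using ext_refl by auto

lemma forcing_notion_frc: "forcing_notion frc"
proof -
  have z: "cond ((LEAST x. True), \<lambda>i. if i = (LEAST x. True) then (LEAST x. True) else om 2)"
  proof -
    have l: "(LEAST x::'o. True) \<le> x" for x by (rule Least_le) simp
    have n: "(LEAST x::'o. True) < om m" for m using om_pos[of m] l by (meson le_less_trans)
    have nl: "\<not> lim_ord (LEAST x::'o. True)" unfolding lim_ord_def using l by (meson not_le)
    show ?thesis unfolding cond_def fst_conv snd_conv using l n nl by (auto simp: antisym_conv dest: leD)
  qed
  have "trans frc" unfolding trans_def frc_def using ext_trans by blast
  moreover have "refl_on (Field frc) frc" unfolding refl_on_def Field_frc unfolding frc_def using ext_refl by auto
  moreover have "frc \<noteq> {}" unfolding frc_def using z ext_refl by blast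
  moreover have "frc \<subseteq> Field frc \<times> Field frc" unfolding Field_def by auto
  ultimately show ?thesis unfolding forcing_notion_def preorder_on_def by blast
qed

lemma f_mem_mono: "(t', t) \<in> frc \<Longrightarrow> f_mem frc M a t \<Longrightarrow> f_mem frc M a t'"
proof -
  have "trans frc" using forcing_notion_frc unfolding forcing_notion_def preorder_on_def by blast
  then show "(t', t) \<in> frc \<Longrightarrow> f_mem frc M a t \<Longrightarrow> f_mem frc M a t'"
    unfolding f_mem_def trans_def by blast
qed

lemma frc_trans: "(t, q) \<in> frc \<Longrightarrow> (q, p) \<in> frc \<Longrightarrow> (t, p) \<in> frc"
  unfolding frc_def using ext_trans by blast

text \<open>Some fibre \<open>c = k\<close> meets \<open>A\<close> in a stationary set. With
  \<open>k\<close> fixed, \<beta> in \<open>S k\<close> is found first, closed under plays whose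
  moves use any ordinal below \<open>\<omega>\<^sub>1\<close>; only then is \<alpha> taken from that
  fibre, closed under plays from \<open>{..<\<alpha>} \<times> v\<close>. Since
  \<open>c \<alpha> = k\<close>, the amalgam may put \<beta> at position \<alpha>, and it forces
  \<open>\<pi> \<alpha>\<close> into the named club.\<close>

lemma forces_stationary_frc:
  assumes A: "stationary_omega1 A" and M: "name_omega1 frc M"
  shows "f_imp frc (f_club frc M) (f_ex frc A (f_mem frc M)) p"
  unfolding f_imp_def f_ex_def
proof (intro allI impI)
  fix q q1 assume q: "(q, p) \<in> frc" and cl: "f_club frc M q" and q1: "(q1, q) \<in> frc"
  obtain \<pi> :: "'o \<Rightarrow> nat set" where bij: "bij_betw \<pi> (aleph 1) (Field aleph1)"
    and ord: "\<forall>x\<in>aleph 1. \<forall>y\<in>aleph 1. (\<pi> x, \<pi> y) \<in> aleph1 \<longleftrightarrow> x \<le> y"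
    using aleph1_iso by blast
  have pF: "\<pi> x \<in> Field aleph1" if "x < om 1" for x using bij that unfolding bij_betw_def by auto
  have pinj: "\<pi> x = \<pi> y \<longleftrightarrow> x = y" if "x < om 1" "y < om 1" for x y
    using bij that unfolding bij_betw_def inj_on_def by auto
  have psur: "\<exists>x. x < om 1 \<and> a = \<pi> x" if "a \<in> Field aleph1" for a using bij that unfolding bij_betw_def by auto
  have above: "aboveS aleph1 (\<pi> x) = \<pi> ` {y. x < y \<and> y < om 1}" if x: "x < om 1" for x
  proof (intro set_eqI iffI)
    fix a assume a: "a \<in> aboveS aleph1 (\<pi> x)"
    then have "a \<in> Field aleph1" unfolding aboveS_def Field_def by auto
    then obtain y where y: "y < om 1" "a = \<pi> y" using psur by blast
    then have "x \<le> y" "x \<noteq> y" using a ord x unfolding aboveS_def by auto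
    then show "a \<in> \<pi> ` {y. x < y \<and> y < om 1}" using y by auto
  next
    fix a assume "a \<in> \<pi> ` {y. x < y \<and> y < om 1}"
    then show "a \<in> aboveS aleph1 (\<pi> x)" using ord x pinj unfolding aboveS_def by auto
  qed
  have under: "underS aleph1 (\<pi> x) = \<pi> ` {..<x}" if x: "x < om 1" for x
  proof (intro set_eqI iffI)
    fix a assume a: "a \<in> underS aleph1 (\<pi> x)"
    then have "a \<in> Field aleph1" unfolding underS_def Field_def by auto
    then obtain y where y: "y < om 1" "a = \<pi> y" using psur by blast
    then have "y \<le> x" "x \<noteq> y" using a ord x unfolding underS_def by auto
    then show "a \<in> \<pi> ` {..<x}" using y by auto
  next
    fix a assume "a \<in> \<pi> ` {..<x}"
    then obtain y where y: "y < x" "a = \<pi> y" by auto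
    then have "y < om 1" using x by (auto intro: less_trans)
    then show "a \<in> underS aleph1 (\<pi> x)" using y ord x pinj unfolding underS_def by auto
  qed
  have C1: "\<exists>t. (t, r) \<in> frc \<and> (\<exists>x\<in>aboveS aleph1 a. f_mem frc M x t)" if "a \<in> Field aleph1" "(r, q) \<in> frc" for a r
    using cl that unfolding f_club_def f_conj_def f_all_def f_ex_def by blast
  have C2: "f_mem frc M d t" if d: "d \<in> Field aleph1" "underS aleph1 d \<noteq> {}" and t: "(t, q) \<in> frc"
    and all: "\<forall>a\<in>underS aleph1 d. f_ex frc (aboveS aleph1 a \<inter> underS aleph1 d) (f_mem frc M) t" for d t
  proof -
    have "f_imp frc (f_all (underS aleph1 d) (\<lambda>a. f_ex frc (aboveS aleph1 a \<inter> underS aleph1 d) (f_mem frc M)))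
      (f_mem frc M d) q"
      using cl d unfolding f_club_def f_conj_def f_all_def[of "{d \<in> Field aleph1. underS aleph1 d \<noteq> {}}"] by blast
    then show ?thesis using t all unfolding f_imp_def f_all_def by blast
  qed
  define D where "D = {r. (r, q1) \<in> frc}"
  have q1c: "cond q1" using q1 unfolding frc_def by simp
  have q1D: "q1 \<in> D" using q1c ext_refl unfolding D_def frc_def by simp
  \<comment> \<open>Each move also forces some \<open>\<pi> y\<close> with \<open>b < y\<close> into
    the named club, so a play that exhausts all \<open>b < \<alpha>\<close> makes that club
    unbounded below \<open>\<pi> \<alpha>\<close>.\<close>
  have step: "\<exists>t y. t \<in> D \<and> ext t r \<and> b < fst t \<and> \<eta> < top t \<and> b < y \<and> y < om 1 \<and> f_mem frc M (\<pi> y) t"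
    if r: "r \<in> D" "b < om 1" "\<eta> < om 2" for r b \<eta>
  proof -
    have rc: "cond r" using r(1) unfolding D_def frc_def by simp
    have "max b (fst r) < om 1" using r(2) condD(1)[OF rc] by simp
    then obtain a' where a': "max b (fst r) < a'" "a' < om 1" using om_limit by blast
    then obtain s where s: "cond s" "ext s r" "fst s = a'" "\<eta> < top s"
      using cond_dense[OF a'(2) rc _ r(3)] by auto
    have sr: "(s, r) \<in> frc" using s rc unfolding frc_def by simp
    then have sq1: "(s, q1) \<in> frc" using r(1) frc_trans unfolding D_def by blast
    then have "(s, q) \<in> frc" using q1 by (rule frc_trans)
    from C1[OF pF[OF r(2)] this] obtain t x where t: "(t, s) \<in> frc" "x \<in> aboveS aleph1 (\<pi> b)" "f_mem frc M x t"
      by blast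
    then obtain y where y: "b < y" "y < om 1" "x = \<pi> y" unfolding above[OF r(2)] by auto
    have ts: "cond t" "ext t s" using t(1) unfolding frc_def by auto
    have "t \<in> D" using frc_trans[OF t(1) sq1] unfolding D_def by simp
    moreover have "ext t r" using ext_trans[OF ts(2) s(2)] .
    moreover have "b < fst t" using ext_len[OF ts(2)] s(3) a'(1) by (auto intro: less_le_trans)
    moreover have "\<eta> < top t" using top_mono[OF ts] s(4) by simp
    ultimately show ?thesis using y t(3) by blast
  qed
  have "\<forall>x. \<exists>ty. fst x \<in> D \<and> fst (snd x) < om 1 \<and> snd (snd x) < om 2 \<longrightarrow>
    fst ty \<in> D \<and> ext (fst ty) (fst x) \<and> fst (snd x) < fst (fst ty) \<and> snd (snd x) < top (fst ty) \<and>
    fst (snd x) < snd ty \<and> snd ty < om 1 \<and> f_mem frc M (\<pi> (snd ty)) (fst ty)"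
    using step by simp
  from choice[OF this] obtain N0 where N0: "\<forall>x. fst x \<in> D \<and> fst (snd x) < om 1 \<and> snd (snd x) < om 2 \<longrightarrow>
    fst (N0 x) \<in> D \<and> ext (fst (N0 x)) (fst x) \<and> fst (snd x) < fst (fst (N0 x)) \<and> snd (snd x) < top (fst (N0 x)) \<and>
    fst (snd x) < snd (N0 x) \<and> snd (N0 x) < om 1 \<and> f_mem frc M (\<pi> (snd (N0 x))) (fst (N0 x))" by (rule exE)
  define N where "N p e = fst (N0 (p, e))" for p e
  define Y where "Y p e = snd (N0 (p, e))" for p e
  have st: "strategy D (om 1) N"
    unfolding strategy_def N_def using N0 by (auto simp: D_def frc_def)
  have Y: "fst e < Y r e" "Y r e < om 1" "f_mem frc M (\<pi> (Y r e)) (N r e)"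
    if "r \<in> D" "fst e < om 1" "snd e < om 2" for r e
    using N0[rule_format, of "(r, e)"] that unfolding Y_def N_def by auto
  have c1: "cof_gt (UNIV::nat set) (om 1 :: 'o)" by (rule cof_om_nat) simp
  have "stationary (om 1) {i. i < om 1 \<and> \<pi> i \<in> A}"
    unfolding stationary_def
  proof (intro allI impI)
    fix E :: "'o set" assume E: "club (om 1) E"
    have "club_omega1 (\<pi> ` E)"
      unfolding club_omega1_def
    proof (intro conjI ballI impI)
      show "\<pi> ` E \<subseteq> Field aleph1" using pF clubD_sub[OF E] by blast
      fix a assume "a \<in> Field aleph1"
      then obtain x where x: "x < om 1" "a = \<pi> x" using psur by blast
      obtain y where "y \<in> E" "x < y" using clubD_unb[OF E x(1)] by blast
      then show "\<exists>b\<in>aboveS aleph1 a. b \<in> \<pi> ` E" unfolding x(2) above[OF x(1)] using clubD_sub[OF E] by blast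
    next
      fix d assume "d \<in> Field aleph1"
        and l: "underS aleph1 d \<noteq> {} \<and> (\<forall>a\<in>underS aleph1 d. \<exists>b\<in>aboveS aleph1 a \<inter> underS aleph1 d. b \<in> \<pi> ` E)"
      then obtain x where x: "x < om 1" "d = \<pi> x" using psur by blast
      then obtain w where w: "w < x" using l unfolding x(2) under[OF x(1)] by auto
      have "x \<in> E"
      proof (rule clubD_closed[OF E x(1) w])
        fix z assume z: "z < x"
        then have z1: "z < om 1" using x(1) by (rule less_trans)
        have "\<pi> z \<in> underS aleph1 d" unfolding x(2) under[OF x(1)] using z by simp
        then obtain b where b: "b \<in> aboveS aleph1 (\<pi> z)" "b \<in> underS aleph1 d" "b \<in> \<pi> ` E" using l by blast
        then obtain y where y: "y \<in> E" "b = \<pi> y" by blast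
        have y1: "y < om 1" using y(1) clubD_sub[OF E] by blast
        have "z < y" using b(1) unfolding y(2) above[OF z1] using pinj y1 by auto
        moreover have "y < x" using b(2) unfolding y(2) x(2) under[OF x(1)] using pinj y1 x(1) by (auto intro: less_trans)
        ultimately show "\<exists>y\<in>E. z < y \<and> y < x" using y(1) by blast
      qed
      then show "d \<in> \<pi> ` E" using x(2) by blast
    qed
    then obtain a where a: "a \<in> A" "a \<in> \<pi> ` E" using A unfolding stationary_omega1_def by blast
    then show "\<exists>i\<in>{i. i < om 1 \<and> \<pi> i \<in> A}. i \<in> E" using clubD_sub[OF E] by blast
  qed
  from stationary_split[OF c1 this, of c] obtain k
    where k: "stationary (om 1) {i \<in> {i. i < om 1 \<and> \<pi> i \<in> A}. c i = k}" by blast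
  obtain y0 where y0: "y0 < (om 2 :: 'o)" using om_pos by blast
  obtain \<beta> v where bv: "\<beta> \<in> S k" "y0 < \<beta>" "countable v" "v \<subseteq> {..<\<beta>}" "\<forall>z<\<beta>. \<exists>u\<in>v. z < u"
    "\<forall>l. set l \<subseteq> {..<om 1} \<times> v \<longrightarrow> top (play N q1 l) < \<beta>"
    by (rule ex_closed_top[OF st q1D order_refl y0])
  have b2: "\<beta> < om 2" using S(1)[OF bv(1)] by simp
  have v2: "u < om 2" if "u \<in> v" for u using bv(4) that b2 by (auto intro: less_trans)
  \<comment> \<open>Closure under \<open>g\<close> bounds both the length reached and the club
    element decided by the last move. The value at \<open>[]\<close> puts \<alpha> above the length
    of \<open>q1\<close>.\<close>
  define g where "g l = (if l = [] then fst q1 else max (fst (play N q1 l)) (Y (play N q1 (butlast l)) (last l)))" for l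
  have C: "club (om 1) {\<alpha>. \<alpha> < om 1 \<and> (\<forall>l. set l \<subseteq> {..<\<alpha>} \<times> v \<longrightarrow> g l < \<alpha>)}"
  proof (rule club_closure_points[OF c1])
    fix \<alpha> :: 'o assume a: "\<alpha> < om 1"
    have "|{..<\<alpha>}| \<le>o |aleph 0|" by (rule om_Suc(2)) (use a in simp)
    then have "countable {..<\<alpha>}" using countable_aleph0 by (rule le_countable_set)
    then have "countable ({..<\<alpha>} \<times> v)" using bv(3) by simp
    then show "|{..<\<alpha>} \<times> v| \<le>o |UNIV::nat set|" using countable_iff_le by blast
    fix l assume l: "set l \<subseteq> {..<\<alpha>} \<times> v"
    then have l2: "set l \<subseteq> {..<om 1} \<times> {..<om 2}" by (intro moves_mono[OF l less_imp_le[OF a]]) (use v2 in auto)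
    show "g l < om 1"
    proof (cases "l = []")
      case True
      then show ?thesis unfolding g_def using condD(1)[OF q1c] by simp
    next
      case False
      have "fst (play N q1 l) < om 1" by (intro condD(1) strategyD(1)[OF st] play_in[OF st q1D l2])
      moreover have "Y (play N q1 (butlast l)) (last l) < om 1"
      proof (rule Y(2))
        show "play N q1 (butlast l) \<in> D" by (rule play_in[OF st q1D]) (use l2 in \<open>auto dest: in_set_butlastD\<close>)
        show "fst (last l) < om 1" "snd (last l) < om 2" using l2 last_in_set[OF False] by auto
      qed
      ultimately show ?thesis unfolding g_def using False by simp
    qed
  next
    show "{..<\<alpha>} \<times> v \<subseteq> {..<\<beta>} \<times> v" if "\<alpha> \<le> \<beta>" for \<alpha> \<beta> :: 'o using that by auto
  next
    fix \<alpha> w :: 'o and e assume lim: "\<And>x. x < \<alpha> \<Longrightarrow> \<exists>z. x < z \<and> z < \<alpha>" and e: "e \<in> {..<\<alpha>} \<times> v"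
    from e have "fst e < \<alpha>" by auto
    from lim[OF this] obtain z where "fst e < z" "z < \<alpha>" by blast
    then show "\<exists>\<beta><\<alpha>. e \<in> {..<\<beta>} \<times> v" using e by (intro exI[of _ z]) auto
  qed simp
  from stationaryD[OF k C] obtain \<alpha> where al: "\<alpha> < om 1" "\<pi> \<alpha> \<in> A" "c \<alpha> = k"
    "\<And>l. set l \<subseteq> {..<\<alpha>} \<times> v \<Longrightarrow> g l < \<alpha>" by auto
  have q1a: "fst q1 < \<alpha>" using al(4)[of "[]"] unfolding g_def by simp
  have "fst (play N q1 l) < \<alpha>" if l: "set l \<subseteq> {..<\<alpha>} \<times> v" for l
    using al(4)[OF l] q1a unfolding g_def by (cases "l = []") auto
  then have cl1: "\<forall>l. set l \<subseteq> {..<\<alpha>} \<times> v \<longrightarrow> fst (play N q1 l) < \<alpha>" by blast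
  have cl2: "\<forall>l. set l \<subseteq> {..<\<alpha>} \<times> v \<longrightarrow> top (play N q1 l) < \<beta>"
  proof (intro allI impI)
    fix l assume "set l \<subseteq> {..<\<alpha>} \<times> v"
    then have "set l \<subseteq> {..<om 1} \<times> v" by (rule moves_mono) (use less_imp_le[OF al(1)] in auto)
    then show "top (play N q1 l) < \<beta>" using bv(6) by blast
  qed
  have bS: "\<beta> \<in> S (c \<alpha>)" using bv(1) al(3) by simp
  obtain t e where t: "cond t" "fst t = \<alpha>" "top t = \<beta>" "range e = {..<\<alpha>} \<times> v"
    "\<forall>n::nat. ext t (play N q1 (map e [0..<n]))"
    by (rule limit_condition[OF st q1D less_imp_le[OF al(1)] al(1) cl1 bS bv(3-5) cl2])
  have tq1: "(t, q1) \<in> frc" using t(1) t(5)[rule_format, of 0] q1c unfolding frc_def by simp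
  have "f_mem frc M (\<pi> \<alpha>) t"
  proof (rule C2[OF pF[OF al(1)] _ frc_trans[OF tq1 q1]])
    show "underS aleph1 (\<pi> \<alpha>) \<noteq> {}" unfolding under[OF al(1)] using q1a by blast
    show "\<forall>a\<in>underS aleph1 (\<pi> \<alpha>). f_ex frc (aboveS aleph1 a \<inter> underS aleph1 (\<pi> \<alpha>)) (f_mem frc M) t"
    proof
      fix a assume "a \<in> underS aleph1 (\<pi> \<alpha>)"
      then obtain a' where a': "a' < \<alpha>" "a = \<pi> a'" unfolding under[OF al(1)] by auto
      then have a1: "a' < om 1" using al(1) by (auto intro: less_trans)
      have "0 < (1::nat) \<and> top q1 < \<beta>" using cl2[rule_format, of "[]"] by simp
      then obtain u where "u \<in> v" using bv(5) by blast
      then have "(a', u) \<in> range e" using t(4) a'(1) by auto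
      then obtain n where n: "e n = (a', u)" by auto
      let ?l = "map e [0..<n]"
      have sub: "set (map e [0..<m]) \<subseteq> {..<\<alpha>} \<times> v" for m using t(4) by auto
      have "set ?l \<subseteq> {..<om 1} \<times> {..<om 2}" by (rule moves_mono[OF sub less_imp_le[OF al(1)]]) (use v2 in auto)
      then have pD: "play N q1 ?l \<in> D" by (rule play_in[OF st q1D])
      have u2: "snd (e n) < om 2" using n v2[OF \<open>u \<in> v\<close>] by simp
      have e1: "fst (e n) < om 1" using n a1 by simp
      define y where "y = Y (play N q1 ?l) (e n)"
      have y: "a' < y" "f_mem frc M (\<pi> y) (N (play N q1 ?l) (e n))" "y < om 1"
        using Y[OF pD e1 u2] n unfolding y_def by simp_all
      have "g (map e [0..<Suc n]) < \<alpha>" by (rule al(4)[OF sub])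
      then have ya: "y < \<alpha>" unfolding g_def y_def by (simp add: butlast_append)
      have ps: "play N q1 (map e [0..<Suc n]) = N (play N q1 ?l) (e n)" by simp
      have "set (map e [0..<Suc n]) \<subseteq> {..<om 1} \<times> {..<om 2}" by (rule moves_mono[OF sub less_imp_le[OF al(1)]]) (use v2 in auto)
      from strategyD(1)[OF st play_in[OF st q1D this]] t(1) t(5)[rule_format, of "Suc n"]
      have "(t, N (play N q1 ?l) (e n)) \<in> frc" unfolding frc_def by simp
      from f_mem_mono[OF this y(2)] have fm: "f_mem frc M (\<pi> y) t" .
      have yin: "\<pi> y \<in> aboveS aleph1 a \<inter> underS aleph1 (\<pi> \<alpha>)"
        unfolding a'(2) above[OF a1] under[OF al(1)] using y(1,3) ya by blast
      show "f_ex frc (aboveS aleph1 a \<inter> underS aleph1 (\<pi> \<alpha>)) (f_mem frc M) t"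
        unfolding f_ex_def
      proof (intro allI impI)
        fix q' assume q': "(q', t) \<in> frc"
        then have "(q', q') \<in> frc" using ext_refl unfolding frc_def by simp
        then show "\<exists>ta. (ta, q') \<in> frc \<and> (\<exists>x\<in>aboveS aleph1 a \<inter> underS aleph1 (\<pi> \<alpha>). f_mem frc M x ta)"
          using f_mem_mono[OF q' fm] yin by blast
      qed
    qed
  qed
  then show "\<exists>t. (t, q1) \<in> frc \<and> (\<exists>x\<in>A. f_mem frc M x t)" using tq1 al(2) by blast
qed

lemma preserves_stationary_frc: "preserves_stationary frc"
  unfolding preserves_stationary_def forces_stationary_def using forces_stationary_frc by blast

text \<open>Meeting the \<open>\<aleph>\<^sub>1\<close> dense sets \<open>Dn a\<close> already
  yields a normal sequence \<open>e\<close> of length \<open>\<omega>\<^sub>1\<close>. A club of its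
  supremum \<gamma> pulls back to a club of \<open>\<omega>\<^sub>1\<close>, which contains a limit
  ordinal \<open>i\<close> with \<open>c i = k\<close>; there \<open>e i \<in> S k\<close>.\<close>

lemma reflect:
  assumes MM: "martins_maximum TYPE('p)" and sz: "|Pow (aleph 2)| \<le>o |UNIV :: 'p set|"
  shows "\<exists>\<gamma> e. \<gamma> < om 2 \<and> normal_to (om 1) \<gamma> e \<and> (\<forall>k. stationary \<gamma> (S k))"
proof -
  \<comment> \<open>To fit into \<open>'p\<close>, conditions are coded by their graphs, which are
    subsets of \<open>\<omega>\<^sub>2 \<times> \<omega>\<^sub>2\<close>. The padding makes the
    graph determine the condition.\<close>
  let ?gr = "\<lambda>p :: 'o \<times> ('o \<Rightarrow> 'o). {(i, snd p i) | i. i \<le> fst p}"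
  have "inj_on ?gr (Field frc)"
  proof (rule inj_onI)
    fix p q assume "p \<in> Field frc" "q \<in> Field frc" and e: "?gr p = ?gr q"
    then have c: "cond p" "cond q" unfolding Field_frc by auto
    have iff: "i \<le> fst p \<longleftrightarrow> i \<le> fst q" for i using e by (auto simp: set_eq_iff)
    then have f: "fst p = fst q" by (meson antisym order_refl)
    have "snd p i = snd q i" for i
    proof (cases "i \<le> fst p")
      case True
      then have "(i, snd p i) \<in> ?gr p" by blast
      then show ?thesis unfolding e by auto
    next
      case False
      then show ?thesis using condD(6)[OF c(1)] condD(6)[OF c(2)] f by auto
    qed
    then show "p = q" using f by (simp add: prod_eq_iff fun_eq_iff)
  qed
  moreover have "?gr p \<in> Pow (aleph 2 \<times> aleph 2)" if "p \<in> Field frc" for p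
    using that condD(1,2)[of p] om_strict_mono[of 1 2] unfolding Field_frc by (auto intro: le_less_trans less_trans)
  ultimately have 1: "|Field frc| \<le>o |Pow (aleph 2 \<times> aleph 2)|" by (rule card_of_ordLeqI)
  have "|aleph 2 \<times> aleph 2| \<le>o |aleph 2|" by (intro le_Times infinite_aleph card_of_mono1 order_refl)
  then obtain h where h: "inj_on h (aleph 2 \<times> aleph 2)" "h ` (aleph 2 \<times> aleph 2) \<subseteq> aleph 2"
    unfolding card_of_ordLeq[symmetric] by blast
  have 2: "|Pow (aleph 2 \<times> aleph 2)| \<le>o |Pow (aleph 2)|"
    by (rule card_of_ordLeqI[OF inj_on_image_Pow[OF h(1)]]) (use h(2) in blast)
  from ordLeq_transitive[OF 1 ordLeq_transitive[OF 2 sz]]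
  obtain j :: "'o \<times> ('o \<Rightarrow> 'o) \<Rightarrow> 'p" where j: "inj_on j (Field frc)" unfolding card_of_ordLeq[symmetric] by blast
  define Dn where "Dn a = {p. cond p \<and> a \<le> fst p}" for a
  have "|Dn ` aleph 1| \<le>o aleph1"
    by (rule ordLeq_ordIso_trans[OF card_of_image aleph_ordIso(1)])
  moreover have "dense_in frc D" if D: "D \<in> Dn ` aleph 1" for D
  proof -
    obtain a where a: "a < om 1" "D = Dn a" using D by auto
    show ?thesis
      unfolding dense_in_def Field_frc a(2)
    proof (intro conjI ballI)
      show "Dn a \<subseteq> {p. cond p}" unfolding Dn_def by blast
      fix p assume "p \<in> {p. cond p}"
      then have p: "cond p" by simp
      have "max a (fst p) < om 1" using a(1) condD(1)[OF p] by simp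
      then obtain a' where a': "max a (fst p) < a'" "a' < om 1" using om_limit by blast
      obtain y where "y < (om 2 :: 'o)" using om_pos by blast
      have "fst p < a'" using a'(1) by simp
      from cond_dense[OF a'(2) p this \<open>y < om 2\<close>] obtain t where "cond t" "ext t p" "fst t = a'" by blast
      then show "\<exists>d\<in>Dn a. (d, p) \<in> frc" using a'(1) p unfolding Dn_def frc_def by (intro bexI[of _ t]) auto
    qed
  qed
  ultimately obtain G where G: "filter_in frc G" "\<forall>D\<in>Dn ` aleph 1. G \<inter> D \<noteq> {}"
    using martins_maximum_embed[OF j refl MM forcing_notion_frc preserves_stationary_frc, of "Dn ` aleph 1"] by blast
  have Gc: "cond p" if "p \<in> G" for p using G(1) that unfolding filter_in_def Field_frc by blast
  have "\<exists>p. p \<in> G \<and> i \<le> fst p" if i: "i < om 1" for i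
  proof -
    have "G \<inter> Dn i \<noteq> {}" using G(2) i by simp
    then show ?thesis unfolding Dn_def by blast
  qed
  then obtain P where P: "\<And>i. i < om 1 \<Longrightarrow> P i \<in> G" "\<And>i. i < om 1 \<Longrightarrow> i \<le> fst (P i)" by metis
  define e where "e i = snd (P i) i" for i
  have e: "e i = snd p i" if p: "p \<in> G" "i \<le> fst p" for i p
  proof -
    have i1: "i < om 1" using p(2) condD(1)[OF Gc[OF p(1)]] by (rule le_less_trans)
    obtain t where "(t, p) \<in> frc" "(t, P i) \<in> frc" using G(1) p(1) P(1)[OF i1] unfolding filter_in_def by blast
    then have "ext t p" "ext t (P i)" unfolding frc_def by auto
    then show ?thesis using ext_val p(2) P(2)[OF i1] unfolding e_def by metis
  qed
  have inc: "e i < e j" if "i < j" "j < om 1" for i j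
    using e[OF P(1)[OF that(2)], of i] e[OF P(1)[OF that(2)], of j] P(2)[OF that(2)] that
      condD(3)[OF Gc[OF P(1)[OF that(2)]] P(2)[OF that(2)] that(1)] by simp
  have e2: "e i < om 2" if "i < om 1" for i
    unfolding e_def by (rule condD(2)[OF Gc[OF P(1)[OF that]] P(2)[OF that]])
  have eS: "e i \<in> S (c i)" if "i < om 1" "lim_ord i" for i
    unfolding e_def by (rule condD(4)[OF Gc[OF P(1)[OF that(1)]] P(2)[OF that(1)] that(2)])
  have elim: "\<exists>j<i. y < e j" if "i < om 1" "lim_ord i" and y: "y < e i" for i y
  proof -
    obtain j where j: "j < i" "y < snd (P i) j"
      using condD(5)[OF Gc[OF P(1)[OF \<open>i < om 1\<close>]] P(2)[OF \<open>i < om 1\<close>] \<open>lim_ord i\<close>] y unfolding e_def by blast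
    have "e j = snd (P i) j" by (rule e[OF P(1)[OF \<open>i < om 1\<close>]]) (use j(1) P(2)[OF \<open>i < om 1\<close>] in simp)
    then show ?thesis using j by (intro exI[of _ j]) simp
  qed
  have c1: "cof_gt (UNIV::nat set) (om 1 :: 'o)" by (rule cof_om_nat) simp
  have c2: "cof_gt (aleph 1) (om 2 :: 'o)" by (rule cof_om_le[of 1]) (auto intro: card_of_mono1)
  have "e ` aleph 1 \<subseteq> aleph 2" using e2 by auto
  note ss = cof_gt_ssup[OF c2 this card_of_image]
  define \<gamma> where "\<gamma> = ssup (e ` aleph 1)"
  have N: "normal_to (om 1) \<gamma> e"
    unfolding normal_to_def
  proof (intro conjI allI impI)
    show "\<And>i j. i \<le> j \<and> j < om 1 \<Longrightarrow> e i \<le> e j" using inc by (metis le_less)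
    show "\<And>i. i < om 1 \<Longrightarrow> e i < \<gamma>" unfolding \<gamma>_def using ss(2) by blast
    fix x assume "x < \<gamma>"
    then obtain i where i: "i < om 1" "x \<le> e i" using less_ssup unfolding \<gamma>_def by blast
    obtain j where j: "i < j" "j < om 1" using om_limit[OF i(1)] by blast
    show "\<exists>i< om 1. x < e i" using inc[OF j] i(2) j(2) le_less_trans by blast
  next
    fix i x assume i: "i < om 1" and l: "{..<i} \<noteq> {} \<and> (\<forall>k<i. \<exists>j. k < j \<and> j < i)" and x: "x < e i"
    have "lim_ord i" using l unfolding lim_ord_def by auto
    then show "\<exists>j<i. x < e j" using elim i x by blast
  qed
  have "stationary \<gamma> (S k)" for k
    unfolding stationary_def
  proof (intro allI impI)
    fix E assume E: "club \<gamma> E"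
    from stationaryD[OF c club_Int[OF c1 club_vimage[OF N c1 E] club_lim_ord[OF c1]], of k]
    obtain i where "i < om 1" "c i = k" "e i \<in> E" "lim_ord i" by blast
    then show "\<exists>x\<in>S k. x \<in> E" using eS by blast
  qed
  then show ?thesis using N ss(1) unfolding \<gamma>_def by blast
qed

end

context large_wellorder
begin

theorem joint_reflection_MM:
  assumes "martins_maximum TYPE('p)" "|Pow (aleph 2)| \<le>o |UNIV :: 'p set|"
  shows joint_reflection
  unfolding joint_reflection_def
proof (intro allI impI)
  fix S :: "nat \<Rightarrow> 'o set"
  assume S: "\<forall>k. (\<forall>\<beta>\<in>S k. \<beta> < om 2 \<and> cof_omega \<beta>) \<and> stationary (om 2) (S k)"
  obtain c :: "'o \<Rightarrow> nat" where "\<forall>k. stationary (om 1) {i. i < om 1 \<and> c i = k}"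
    using stationary_partition by blast
  then interpret reflection_forcing T S c
    by unfold_locales (use S in auto)
  show "\<exists>\<gamma> e. \<gamma> < om 2 \<and> normal_to (om 1) \<gamma> e \<and> (\<forall>k. stationary \<gamma> (S k))"
    by (rule reflect[OF assms])
qed

end

section \<open>Noetherian types\<close>

context large_wellorder
begin

lemma noetherian_type_sparse:
  assumes M: "sparse_cofinal (aleph n) M" and k: "Card_order \<kappa>" "|aleph n| =o \<kappa>"
  shows "noetherian_type (PR (A_omega1 M)) \<le>o cardSuc \<kappa>"
proof -
  have "has_op_like_base (PR (A_omega1 M)) (cardSuc |aleph n| )"
    by (rule has_op_like_base_PR[OF M infinite_aleph])
  moreover have "cardSuc |aleph n| \<le>o cardSuc \<kappa>"
    using cardSuc_aleph[OF k] by (rule ordIso_imp_ordLeq)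
  ultimately have "has_op_like_base (PR (A_omega1 M)) (cardSuc \<kappa>)"
    by (rule has_op_like_base_mono)
  then show ?thesis using noetherian_type_le_iff[OF cardSuc_Card_order[OF k(1)]] by blast
qed

lemma noetherian_type_small:
  fixes M :: "'b set"
  assumes "|M| <o |Kw|"
  shows "noetherian_type (PR (A_omega1 M)) \<le>o aleph1"
proof -
  obtain n where "|M| \<le>o |aleph n|" using card_less_Kw[OF assms] by blast
  then obtain h where h: "inj_on h M" "h ` M \<subseteq> aleph n"
    unfolding card_of_ordLeq[symmetric] by blast
  have "sparse_cofinal (aleph 0) (h ` M)"
    by (rule sparse_cofinal_le_aleph[OF card_of_mono1[OF h(2)] infinite_aleph])
  then have "sparse_cofinal (aleph 0) M"
    by (rule sparse_cofinal_bij[OF bij_betw_the_inv_into[OF inj_on_imp_bij_betw[OF h(1)]]])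
  then show ?thesis
    by (rule noetherian_type_sparse[OF _ natLeq_Card_order aleph0_ordIso])
qed

lemma noetherian_type_Kw:
  fixes K :: "'b set"
  assumes K: "|K| =o |Kw|"
    and sparse: "\<And>Z. countable Z \<Longrightarrow> |{\<xi>. \<xi> < L \<and> (\<forall>n\<in>a0. sc \<xi> n \<in> Z)}| \<le>o |aleph n|"
    and k: "Card_order \<kappa>" "|aleph n| =o \<kappa>"
  shows "noetherian_type (PR (A_omega1 K)) \<le>o cardSuc \<kappa>"
proof -
  obtain h where "bij_betw h Kw K" using ordIso_symmetric[OF K] card_of_ordIso by blast
  then have "sparse_cofinal (aleph n) K"
    by (rule sparse_cofinal_bij) (rule sparse_cofinal_Kw[OF infinite_aleph sparse])
  then show ?thesis using k by (rule noetherian_type_sparse)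
qed

lemma noetherian_type_chang:
  fixes K :: "'b set"
  assumes K: "|K| =o |Kw|" and chang: "chang_conjecture_for K"
  shows "aleph2 \<le>o noetherian_type (PR (A_omega1 K))"
proof (rule ccontr)
  obtain h where h: "bij_betw h Kw K" using ordIso_symmetric[OF K] card_of_ordIso by blast
  have sub: "aleph n \<subseteq> Kw" for n unfolding Kw_def by blast
  have inj: "inj_on h (aleph n)" for n using h sub inj_on_subset unfolding bij_betw_def by blast
  have "K = (\<Union>n. h ` aleph n)" using h unfolding bij_betw_def Kw_def by blast
  moreover have "infinite (h ` aleph n)" for n using finite_imageD[OF _ inj] infinite_aleph by blast
  moreover have "|h ` aleph n| <o |K|" for n
  proof -
    have "|aleph (Suc n)| \<le>o |K|"
      by (rule ordLeq_ordIso_trans[OF card_of_mono1[OF sub] ordIso_symmetric[OF K]])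
    then have "|aleph n| <o |K|" by (rule ordLess_ordLeq_trans[OF om_Suc(1)])
    then show ?thesis by (rule ordLeq_ordLess_trans[OF card_of_image])
  qed
  ultimately have no: "\<not> has_op_like_base (PR (A_omega1 K)) aleph1"
    using chang by (rule not_op_like_base_chang)
  have co: "Card_order aleph1" "Card_order (noetherian_type (PR (A_omega1 K)))"
    by (rule cardSuc_Card_order[OF natLeq_Card_order], rule noetherian_type(1))
  assume "\<not> aleph2 \<le>o noetherian_type (PR (A_omega1 K))"
  then have "\<not> aleph1 <o noetherian_type (PR (A_omega1 K))" using cardSuc_ordLess_ordLeq[OF co] by blast
  then have "noetherian_type (PR (A_omega1 K)) \<le>o aleph1"
    using not_ordLess_iff_ordLeq[OF card_order_on_well_order_on[OF co(2)] card_order_on_well_order_on[OF co(1)]] by blast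
  then show False using no noetherian_type_le_iff[OF co(1)] by blast
qed

end

text \<open>Each \<open>om n\<close> injects into \<open>'a\<close>, so the functions in
  \<open>products\<close> embed into \<open>nat \<Rightarrow> 'a\<close>. Passing to sets of such
  functions makes the type strictly larger.\<close>

lemma large_wellorder_wo:
  fixes K :: "'a set"
  assumes K: "above_alephs K"
  shows "large_wellorder TYPE((nat \<Rightarrow> 'a) set wo)"
proof -
  let ?U = "UNIV :: (nat \<Rightarrow> 'a) set wo set"
  have U: "|UNIV :: (nat \<Rightarrow> 'a) set| <o |?U|"
    by (rule ordLess_ordIso_trans[OF card_of_Pow[of "UNIV :: (nat \<Rightarrow> 'a) set", unfolded Pow_UNIV]
          ordIso_symmetric[OF card_of_wo]])
  have "inj (\<lambda>(x::'a) (n::nat). x)" by (auto simp: inj_def fun_eq_iff)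
  then have "|UNIV :: 'a set| \<le>o |UNIV :: (nat \<Rightarrow> 'a) set|"
    unfolding card_of_ordLeq[symmetric] by blast
  then have small: "|B| <o |?U|" for B :: "'a set"
    using ordLeq_ordLess_trans[OF ordLeq_transitive[OF card_of_mono1[OF subset_UNIV]] U] by blast
  have seg: "\<exists>\<nu> :: (nat \<Rightarrow> 'a) set wo. |B| =o |{..<\<nu>}|" for B :: "'a set"
    using segment_of_card[OF small[of B]] by blast
  have ex0: "\<exists>\<nu> :: (nat \<Rightarrow> 'a) set wo. |B| =o |{..<\<nu>}| \<and> infinite {..<\<nu>}"
    if B: "has_card_aleph 0 B" for B :: "'a set"
  proof -
    obtain \<nu> :: "(nat \<Rightarrow> 'a) set wo" where nu: "|B| =o |{..<\<nu>}|" using seg by blast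
    have "natLeq \<le>o |{..<\<nu>}|"
      using ordIso_transitive[OF ordIso_symmetric[OF B[unfolded has_card_aleph.simps]] nu] by (rule ordIso_imp_ordLeq)
    then show ?thesis using nu infinite_iff_natLeq_ordLeq by blast
  qed
  \<comment> \<open>The existence of ordinals of size \<open>\<aleph>\<^sub>n\<close> is only being
    established here, so \<open>om n\<close> is bounded level by level through subsets of
    \<open>'a\<close> of the right size.\<close>
  have le: "|{..<om n :: (nat \<Rightarrow> 'a) set wo}| \<le>o |B|" if "has_card_aleph n B" for n and B :: "'a set"
    using that
  proof (induction n arbitrary: B)
    case 0
    from ex0[OF 0] obtain \<nu> :: "(nat \<Rightarrow> 'a) set wo" where nu: "|B| =o |{..<\<nu>}|" "infinite {..<\<nu>}" by blast
    have "om 0 \<le> \<nu>" unfolding om.simps by (rule Least_le[of "\<lambda>\<alpha>. infinite {..<\<alpha>}", OF nu(2)])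
    then show ?case
      by (intro ordLeq_ordIso_trans[OF card_of_mono1 ordIso_symmetric[OF nu(1)]]) auto
  next
    case (Suc n)
    from Suc.prems obtain C :: "'a set" where C: "has_card_aleph n C" "|B| =o cardSuc |C|"
      unfolding has_card_aleph.simps by blast
    have "|{..<om n :: (nat \<Rightarrow> 'a) set wo}| <o |B|"
      by (rule ordLeq_ordLess_trans[OF Suc.IH[OF C(1)]
            ordLess_ordIso_trans[OF cardSuc_greater[OF card_of_Card_order] ordIso_symmetric[OF C(2)]]])
    moreover obtain \<nu> :: "(nat \<Rightarrow> 'a) set wo" where nu: "|B| =o |{..<\<nu>}|" using seg by blast
    ultimately have "|{..<om n :: (nat \<Rightarrow> 'a) set wo}| <o |{..<\<nu>}|" by (rule ordLess_ordIso_trans)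
    then have "om (Suc n) \<le> \<nu>" unfolding om.simps by (rule Least_le)
    then show ?case
      by (intro ordLeq_ordIso_trans[OF card_of_mono1 ordIso_symmetric[OF nu]]) auto
  qed
  from K have "\<forall>n. \<exists>B :: 'a set. has_card_aleph n B" unfolding above_alephs_def by blast
  from choice[OF this] obtain B :: "nat \<Rightarrow> 'a set" where B: "\<forall>n. has_card_aleph n (B n)" by (rule exE)
  show ?thesis
  proof
    show "\<exists>\<alpha> :: (nat \<Rightarrow> 'a) set wo. infinite {..<\<alpha>}" using ex0[OF B[rule_format]] by blast
    fix n
    obtain C :: "'a set" where C: "has_card_aleph n C" "|B (Suc n)| =o cardSuc |C|"
      using B[rule_format, of "Suc n"] unfolding has_card_aleph.simps by blast
    obtain \<nu> :: "(nat \<Rightarrow> 'a) set wo" where nu: "|B (Suc n)| =o |{..<\<nu>}|" using seg by blast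
    have "|{..<om n :: (nat \<Rightarrow> 'a) set wo}| <o |B (Suc n)|"
      by (rule ordLeq_ordLess_trans[OF le[OF C(1)]
            ordLess_ordIso_trans[OF cardSuc_greater[OF card_of_Card_order] ordIso_symmetric[OF C(2)]]])
    from ordLess_ordIso_trans[OF this nu]
    show "\<exists>\<alpha> :: (nat \<Rightarrow> 'a) set wo. |{..<om n :: (nat \<Rightarrow> 'a) set wo}| <o |{..<\<alpha>}|" by blast
  next
    have "\<forall>n. \<exists>g :: (nat \<Rightarrow> 'a) set wo \<Rightarrow> 'a. inj_on g {..<om n}"
      using le[OF B[rule_format]] unfolding card_of_ordLeq[symmetric] by blast
    from choice[OF this] obtain g :: "nat \<Rightarrow> (nat \<Rightarrow> 'a) set wo \<Rightarrow> 'a"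
      where g: "\<forall>n. inj_on (g n) {..<om n}" by (rule exE)
    have "inj_on (\<lambda>h n. g n (h n)) {h. \<forall>n. h n < om n}"
    proof (rule inj_onI)
      fix h h' :: "nat \<Rightarrow> (nat \<Rightarrow> 'a) set wo"
      assume h: "h \<in> {h. \<forall>n. h n < om n}" "h' \<in> {h. \<forall>n. h n < om n}" and e: "(\<lambda>n. g n (h n)) = (\<lambda>n. g n (h' n))"
      have "h n = h' n" for n
        using inj_onD[OF g[rule_format, of n] fun_cong[OF e, of n]] h by simp
      then show "h = h'" by (rule ext)
    qed
    then have "|{h :: nat \<Rightarrow> (nat \<Rightarrow> 'a) set wo. \<forall>n. h n < om n}| \<le>o |UNIV :: (nat \<Rightarrow> 'a) set|"
      unfolding card_of_ordLeq[symmetric] by blast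
    then show "|{h :: nat \<Rightarrow> (nat \<Rightarrow> 'a) set wo. \<forall>n. h n < om n}| <o |?U|"
      using U by (rule ordLeq_ordLess_trans)
  qed
qed

theorem corollary4p6:
  fixes K :: "'a set"
  assumes "has_card_aleph_omega K"
  shows "(\<forall>M :: 'a set. |M| <o |K| \<longrightarrow> noetherian_type (PR (A_omega1 M)) \<le>o aleph1) \<and>
    noetherian_type (PR (A_omega1 K)) \<le>o aleph4 \<and>
    (chang_conjecture_for K \<longrightarrow> aleph2 \<le>o noetherian_type (PR (A_omega1 K))) \<and>
    (martins_maximum TYPE('a set set set) \<longrightarrow> noetherian_type (PR (A_omega1 K)) \<le>o aleph2)"
proof -
  have "above_alephs K" using assms unfolding has_card_aleph_omega_def by blast
  then interpret W: large_wellorder "TYPE((nat \<Rightarrow> 'a) set wo)" by (rule large_wellorder_wo)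
  have K: "|K| =o |W.Kw|" by (rule W.has_card_aleph_omega_iff[OF assms])
  have co: "Card_order aleph1" "Card_order (cardSuc aleph2)"
    by (intro cardSuc_Card_order natLeq_Card_order)+
  show ?thesis
  proof (intro conjI allI impI)
    fix M :: "'a set" assume "|M| <o |K|"
    from ordLess_ordIso_trans[OF this K] show "noetherian_type (PR (A_omega1 M)) \<le>o aleph1"
      by (rule W.noetherian_type_small)
  next
    show "noetherian_type (PR (A_omega1 K)) \<le>o aleph4"
      by (rule W.noetherian_type_Kw[OF K W.sparse_scale_aleph3 co(2) W.aleph_ordIso(3)])
  next
    assume "chang_conjecture_for K"
    with K show "aleph2 \<le>o noetherian_type (PR (A_omega1 K))" by (rule W.noetherian_type_chang)
  next
    assume MM: "martins_maximum TYPE('a set set set)"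
    \<comment> \<open>Conditions are coded by subsets of \<open>\<omega>\<^sub>2\<close>, and
      \<open>\<omega>\<^sub>2\<close> embeds into \<open>'a\<close>, so the forcing notion fits into
      the type for which Martin's Maximum is assumed.\<close>
    have "|W.aleph 2| \<le>o |W.Kw|" by (rule card_of_mono1) (auto simp: W.Kw_def)
    then have "|W.aleph 2| \<le>o |K|" using ordIso_symmetric[OF K] by (rule ordLeq_ordIso_trans)
    then have "|W.aleph 2| \<le>o |UNIV :: 'a set|" using card_of_mono1[OF subset_UNIV] by (rule ordLeq_transitive)
    then obtain h :: "_ \<Rightarrow> 'a" where "inj_on h (W.aleph 2)" unfolding card_of_ordLeq[symmetric] by blast
    then have "|Pow (W.aleph 2)| \<le>o |UNIV :: 'a set set|" by (rule card_of_ordLeqI[OF inj_on_image_Pow]) simp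
    moreover have "|UNIV :: 'a set set| \<le>o |UNIV :: 'a set set set set|"
      by (rule ordLess_imp_ordLeq[OF ordLess_transitive[OF card_of_Pow[of "UNIV :: 'a set set", unfolded Pow_UNIV]
              card_of_Pow[of "UNIV :: 'a set set set", unfolded Pow_UNIV]]])
    ultimately have "|Pow (W.aleph 2)| \<le>o |UNIV :: 'a set set set set|" by (rule ordLeq_transitive)
    then have joint: W.joint_reflection by (rule W.joint_reflection_MM[OF MM])
    show "noetherian_type (PR (A_omega1 K)) \<le>o aleph2"
      by (rule W.noetherian_type_Kw[OF K W.sparse_scale_aleph1[OF joint] co(1) W.aleph_ordIso(1)])
  qed
qed

end
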